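(* Let $p>1$ be an integer. In the multivariate Gaussian sequence model with noise level $\varepsilon$, let $\hat{\theta}_{\mathrm{BEM}}$ be the blockwise Efron--Morris estimator with the weakly geometric blocks. Then for every $\beta>0$ and every $p\times p$ symmetric positive definite matrix $Q$, $\hat\theta_{\mathrm{BEM}}$ is asymptotically minimax under $L_Q$ on the multivariate Sobolev ellipsoid $\Theta(\beta,Q)$: $$\sup_{\theta\in\Theta(\beta,Q)}R_Q(\theta,\hat{\theta}_{\mathrm{BEM}})\sim\inf_{\hat{\theta}}\sup_{\theta\in\Theta(\beta,Q)}R_Q(\theta,\hat{\theta})\sim P(\beta,Q)\,\varepsilon^{4\beta/(2\beta+1)}$$ as $\varepsilon\to0$, where the infimum is taken over all estimators and $$P(\beta,Q)=(2\beta+1)^{1/(2\beta+1)}\left(\frac{\beta\,\mathrm{tr}(Q^{(\beta+1)/\beta})}{\beta+1}\right)^{2\beta/(2\beta+1)}.$$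
   Context: Multivariate Gaussian sequence model: one observes $y=(y_i)_{i\ge1}$ with $y_i=\theta_i+\varepsilon\xi_i\in\mathbb{R}^p$, $i=1,2,\dots$, where $\varepsilon>0$, $\theta=(\theta_i)_{i\ge1}$ is an unknown sequence in $\mathbb{R}^p$, and $\xi_i\sim\mathrm{N}_p(0,I_p)$ are independent. An estimator $\hat\theta=(\hat\theta_i)_{i\ge 1}$ is a function of $y$. Loss and risk: $L_Q(\theta,\hat\theta)=\sum_{i=1}^\infty(\hat\theta_i-\theta_i)^{\top}Q(\hat\theta_i-\theta_i)$ and $R_Q(\theta,\hat\theta)=\mathrm{E}_\theta[L_Q(\theta,\hat\theta)]$. Multivariate Sobolev ellipsoid: $\Theta(\beta,Q)=\{\theta=(\theta_1,\theta_2,\dots)\mid\sum_{i=1}^\infty a_{\beta,i}^2\,\theta_i^{\top}Q^{-1}\theta_i\le1\}$, where $a_{\beta,i}=i^\beta$ for $i$ even and $a_{\beta,i}=(i-1)^\beta$ for $i$ odd. Weakly geometric blocks (for small $\varepsilon$): $N=\lfloor\varepsilon^{-2}\rfloor$, $\rho_\varepsilon=(\log(1/\varepsilon))^{-1}$, $J=\min\{j\mid\rho_\varepsilon^{-1}(1+\rho_\varepsilon)^j\ge\varepsilon^{-2}\}$, $l_0=0$, $l_j=\lfloor\rho_\varepsilon^{-1}(1+\rho_\varepsilon)^j\rfloor$ for $j=1,\dots,J-1$, $l_J=N$, and $B_j=\{l_{j-1}+1,l_{j-1}+2,\dots,l_j\}$ for $j=1,\dots,J$, which partition $\{1,\dots,N\}$.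 Blockwise Efron--Morris estimator $\hat\theta_{\mathrm{BEM}}=(\hat\theta_{\mathrm{BEM},i})$: for $i\in B_j$ with $|B_j|<p+2$, $\hat\theta_{\mathrm{BEM},i}=y_i$; for $i\in B_j$ with $|B_j|\ge p+2$, $\hat\theta_{\mathrm{BEM},i}=\left(I_p-\varepsilon^2(|B_j|-p-1)\left(\sum_{k\in B_j}y_ky_k^{\top}\right)^{-1}\right)y_i$; for $i>N$, $\hat\theta_{\mathrm{BEM},i}=0$. Real powers of $Q$ are defined by the spectral calculus. $a\sim b$ means $a/b\to1$. *)

theory Defs
  imports "HOL-Probability.Probability"
begin

definition sym_pos_def :: "real^'p^'p \<Rightarrow> bool" where
  "sym_pos_def Q \<longleftrightarrow> transpose Q = Q \<and> (\<forall>x. x \<noteq> 0 \<longrightarrow> x \<bullet> (Q *v x) > 0)"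

definition diag_mat :: "('p \<Rightarrow> real) \<Rightarrow> real^'p^'p" where
  "diag_mat d = (\<chi> i j. if i = j then d i else 0)"

text \<open>Spectral calculus for real symmetric matrices. The value does not depend on the chosen
  orthogonal diagonalisation (see the lemma below); it is unspecified if there is none.\<close>

definition spectral_fun :: "(real \<Rightarrow> real) \<Rightarrow> real^'p^'p \<Rightarrow> real^'p^'p" where
  "spectral_fun f Q = (THE M. \<exists>U d. orthogonal_matrix U \<and>
     Q = U ** diag_mat d ** transpose U \<and>
     M = U ** diag_mat (\<lambda>i. f (d i)) ** transpose U)"

lemma diag_mat_intertwine:
  "A ** diag_mat d = diag_mat e ** A \<longleftrightarrow> (\<forall>i j. A $ i $ j * d j = e i * A $ i $ j)"
  by (simp add: diag_mat_def matrix_matrix_mult_def vec_eq_iff if_distrib[of "\<lambda>x. _ * x"]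
      if_distrib[of "\<lambda>x. x * _"] cong: if_cong)

lemma spectral_fun_diagonalisation:
  assumes U: "orthogonal_matrix U"
  shows "spectral_fun f (U ** diag_mat d ** transpose U)
       = U ** diag_mat (\<lambda>i. f (d i)) ** transpose U"
  unfolding spectral_fun_def
proof (rule the_equality)
  show "\<exists>V e. orthogonal_matrix V \<and>
      U ** diag_mat d ** transpose U = V ** diag_mat e ** transpose V \<and>
      U ** diag_mat (\<lambda>i. f (d i)) ** transpose U = V ** diag_mat (\<lambda>i. f (e i)) ** transpose V"
    using U by blast
next
  fix M
  assume "\<exists>V e. orthogonal_matrix V \<and>
      U ** diag_mat d ** transpose U = V ** diag_mat e ** transpose V \<and>
      M = V ** diag_mat (\<lambda>i. f (e i)) ** transpose V"
  then obtain V e where V: "orthogonal_matrix V"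
    and eq: "U ** diag_mat d ** transpose U = V ** diag_mat e ** transpose V"
    and M: "M = V ** diag_mat (\<lambda>i. f (e i)) ** transpose V" by blast
  have oU: "transpose U ** U = mat 1" "U ** transpose U = mat 1"
    using U by (auto simp: orthogonal_matrix_def)
  have oV: "transpose V ** V = mat 1" "V ** transpose V = mat 1"
    using V by (auto simp: orthogonal_matrix_def)
  define W where "W = transpose V ** U"
  have "W ** diag_mat d = transpose V ** (U ** diag_mat d ** transpose U) ** U"
    by (simp add: W_def matrix_mul_assoc[symmetric] oU)
  also have "\<dots> = (transpose V ** V) ** diag_mat e ** W"
    unfolding eq by (simp add: W_def matrix_mul_assoc)
  also have "\<dots> = diag_mat e ** W" by (simp add: oV)
  finally have "\<forall>i j. W $ i $ j * d j = e i * W $ i $ j"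
    by (rule diag_mat_intertwine[THEN iffD1])
  then have "\<forall>i j. W $ i $ j * f (d j) = f (e i) * W $ i $ j"
    by (metis mult.commute mult_cancel_left)
  then have W: "W ** diag_mat (\<lambda>i. f (d i)) = diag_mat (\<lambda>i. f (e i)) ** W"
    by (rule diag_mat_intertwine[THEN iffD2])
  have "M = V ** (diag_mat (\<lambda>i. f (e i)) ** W) ** transpose U"
    unfolding M W_def by (simp add: matrix_mul_assoc[symmetric] oU)
  also have "\<dots> = V ** transpose V ** U ** diag_mat (\<lambda>i. f (d i)) ** transpose U"
    unfolding W[symmetric] by (simp add: W_def matrix_mul_assoc)
  finally show "M = U ** diag_mat (\<lambda>i. f (d i)) ** transpose U"
    by (simp add: oV)
qed

definition mat_powr :: "real^'p^'p \<Rightarrow> real \<Rightarrow> real^'p^'p" where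
  "mat_powr Q s = spectral_fun (\<lambda>x. x powr s) Q"

text \<open>All sequences are indexed by \<^term>\<open>{1::nat..}\<close>. Parameters and estimates are functions on
  \<^typ>\<open>nat\<close> whose value at 0 is never used.\<close>

definition std_gaussian :: "(real^'p) measure" where
  "std_gaussian = density lborel (\<lambda>x. ennreal (\<Prod>k\<in>UNIV. std_normal_density (x $ k)))"

abbreviation obs_space :: "(nat \<Rightarrow> real^'p) measure" where
  "obs_space \<equiv> PiM {1..} (\<lambda>_. borel)"

definition obs_law :: "real \<Rightarrow> (nat \<Rightarrow> real^'p) \<Rightarrow> (nat \<Rightarrow> real^'p) measure" where
  "obs_law \<epsilon> \<theta> = distr (PiM {1..} (\<lambda>_. std_gaussian)) obs_space
     (\<lambda>\<xi>. \<lambda>i\<in>{1..}. \<theta> i + \<epsilon> *\<^sub>R \<xi> i)"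

definition estimators :: "((nat \<Rightarrow> real^'p) \<Rightarrow> nat \<Rightarrow> real^'p) set" where
  "estimators = {\<delta>. \<forall>i\<ge>1. (\<lambda>y. \<delta> y i) \<in> borel_measurable obs_space}"

text \<open>Losses, risks and the ellipsoid constraint are sums of nonnegative terms in \<^typ>\<open>ennreal\<close>,
  so divergent sums have the value \<open>\<infinity>\<close>.\<close>

definition loss :: "real^'p^'p \<Rightarrow> (nat \<Rightarrow> real^'p) \<Rightarrow> (nat \<Rightarrow> real^'p) \<Rightarrow> ennreal" where
  "loss Q \<theta> t = (\<Sum>n. let i = Suc n in ennreal ((t i - \<theta> i) \<bullet> (Q *v (t i - \<theta> i))))"

definition risk :: "real^'p^'p \<Rightarrow> real \<Rightarrow> (nat \<Rightarrow> real^'p) \<Rightarrow>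
    ((nat \<Rightarrow> real^'p) \<Rightarrow> nat \<Rightarrow> real^'p) \<Rightarrow> ennreal" where
  "risk Q \<epsilon> \<theta> \<delta> = (\<integral>\<^sup>+ y. loss Q \<theta> (\<delta> y) \<partial>obs_law \<epsilon> \<theta>)"

definition sobolev_weight :: "real \<Rightarrow> nat \<Rightarrow> real" where
  "sobolev_weight \<beta> i = (if even i then real i powr \<beta> else (real i - 1) powr \<beta>)"

definition sobolev_ellipsoid :: "real \<Rightarrow> real^'p^'p \<Rightarrow> (nat \<Rightarrow> real^'p) set" where
  "sobolev_ellipsoid \<beta> Q = {\<theta>. (\<Sum>n. let i = Suc n in
     ennreal ((sobolev_weight \<beta> i)\<^sup>2 * (\<theta> i \<bullet> (matrix_inv Q *v \<theta> i)))) \<le> 1}"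

definition max_risk :: "real \<Rightarrow> real^'p^'p \<Rightarrow> real \<Rightarrow>
    ((nat \<Rightarrow> real^'p) \<Rightarrow> nat \<Rightarrow> real^'p) \<Rightarrow> ennreal" where
  "max_risk \<beta> Q \<epsilon> \<delta> = (SUP \<theta>\<in>sobolev_ellipsoid \<beta> Q. risk Q \<epsilon> \<theta> \<delta>)"

definition minimax_risk :: "real \<Rightarrow> real^'p^'p \<Rightarrow> real \<Rightarrow> ennreal" where
  "minimax_risk \<beta> Q \<epsilon> = (INF \<delta>\<in>estimators. max_risk \<beta> Q \<epsilon> \<delta>)"

definition pinsker_const :: "real \<Rightarrow> real^'p^'p \<Rightarrow> real" where
  "pinsker_const \<beta> Q = (2 * \<beta> + 1) powr (1 / (2 * \<beta> + 1)) *
     (\<beta> * trace (mat_powr Q ((\<beta> + 1) / \<beta>)) / (\<beta> + 1)) powr (2 * \<beta> / (2 * \<beta> + 1))"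

text \<open>Weakly geometric blocks. They are only meaningful for small \<open>\<epsilon> > 0\<close>, when
  \<open>1, \<dots>, wgb_N \<epsilon>\<close> is partitioned by the blocks with index \<open>1, \<dots>, wgb_J \<epsilon>\<close>; some of these
  blocks may be empty.\<close>

definition wgb_N :: "real \<Rightarrow> nat" where
  "wgb_N \<epsilon> = nat \<lfloor>1 / \<epsilon>\<^sup>2\<rfloor>"

definition wgb_rho :: "real \<Rightarrow> real" where
  "wgb_rho \<epsilon> = 1 / ln (1 / \<epsilon>)"

definition wgb_J :: "real \<Rightarrow> nat" where
  "wgb_J \<epsilon> = (LEAST j. 1 / wgb_rho \<epsilon> * (1 + wgb_rho \<epsilon>) ^ j \<ge> 1 / \<epsilon>\<^sup>2)"

definition wgb_l :: "real \<Rightarrow> nat \<Rightarrow> nat" where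
  "wgb_l \<epsilon> j = (if j = 0 then 0
     else if j < wgb_J \<epsilon> then nat \<lfloor>1 / wgb_rho \<epsilon> * (1 + wgb_rho \<epsilon>) ^ j\<rfloor>
     else wgb_N \<epsilon>)"

definition wgb_block :: "real \<Rightarrow> nat \<Rightarrow> nat set" where
  "wgb_block \<epsilon> j = {wgb_l \<epsilon> (j - 1) + 1 .. wgb_l \<epsilon> j}"

definition block_of :: "real \<Rightarrow> nat \<Rightarrow> nat set" where
  "block_of \<epsilon> i = wgb_block \<epsilon> (THE j. j \<in> {1..wgb_J \<epsilon>} \<and> i \<in> wgb_block \<epsilon> j)"

definition bem :: "real \<Rightarrow> (nat \<Rightarrow> real^'p) \<Rightarrow> nat \<Rightarrow> real^'p" where
  "bem \<epsilon> y i =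
    (if i > wgb_N \<epsilon> then 0
     else let B = block_of \<epsilon> i; p = CARD('p) in
       if card B < p + 2 then y i
       else (mat 1 - (\<epsilon>\<^sup>2 * (real (card B) - real p - 1)) *\<^sub>R
               matrix_inv (\<Sum>k\<in>B. (\<chi> a b. y k $ a * y k $ b))) *v y i)"

end

theory Submission imports Defs "HOL-Real_Asymp.Real_Asymp" begin

text \<open>Diagonalise \<open>Q\<close> in an orthonormal frame \<open>u\<close> with eigenvalues \<open>d\<close>, and write \<open>x\<^sub>i\<^sub>k = u k \<bullet> \<theta> i\<close>.
The loss becomes \<open>\<Sum> d k * (error)\<^sup>2\<close> over the coordinates \<open>(i, k)\<close>, the ellipsoid becomes
\<open>\<Sum> a\<^sub>i\<^sup>2 * x\<^sub>i\<^sub>k\<^sup>2 / d k \<le> 1\<close>, and by rotation invariance of the Gaussian law the noise is an independent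
standard normal in every coordinate (lemma \<open>obs_law_eq\<close>). What remains is Pinsker's problem for a
two-index family of coordinates. Its solution shrinks the coordinate \<open>(i, k)\<close> by the weight
\<open>max 0 (1 - \<kappa> a\<^sub>i / d k)\<close>; balancing bias against variance gives the level \<open>\<kappa>\<close>
(definition \<open>level\<close>) and the minimax value \<open>(2 \<beta> + 1) \<kappa>\<^sup>2\<close>, which is the Pinsker constant times the
rate (lemma \<open>pinsker_const_level\<close>). It is shown that the maximal risk of the estimator is at most
\<open>(1 + \<eta>)\<close> times this value, and the minimax risk at least \<open>(1 - \<eta>)\<close> times it, for every
\<open>\<eta> > 0\<close> and all small \<open>\<epsilon>\<close>.

\<^bold>\<open>Upper bound.\<close> On a block \<open>B\<close> with \<open>n\<close> elements let \<open>S\<close> be the sum of the matrices \<open>y y\<^sup>T\<close>. Replace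
\<open>S\<close> by \<open>S + \<delta> I\<close> and let \<open>R\<close> be its inverse; then all functions involved are bounded and smooth, and
Stein's identity bounds the block risk in the direction \<open>u k\<close> by
\<open>\<epsilon>\<^sup>2 n - \<epsilon>\<^sup>4 (n - p - 1)\<^sup>2 E (u k \<bullet> R (u k))\<close>, where by the inequalities of Cauchy--Schwarz and Jensen the
expectation is at least \<open>1 / (\<delta> + n \<epsilon>\<^sup>2 + \<Sum> x\<^sub>i\<^sub>k\<^sup>2)\<close> (lemma \<open>regularised_block_risk\<close>). The same bound shows
that \<open>E (trace R)\<close> stays bounded as \<open>\<delta>\<close> tends to 0, whereas \<open>trace R \<ge> 1 / \<delta>\<close> where \<open>S\<close> is singular; so
\<open>S\<close> is almost surely invertible, and Fatou's lemma removes \<open>\<delta>\<close>. Hence in every direction the estimator is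
as good, up to \<open>2 (p + 1) \<epsilon>\<^sup>2\<close> per block, as the best multiple of the observed block
(lemmas \<open>efron_morris_block_risk\<close> and \<open>efron_morris_block_oracle\<close>). There are only
\<open>O((ln (1 / \<epsilon>))\<^sup>2)\<close> blocks, and the weights \<open>a\<^sub>i\<close> are nearly constant on a block, so that Pinsker's
weights may be taken constant on the blocks (lemma \<open>bem_risk_le\<close>).

\<^bold>\<open>Lower bound.\<close> Put independent normal priors on finitely many coordinates, with the variances
of Pinsker's least favourable prior shrunk by the factor \<open>1 - h\<close>. The Bayes risk of each coordinate is explicit
(lemma \<open>gaussian_bayes_risk\<close>). The prior leaves the ellipsoid with a probability that is exponentially small
in a power of \<open>1 / \<epsilon>\<close>, by Chernoff's bound for weighted sums of squares, and the estimates may be clipped to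
the range of the coordinates on the ellipsoid, so that this event is negligible
(lemmas \<open>max_risk_lower_bound\<close> and \<open>pinsker_prior_bound\<close>).\<close>

section \<open>Eigenframes of symmetric matrices\<close>

text \<open>The spectral theorem on an invariant subspace, by induction on the dimension: a maximiser \<open>u\<close> of
the quadratic form on the unit sphere of \<open>V\<close> is an eigenvector, and the vectors of \<open>V\<close> orthogonal to \<open>u\<close>
form a smaller invariant subspace.\<close>

lemma orthonormal_frame_exists_subspace:
  fixes f :: "'a::euclidean_space \<Rightarrow> 'a" and V :: "'a set"
  assumes lin: "linear f" and self: "\<And>x y. x \<bullet> f y = f x \<bullet> y"
  shows "subspace V \<Longrightarrow> f ` V \<subseteq> V \<Longrightarrow>
    \<exists>B\<subseteq>V. pairwise orthogonal B \<and> (\<forall>b\<in>B. norm b = 1 \<and> (\<exists>c. f b = c *\<^sub>R b)) \<and> card B = dim V \<and> finite B"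
proof (induction "dim V" arbitrary: V rule: less_induct)
  case less
  note V = less.prems(1) and inv = less.prems(2)
  show ?case
  proof (cases "dim V = 0")
    case True
    then show ?thesis by (intro exI[of _ "{}"]) auto
  next
    case False
    then obtain v where v: "v \<in> V" "v \<noteq> 0"
      using dim_eq_0[of V] by auto
    let ?S = "V \<inter> sphere 0 1"
    have "compact ?S"
      using V by (simp add: closed_subspace closed_Int_compact)
    moreover have "(1 / norm v) *\<^sub>R v \<in> ?S"
      using v V by (auto simp: subspace_scale)
    moreover have "continuous_on ?S (\<lambda>x. x \<bullet> f x)"
      using lin by (intro continuous_intros linear_continuous_on) (simp add: linear_linear)
    ultimately obtain u where u: "u \<in> ?S" and umax: "\<And>x. x \<in> ?S \<Longrightarrow> x \<bullet> f x \<le> u \<bullet> f u"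
      using continuous_attains_sup[of ?S "\<lambda>x. x \<bullet> f x"] by blast
    define m where "m = u \<bullet> f u"
    have un: "u \<bullet> u = 1" using u by (simp add: dot_square_norm)
    have bound: "x \<bullet> f x \<le> m * (x \<bullet> x)" if "x \<in> V" for x
    proof (cases "x = 0")
      case False
      have "(1 / norm x) *\<^sub>R x \<in> ?S" using that False V by (auto simp: subspace_scale)
      from umax[OF this] have "(x \<bullet> f x) / (norm x)\<^sup>2 \<le> m"
        using lin by (simp add: linear_scale m_def power2_eq_square)
      then show ?thesis using False by (simp add: divide_le_eq power2_norm_eq_inner)
    qed (use lin in \<open>simp add: linear_0\<close>)
    (* First-order condition: the form at u + t w exceeds its maximum for small t unless the linear term vanishes. *)
    have orth: "w \<bullet> f u = 0" if w: "w \<in> V" "w \<bullet> u = 0" for w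
    proof -
      define b where "b = w \<bullet> f u"
      define C where "C = \<bar>m * (w \<bullet> w) - w \<bullet> f w\<bar> + 1"
      have C: "C > 0" by (simp add: C_def)
      define t where "t = b / C"
      have "u + t *\<^sub>R w \<in> V" using u w V by (auto simp: subspace_add subspace_scale)
      from bound[OF this]
      have "(u + t *\<^sub>R w) \<bullet> f (u + t *\<^sub>R w) \<le> m * ((u + t *\<^sub>R w) \<bullet> (u + t *\<^sub>R w))" .
      moreover have "(u + t *\<^sub>R w) \<bullet> f (u + t *\<^sub>R w) = m + 2 * t * b + t * t * (w \<bullet> f w)"
        using lin self[of u w]
        by (simp add: linear_add linear_scale inner_add_left inner_add_right m_def b_def algebra_simps inner_commute)
      moreover have "(u + t *\<^sub>R w) \<bullet> (u + t *\<^sub>R w) = 1 + t * t * (w \<bullet> w)"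
        using w un by (simp add: inner_add_left inner_add_right inner_commute[of u w])
      ultimately have "2 * t * b \<le> t * t * (m * (w \<bullet> w) - w \<bullet> f w)"
        by (simp add: right_diff_distrib distrib_left mult.left_commute[of m])
      also have "\<dots> \<le> t * t * C" by (intro mult_left_mono) (auto simp: C_def)
      finally have "2 * t * b \<le> t * t * C" .
      then have "b * b \<le> 0" using C by (simp add: t_def divide_simps mult.commute)
      then have "b = 0" by (metis mult_eq_0_iff order_antisym zero_le_square)
      then show ?thesis by (simp add: b_def)
    qed
    have eig: "f u = m *\<^sub>R u"
    proof -
      let ?w = "f u - m *\<^sub>R u"
      have wV: "?w \<in> V" using u inv V by (auto simp: subspace_diff subspace_scale)
      have wu: "?w \<bullet> u = 0" using un by (simp add: inner_diff_left m_def inner_commute[of "f u" u])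
      have "?w \<bullet> ?w = ?w \<bullet> f u - m * (?w \<bullet> u)" by (simp add: inner_diff_right)
      also have "\<dots> = 0" using orth[OF wV wu] wu by simp
      finally show ?thesis by simp
    qed
    define W where "W = {w \<in> V. w \<bullet> u = 0}"
    have W: "subspace W" using V
      by (auto simp: W_def subspace_def inner_add_left)
    have invW: "f ` W \<subseteq> W"
      using inv by (auto simp: W_def self[symmetric] eig)
    have uV: "u \<in> V" and u0: "u \<noteq> 0" using u by auto
    have uW: "u \<notin> W" using un by (auto simp: W_def)
    have V_eq: "V = span (insert u W)"
    proof
      show "span (insert u W) \<subseteq> V"
        using uV by (intro span_minimal) (auto simp: V W_def)
      show "V \<subseteq> span (insert u W)"
      proof
        fix x assume x: "x \<in> V"
        have "x - (x \<bullet> u) *\<^sub>R u \<in> W"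
          using x uV V un by (auto simp: W_def subspace_diff subspace_scale inner_diff_left)
        then have "(x - (x \<bullet> u) *\<^sub>R u) + (x \<bullet> u) *\<^sub>R u \<in> span (insert u W)"
          by (intro span_add span_scale) (auto intro: span_base)
        then show "x \<in> span (insert u W)" by simp
      qed
    qed
    have "u \<notin> span W" using uW W by (metis span_eq_iff)
    then have dimV: "dim V = Suc (dim W)"
      by (subst V_eq) (simp add: dim_insert)
    then obtain B where B: "B \<subseteq> W" "pairwise orthogonal B"
        "\<forall>b\<in>B. norm b = 1 \<and> (\<exists>c. f b = c *\<^sub>R b)" "card B = dim W" "finite B"
      using less.hyps[OF _ W invW] by auto
    show ?thesis
    proof (intro exI[of _ "insert u B"] conjI)
      show "insert u B \<subseteq> V" using B uV by (auto simp: W_def)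
      show "pairwise orthogonal (insert u B)"
        using B by (auto simp: pairwise_insert orthogonal_def W_def inner_commute)
      show "\<forall>b\<in>insert u B. norm b = 1 \<and> (\<exists>c. f b = c *\<^sub>R b)"
        using B eig u by auto
      show "card (insert u B) = dim V" using B uW dimV by (auto simp: card_insert_if)
      show "finite (insert u B)" using B by simp
    qed
  qed
qed

locale eigenframe =
  fixes Q :: "real^'p^'p" and u :: "'p \<Rightarrow> real^'p" and d :: "'p \<Rightarrow> real"
  assumes orthonormal: "u j \<bullet> u k = (if j = k then 1 else 0)"
    and eigen: "Q *v u k = d k *\<^sub>R u k"
    and d_pos: "d k > 0"

lemma sym_pos_def_eigenframe:
  fixes Q :: "real^'p^'p"
  assumes "sym_pos_def Q"
  obtains u d where "eigenframe Q u d"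
proof -
  have sym: "transpose Q = Q" and pos: "\<And>x. x \<noteq> 0 \<Longrightarrow> x \<bullet> (Q *v x) > 0"
    using assms by (auto simp: sym_pos_def_def)
  have self: "x \<bullet> (Q *v y) = (Q *v x) \<bullet> y" for x y
    by (metis dot_lmul_matrix sym transpose_matrix_vector)
  obtain B :: "(real^'p) set" where B: "pairwise orthogonal B"
    "\<And>b. b \<in> B \<Longrightarrow> norm b = 1" "\<And>b. b \<in> B \<Longrightarrow> \<exists>c. Q *v b = c *\<^sub>R b" "card B = CARD('p)" "finite B"
    using orthonormal_frame_exists_subspace[of "(*v) Q" UNIV] self
    by (auto simp: dim_UNIV matrix_vector_mul_linear)
  obtain u :: "'p \<Rightarrow> real^'p" where u: "bij_betw u UNIV B"
    using B finite_same_card_bij[of "UNIV :: 'p set" B] by auto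
  have uB: "u k \<in> B" for k using u by (auto simp: bij_betw_def)
  obtain d where d: "\<And>k. Q *v u k = d k *\<^sub>R u k" using B(3)[OF uB] by metis
  have un: "u k \<bullet> u k = 1" for k using B(2)[OF uB[of k]] by (simp add: dot_square_norm)
  have "eigenframe Q u d"
  proof
    fix j k
    show "u j \<bullet> u k = (if j = k then 1 else 0)"
    proof (cases "j = k")
      case False
      then have "u j \<noteq> u k" using u by (auto simp: bij_betw_def inj_on_def)
      then show ?thesis using B(1) uB False by (auto simp: pairwise_def orthogonal_def)
    qed (simp add: un)
    show "Q *v u k = d k *\<^sub>R u k" by (rule d)
    have "u k \<noteq> 0" using un[of k] by auto
    from pos[OF this] show "d k > 0" by (simp add: d un)
  qed
  then show ?thesis by (rule that)
qed

lemma matrix_inv_inverse: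
  assumes "invertible (A :: 'a::semiring_1^'n^'m)"
  shows "A ** matrix_inv A = mat 1" "matrix_inv A ** A = mat 1"
proof -
  have "A ** matrix_inv A = mat 1 \<and> matrix_inv A ** A = mat 1"
    unfolding matrix_inv_def by (rule someI_ex) (use assms in \<open>simp add: invertible_def\<close>)
  then show "A ** matrix_inv A = mat 1" "matrix_inv A ** A = mat 1" by auto
qed

context eigenframe
begin

definition U :: "real^'p^'p" where "U = (\<chi> i k. u k $ i)"

lemma orthogonal_U: "orthogonal_matrix U"
  unfolding orthogonal_matrix using orthonormal
  by (simp add: U_def transpose_def matrix_matrix_mult_def mat_def vec_eq_iff inner_vec_def)

lemma U_mult: "U *v c = (\<Sum>k\<in>UNIV. c $ k *\<^sub>R u k)"
  by (simp add: U_def matrix_vector_mult_def vec_eq_iff mult.commute)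

lemma inner_sum_frame: "u j \<bullet> (\<Sum>k\<in>UNIV. c k *\<^sub>R u k) = c j"
  by (simp add: inner_sum_right orthonormal if_distrib cong: if_cong)

lemma frame_expansion: "x = (\<Sum>k\<in>UNIV. (u k \<bullet> x) *\<^sub>R u k)"
proof -
  have "U *v (transpose U *v x) = x"
    using orthogonal_U unfolding orthogonal_matrix_def matrix_vector_mul_assoc by (metis matrix_vector_mul_lid)
  moreover have "(transpose U *v x) $ k = u k \<bullet> x" for k
    by (simp add: U_def transpose_def matrix_vector_mult_def inner_vec_def)
  ultimately show ?thesis by (simp add: U_mult)
qed

lemma inner_frame: "x \<bullet> y = (\<Sum>k\<in>UNIV. (u k \<bullet> x) * (u k \<bullet> y))"
proof -
  have "x \<bullet> y = (\<Sum>k\<in>UNIV. (u k \<bullet> x) *\<^sub>R u k) \<bullet> y"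
    using frame_expansion[of x] by simp
  then show ?thesis by (simp only: inner_sum_left inner_scaleR_left)
qed

lemma Q_mult: "Q *v x = (\<Sum>k\<in>UNIV. (d k * (u k \<bullet> x)) *\<^sub>R u k)"
proof -
  have "Q *v x = Q *v (\<Sum>k\<in>UNIV. (u k \<bullet> x) *\<^sub>R u k)"
    using frame_expansion[of x] by simp
  also have "\<dots> = (\<Sum>k\<in>UNIV. Q *v ((u k \<bullet> x) *\<^sub>R u k))"
    by (rule linear_sum[OF matrix_vector_mul_linear])
  finally show ?thesis by (simp add: matrix_vector_mult_scaleR eigen mult.commute)
qed

lemma Q_form: "x \<bullet> (Q *v x) = (\<Sum>k\<in>UNIV. d k * (u k \<bullet> x)\<^sup>2)"
  unfolding Q_mult inner_sum_right
  by (rule sum.cong) (simp_all add: power2_eq_square inner_commute[of x])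

lemma invertible_Q: "invertible Q"
proof -
  have "x = 0" if "Q *v x = 0" for x
  proof -
    have "(\<Sum>k\<in>UNIV. d k * (u k \<bullet> x)\<^sup>2) = 0" using Q_form[of x] that by simp
    then have "d k * (u k \<bullet> x)\<^sup>2 = 0" for k
      using sum_nonneg_eq_0_iff[of UNIV "\<lambda>k. d k * (u k \<bullet> x)\<^sup>2"] d_pos
      by (simp add: less_imp_le)
    then have "u k \<bullet> x = 0" for k using d_pos[of k] by (metis less_irrefl mult_eq_0_iff power_eq_0_iff)
    then show "x = 0" using frame_expansion[of x] by simp
  qed
  then have "\<exists>B. B ** Q = mat 1" using matrix_left_invertible_ker by blast
  then show ?thesis by (simp add: invertible_left_inverse)
qed

lemma eigenframe_inv: "eigenframe (matrix_inv Q) u (\<lambda>k. 1 / d k)"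
proof
  fix k
  have "matrix_inv Q ** Q = mat 1" using invertible_Q by (rule matrix_inv_inverse)
  then have "matrix_inv Q *v (Q *v u k) = u k" by (simp add: matrix_vector_mul_assoc)
  then have "d k *\<^sub>R (matrix_inv Q *v u k) = u k" by (simp add: eigen matrix_vector_mult_scaleR)
  then show "matrix_inv Q *v u k = (1 / d k) *\<^sub>R u k"
    using d_pos[of k] by (simp add: vec_eq_iff field_simps)
qed (auto simp: orthonormal d_pos)

lemma Q_inv_form: "x \<bullet> (matrix_inv Q *v x) = (\<Sum>k\<in>UNIV. (u k \<bullet> x)\<^sup>2 / d k)"
  using eigenframe.Q_form[OF eigenframe_inv] by simp

lemma Q_diagonalisation: "Q = U ** diag_mat d ** transpose U"
proof -
  have "Q *v x = (U ** diag_mat d ** transpose U) *v x" for x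
  proof -
    have 1: "(transpose U *v x) $ k = u k \<bullet> x" for k
      by (simp add: U_def transpose_def matrix_vector_mult_def inner_vec_def)
    have 2: "(diag_mat d *v y) $ k = d k * y $ k" for k y
      by (simp add: diag_mat_def matrix_vector_mult_def if_distrib[of "\<lambda>x. x * _"] cong: if_cong)
    have "(U ** diag_mat d ** transpose U) *v x = U *v (diag_mat d *v (transpose U *v x))"
      by (simp only: matrix_vector_mul_assoc matrix_mul_assoc)
    also have "\<dots> = Q *v x"
      unfolding U_mult Q_mult 1 2 ..
    finally show ?thesis ..
  qed
  then show ?thesis by (simp add: matrix_eq)
qed

lemma trace_mat_powr: "trace (mat_powr Q s) = (\<Sum>k\<in>UNIV. d k powr s)"
proof -
  have "mat_powr Q s = U ** diag_mat (\<lambda>k. d k powr s) ** transpose U"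
    unfolding mat_powr_def by (subst Q_diagonalisation) (rule spectral_fun_diagonalisation[OF orthogonal_U])
  also have "trace \<dots> = trace (transpose U ** (U ** diag_mat (\<lambda>k. d k powr s)))"
    by (rule trace_mul_sym)
  also have "\<dots> = trace (diag_mat (\<lambda>k. d k powr s))"
    using orthogonal_U by (simp add: matrix_mul_assoc orthogonal_matrix_def)
  finally show ?thesis by (simp add: trace_def diag_mat_def)
qed

end

section \<open>Rotation invariance of the standard Gaussian law\<close>

text \<open>Makes the unit ball usable as a normalising set in the next proof.\<close>

lemma emeasure_lborel_open_neq_0:
  fixes S :: "'a::euclidean_space set"
  assumes "open S" "S \<noteq> {}"
  shows "emeasure lborel S \<noteq> 0"
proof
  assume "emeasure lborel S = 0"
  then have "negligible S"
    using assms(1) unfolding negligible_iff_null_sets by (intro null_sets_completionI) (auto simp: null_sets_def)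
  then show False using open_not_negligible assms by blast
qed

text \<open>The image \<open>M\<close> of Lebesgue measure is translation invariant because \<open>T\<close> is linear, and it gives
the unit ball \<open>B\<close> its Lebesgue measure because \<open>T\<close> preserves norms. Two translation invariant measures are
proportional: computing \<open>\<integral>\<integral> 1\<^sub>A(x) 1\<^sub>B(x + y)\<close> in both orders gives \<open>M A * lborel B = M B * lborel A\<close>.\<close>

lemma lborel_distr_orthogonal:
  fixes T :: "'a::euclidean_space \<Rightarrow> 'a"
  assumes T: "orthogonal_transformation T"
  shows "distr lborel borel T = lborel"
proof -
  have lin: "linear T" using T by (rule orthogonal_transformation_linear)
  have [measurable]: "T \<in> borel_measurable borel"
    using lin by (intro borel_measurable_continuous_onI linear_continuous_on) (simp add: linear_linear)
  let ?M = "distr lborel borel T"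
  obtain T' where T': "orthogonal_transformation T'" "\<And>x. T' (T x) = x" "\<And>x. T (T' x) = x"
    using T orthogonal_transformation_inv[OF T] orthogonal_transformation_bij[OF T]
    by (metis bij_inv_eq_iff)
  have ball: "emeasure ?M (ball 0 1) = emeasure lborel (ball (0::'a) 1)"
  proof -
    have "T -` ball 0 1 = ball (0::'a) 1"
      using orthogonal_transformation_norm[OF T] by (auto simp: dist_norm)
    then show ?thesis by (simp add: emeasure_distr)
  qed
  have transl: "(\<integral>\<^sup>+x. f (x + y) \<partial>?M) = (\<integral>\<^sup>+x. f x \<partial>?M)"
    if [measurable]: "f \<in> borel_measurable borel" for f :: "'a \<Rightarrow> ennreal" and y
  proof -
    have "(\<integral>\<^sup>+x. f (x + y) \<partial>?M) = (\<integral>\<^sup>+x. f (T (T' y + x)) \<partial>lborel)"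
      using lin by (simp add: nn_integral_distr linear_add T' add.commute)
    also have "\<dots> = (\<integral>\<^sup>+x. f (T x) \<partial>distr lborel borel ((+) (T' y)))"
      by (simp add: nn_integral_distr)
    finally show ?thesis by (simp add: lborel_distr_plus nn_integral_distr)
  qed
  have translL: "(\<integral>\<^sup>+x. f (x + y) \<partial>lborel) = (\<integral>\<^sup>+x. f x \<partial>lborel)"
    if [measurable]: "f \<in> borel_measurable borel" for f :: "'a \<Rightarrow> ennreal" and y
  proof -
    have "(\<integral>\<^sup>+x. f (x + y) \<partial>lborel) = (\<integral>\<^sup>+x. f x \<partial>distr lborel borel ((+) y))"
      by (simp add: nn_integral_distr add.commute)
    then show ?thesis by (simp add: lborel_distr_plus)
  qed
  have reflL: "(\<integral>\<^sup>+x. f (- x) \<partial>lborel) = (\<integral>\<^sup>+x. f x \<partial>lborel)"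
    if [measurable]: "f \<in> borel_measurable borel" for f :: "'a \<Rightarrow> ennreal"
  proof -
    have "(\<integral>\<^sup>+x. f (- x) \<partial>lborel) = (\<integral>\<^sup>+x. f x \<partial>distr lborel borel uminus)"
      by (simp add: nn_integral_distr)
    moreover have "distr lborel borel uminus = (lborel :: 'a measure)"
      by (subst lborel_affine[of "-1" 0]) (auto simp: density_1)
    ultimately show ?thesis by simp
  qed
  have T'm [measurable]: "T' \<in> borel_measurable borel"
    using orthogonal_transformation_linear[OF T'(1)]
    by (intro borel_measurable_continuous_onI linear_continuous_on) (simp add: linear_linear)
  have "distr ?M borel T' = distr lborel borel (\<lambda>x. x)"
    by (subst distr_distr) (simp_all add: comp_def T')
  then have "sigma_finite_measure (distr ?M borel T')"
    using lborel.sigma_finite_measure_axioms by (simp add: distr_id2)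
  then interpret M: sigma_finite_measure ?M
    by (rule sigma_finite_measure_distr) simp
  interpret P: pair_sigma_finite ?M lborel by unfold_locales
  show ?thesis
  proof (rule measure_eqI)
    fix A assume "A \<in> sets ?M"
    then have [measurable]: "A \<in> sets borel" by simp
    let ?B = "ball (0::'a) 1"
    have [measurable]: "?B \<in> sets borel" by (intro borel_open open_ball)
    have "emeasure ?M A * emeasure lborel ?B = (\<integral>\<^sup>+x. indicator A x * emeasure lborel ?B \<partial>?M)"
      by (simp add: nn_integral_multc)
    also have "\<dots> = (\<integral>\<^sup>+x. \<integral>\<^sup>+y. indicator A x * indicator ?B (y + x) \<partial>lborel \<partial>?M)"
    proof (rule nn_integral_cong)
      fix x
      have "(\<integral>\<^sup>+y. indicator ?B (y + x) \<partial>lborel) = emeasure lborel ?B"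
        using translL[OF borel_measurable_indicator[of ?B borel], of x] by simp
      then show "indicator A x * emeasure lborel ?B = (\<integral>\<^sup>+y. indicator A x * indicator ?B (y + x) \<partial>lborel)"
      proof (subst nn_integral_cmult)
        have "(\<lambda>y. indicator ?B y :: ennreal) \<in> borel_measurable borel" by measurable
        then have "(\<lambda>y. indicator ?B (y + x) :: ennreal) \<in> borel_measurable borel"
          by measurable
        then show "(\<lambda>y. indicator ?B (y + x) :: ennreal) \<in> borel_measurable lborel" by simp
      qed simp
    qed
    also have "\<dots> = (\<integral>\<^sup>+y. \<integral>\<^sup>+x. indicator A x * indicator ?B (y + x) \<partial>?M \<partial>lborel)"
      by (rule P.Fubini'[symmetric]) simp
    also have "\<dots> = (\<integral>\<^sup>+y. \<integral>\<^sup>+x. indicator A ((x + y) - y) * indicator ?B (x + y) \<partial>?M \<partial>lborel)"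
      by (simp add: add.commute)
    also have "\<dots> = (\<integral>\<^sup>+y. \<integral>\<^sup>+x. indicator A (x - y) * indicator ?B x \<partial>?M \<partial>lborel)"
      by (intro nn_integral_cong transl[of "\<lambda>x. indicator A (x - _) * indicator ?B x"]) simp
    also have "\<dots> = (\<integral>\<^sup>+x. \<integral>\<^sup>+y. indicator A (x - y) * indicator ?B x \<partial>lborel \<partial>?M)"
      by (rule P.Fubini') simp
    also have "\<dots> = (\<integral>\<^sup>+x. (\<integral>\<^sup>+y. indicator A (- y + x) \<partial>lborel) * indicator ?B x \<partial>?M)"
      by (simp add: nn_integral_multc)
    also have "\<dots> = (\<integral>\<^sup>+x. emeasure lborel A * indicator ?B x \<partial>?M)"
    proof (intro nn_integral_cong arg_cong2[where f="(*)"] refl)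
      fix x
      show "(\<integral>\<^sup>+y. indicator A (- y + x) \<partial>lborel) = emeasure lborel A"
        using reflL[of "\<lambda>y. indicator A (y + x)"] translL[OF borel_measurable_indicator[of A borel], of x] by simp
    qed
    also have "\<dots> = emeasure lborel A * emeasure lborel ?B"
      by (simp add: nn_integral_cmult ball)
    finally have "emeasure ?M A * emeasure lborel ?B = emeasure lborel A * emeasure lborel ?B" .
    moreover have "emeasure lborel ?B \<noteq> 0" by (intro emeasure_lborel_open_neq_0) auto
    moreover have "emeasure lborel ?B \<noteq> \<infinity>" using emeasure_lborel_ball_finite[of "0::'a" 1] by auto
    ultimately show "emeasure ?M A = emeasure lborel A"
      by (metis ennreal_mult_cancel_left mult.commute infinity_ennreal_def)
  qed simp
qed

lemma borel_measurable_vecI: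
  fixes f :: "'a \<Rightarrow> real^'n"
  assumes "\<And>k. (\<lambda>x. f x $ k) \<in> borel_measurable M"
  shows "f \<in> borel_measurable M"
proof (rule borel_measurable_euclidean_space[THEN iffD2], rule ballI)
  fix b :: "real^'n" assume "b \<in> Basis"
  then obtain k where "b = axis k 1" by (auto simp: Basis_vec_def)
  then show "(\<lambda>x. f x \<bullet> b) \<in> borel_measurable M" using assms by (simp add: inner_axis)
qed

abbreviation gauss1 :: "real measure" where
  "gauss1 \<equiv> density lborel (\<lambda>x. ennreal (std_normal_density x))"

lemma prob_space_gauss1: "prob_space gauss1"
  by (rule prob_space_normal_density) simp

lemma std_gaussian_product:
  "(std_gaussian :: (real^'p::finite) measure) = distr (PiM UNIV (\<lambda>_. gauss1)) borel (\<lambda>z. \<chi> k. z k)"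
proof -
  interpret prob_space gauss1 by (rule prob_space_gauss1)
  interpret product_prob_space "\<lambda>_::'p. gauss1" UNIV by unfold_locales
  let ?V = "\<lambda>z::'p \<Rightarrow> real. (\<chi> k. z k) :: real^'p"
  have sets_eq [measurable_cong]: "sets (PiM UNIV (\<lambda>_::'p. gauss1)) = sets (PiM UNIV (\<lambda>_::'p. borel))"
    by (intro sets_PiM_cong) simp_all
  have sets_g [measurable_cong]: "sets (std_gaussian :: (real^'p) measure) = sets borel"
    by (simp add: std_gaussian_def)
  have [measurable]: "?V \<in> borel_measurable (PiM UNIV (\<lambda>_. borel))"
    by (rule borel_measurable_vecI) simp
  have 1: "distr std_gaussian (PiM UNIV (\<lambda>_. gauss1)) (\<lambda>x::real^'p. \<lambda>k\<in>UNIV. x $ k) = PiM UNIV (\<lambda>_. gauss1)"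
  proof (rule PiM_eqI)
    fix A :: "'p \<Rightarrow> real set" assume A: "\<And>k. k \<in> UNIV \<Longrightarrow> A k \<in> sets gauss1"
    then have [measurable]: "\<And>k. A k \<in> sets borel" by simp
    have [measurable]: "PiE UNIV A \<in> sets (PiM UNIV (\<lambda>_. borel))" by (intro sets_PiM_I_finite) auto
    show "emeasure (distr std_gaussian (PiM UNIV (\<lambda>_. gauss1)) (\<lambda>x::real^'p. \<lambda>k\<in>UNIV. x $ k)) (PiE UNIV A)
       = (\<Prod>k\<in>UNIV. emeasure gauss1 (A k))"
    proof -
      define f where "f = (\<lambda>b::real^'p. \<lambda>x. ennreal (std_normal_density x) * indicator (A (inv (\<lambda>k. axis k 1) b)) x)"
      have inj: "inj (\<lambda>k::'p. axis k (1::real))" by (simp add: inj_on_def axis_eq_axis)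
      have basis: "(Basis :: (real^'p) set) = range (\<lambda>k. axis k 1)"
        by (auto simp: Basis_vec_def)
      have idx: "inv (\<lambda>k::'p. axis k (1::real)) (axis k 1) = k" for k :: 'p
        by (rule inv_f_f[OF inj])
      have "emeasure (distr std_gaussian (PiM UNIV (\<lambda>_. gauss1)) (\<lambda>x::real^'p. \<lambda>k\<in>UNIV. x $ k)) (PiE UNIV A)
          = emeasure std_gaussian {x::real^'p. \<forall>k. x $ k \<in> A k}"
        by (subst emeasure_distr) (auto intro!: arg_cong2[where f=emeasure] simp: std_gaussian_def PiE_iff)
      also have "\<dots> = (\<integral>\<^sup>+x. (\<Prod>k\<in>UNIV. ennreal (std_normal_density (x $ k))) * indicator {x::real^'p. \<forall>k. x $ k \<in> A k} x \<partial>lborel)"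
        unfolding std_gaussian_def by (subst emeasure_density) (auto simp: prod_ennreal)
      also have "\<dots> = (\<integral>\<^sup>+x. (\<Prod>b\<in>Basis. f b (x \<bullet> b)) \<partial>(lborel :: (real^'p) measure))"
      proof (rule nn_integral_cong)
        fix x :: "real^'p"
        have "indicator {x::real^'p. \<forall>k. x $ k \<in> A k} x = (\<Prod>k\<in>UNIV. indicator (A k) (x $ k) :: ennreal)"
          by (auto simp: indicator_def prod_zero_iff)
        then show "(\<Prod>k\<in>UNIV. ennreal (std_normal_density (x $ k))) * indicator {x::real^'p. \<forall>k. x $ k \<in> A k} x
            = (\<Prod>b\<in>Basis. f b (x \<bullet> b))"
          unfolding basis by (subst prod.reindex[OF inj]) (simp add: f_def idx inner_axis prod.distrib)
      qed
      also have "\<dots> = (\<Prod>b\<in>(Basis::(real^'p) set). \<integral>\<^sup>+x. f b x \<partial>lborel)"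
        by (rule nn_integral_lborel_prod) (simp_all add: f_def)
      also have "\<dots> = (\<Prod>k\<in>UNIV. emeasure gauss1 (A k))"
        unfolding basis by (subst prod.reindex[OF inj]) (simp add: f_def idx emeasure_density)
      finally show ?thesis .
    qed
  qed simp_all
  have "std_gaussian = distr std_gaussian borel (\<lambda>x::real^'p. x)"
    by (simp add: std_gaussian_def distr_id2)
  also have "\<dots> = distr (distr std_gaussian (PiM UNIV (\<lambda>_. gauss1)) (\<lambda>x::real^'p. \<lambda>k\<in>UNIV. x $ k)) borel ?V"
  proof -
    have [measurable]: "(\<lambda>x::real^'p. \<lambda>k\<in>UNIV. x $ k) \<in> borel \<rightarrow>\<^sub>M PiM UNIV (\<lambda>_. borel)"
      by (rule measurable_restrict) simp
    have "?V \<circ> (\<lambda>x::real^'p. \<lambda>k\<in>UNIV. x $ k) = (\<lambda>x. x)" by (auto simp: fun_eq_iff vec_eq_iff)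
    then show ?thesis by (subst distr_distr) measurable
  qed
  finally show ?thesis by (simp only: 1)
qed

section \<open>The noise as a family of scalar normal variables\<close>

lemma sets_std_gaussian [measurable_cong, simp]: "sets std_gaussian = sets borel"
  by (simp add: std_gaussian_def)

text \<open>The density depends on the norm alone; hence the law is invariant under rotations.\<close>

lemma std_gaussian_density:
  "(\<Prod>k\<in>UNIV. std_normal_density (x $ k)) = (1 / sqrt (2 * pi)) ^ CARD('p) * exp (- (norm x)\<^sup>2 / 2)"
  for x :: "real^'p"
proof -
  have "(\<Prod>k\<in>UNIV. std_normal_density (x $ k)) = (\<Prod>k\<in>(UNIV::'p set). 1 / sqrt (2 * pi)) * (\<Prod>k\<in>UNIV. exp (- (x $ k)\<^sup>2 / 2))"
    by (simp only: std_normal_density_def prod.distrib)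
  also have "(\<Prod>k\<in>UNIV. exp (- (x $ k)\<^sup>2 / 2)) = exp (\<Sum>k\<in>UNIV. - (x $ k)\<^sup>2 / 2)"
    by (simp add: exp_sum)
  also have "(\<Sum>k\<in>UNIV. - (x $ k)\<^sup>2 / 2) = - (norm x)\<^sup>2 / 2"
  proof -
    have "(norm x)\<^sup>2 = (\<Sum>k\<in>UNIV. (x $ k)\<^sup>2)"
      unfolding power2_norm_eq_inner by (simp add: inner_vec_def power2_eq_square)
    then show ?thesis by (simp add: sum_negf sum_divide_distrib[symmetric])
  qed
  finally show ?thesis by simp
qed

lemma std_gaussian_distr_orthogonal:
  fixes T :: "real^'p \<Rightarrow> real^'p"
  assumes T: "orthogonal_transformation T"
  shows "distr std_gaussian borel T = std_gaussian"
proof -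
  have lin: "linear T" using T by (rule orthogonal_transformation_linear)
  have [measurable]: "T \<in> borel_measurable borel"
    using lin by (intro borel_measurable_continuous_onI linear_continuous_on) (simp add: linear_linear)
  let ?g = "\<lambda>x::real^'p. ennreal (\<Prod>k\<in>UNIV. std_normal_density (x $ k))"
  have g: "?g (T x) = ?g x" for x
    using orthogonal_transformation_norm[OF T] by (simp add: std_gaussian_density)
  have "distr (density lborel ?g) borel T = distr (density lborel (\<lambda>x. ?g (T x))) borel T"
    by (simp only: g)
  also have "\<dots> = density (distr lborel borel T) ?g"
    by (rule density_distr[symmetric]) simp_all
  also have "\<dots> = density lborel ?g" by (simp add: lborel_distr_orthogonal[OF T])
  finally show ?thesis by (simp add: std_gaussian_def)
qed

text \<open>One standard normal variable for every time and every frame vector. The index set is all of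
\<open>nat \<times> 'p\<close>, time 0 included, so that every function is a sample point and updates stay in the space.\<close>

definition noise :: "(nat \<times> 'p \<Rightarrow> real) measure" where
  "noise = PiM UNIV (\<lambda>_. gauss1)"

lemma sets_noise [measurable_cong, simp]: "sets noise = sets (PiM UNIV (\<lambda>_. borel))"
  unfolding noise_def by (intro sets_PiM_cong) simp_all

lemma space_noise [simp]: "space noise = UNIV"
  by (simp add: noise_def space_PiM)

lemma prob_space_noise: "prob_space noise"
  unfolding noise_def by (intro prob_space_PiM prob_space_gauss1)

text \<open>Replacing one coordinate by an independent copy does not change the law. Together with Fubini this
reduces Stein's identity and Bayes risks to integrals over a single real variable.\<close>

lemma noise_resample:
  "noise = distr (gauss1 \<Otimes>\<^sub>M noise) noise (\<lambda>x. (snd x)(j := fst x))"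
  using distr_pair_PiM_eq_PiM[of UNIV "\<lambda>_. gauss1" j] prob_space_gauss1
  by (simp add: noise_def insert_UNIV split_beta')

lemma measurable_resample [measurable]:
  "(\<lambda>x. (snd x)(j := fst x)) \<in> gauss1 \<Otimes>\<^sub>M noise \<rightarrow>\<^sub>M PiM UNIV (\<lambda>_. borel)"
proof (rule measurable_PiM_single')
  show "(\<lambda>x. ((snd x)(j := fst x)) i) \<in> borel_measurable (gauss1 \<Otimes>\<^sub>M noise)" for i
    by (cases "i = j") simp_all
qed simp

lemma nn_integral_noise_resample:
  assumes [measurable]: "f \<in> borel_measurable (PiM UNIV (\<lambda>_. borel))"
  shows "(\<integral>\<^sup>+z. f z \<partial>noise) = (\<integral>\<^sup>+z. \<integral>\<^sup>+t. f (z(j := t)) \<partial>gauss1 \<partial>noise)"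
proof -
  interpret N: prob_space gauss1 by (rule prob_space_gauss1)
  interpret P: prob_space noise by (rule prob_space_noise)
  interpret pair_sigma_finite gauss1 noise by unfold_locales
  have "(\<integral>\<^sup>+z. f z \<partial>noise) = (\<integral>\<^sup>+x. f ((snd x)(j := fst x)) \<partial>(gauss1 \<Otimes>\<^sub>M noise))"
    by (subst noise_resample[of j], subst nn_integral_distr) auto
  also have "\<dots> = (\<integral>\<^sup>+z. \<integral>\<^sup>+t. f (z(j := t)) \<partial>gauss1 \<partial>noise)"
    by (subst nn_integral_snd[symmetric]) auto
  finally show ?thesis .
qed

lemma (in eigenframe) orthogonal_transformation_U: "orthogonal_transformation ((*v) U)"
  using orthogonal_U by (simp add: orthogonal_transformation_matrix matrix_vector_mul_linear matrix_of_matrix_vector_mul)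

text \<open>For each time the coordinates form a standard Gaussian vector, which stays so when the frame \<open>u\<close>
is used in place of the standard basis; rows with different times are independent.\<close>

lemma (in eigenframe) PiM_std_gaussian:
  "PiM {1..} (\<lambda>_. std_gaussian) =
     distr noise (obs_space :: (nat \<Rightarrow> real^'p) measure) (\<lambda>z. \<lambda>i\<in>{1..}. U *v (\<chi> k. z (i, k)))"
proof -
  interpret P: prob_space "noise :: (nat \<times> 'p \<Rightarrow> real) measure" by (rule prob_space_noise)
  have ind: "P.indep_vars (\<lambda>_. gauss1) (\<lambda>j z. z j) UNIV"
  proof (subst P.indep_vars_iff_distr_eq_PiM')
    have "distr noise (PiM UNIV (\<lambda>_. gauss1)) (\<lambda>z. \<lambda>j\<in>UNIV. z j) = (noise :: (nat \<times> 'p \<Rightarrow> real) measure)"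
      unfolding noise_def restrict_UNIV by (rule distr_id2) simp
    moreover have "distr noise gauss1 (\<lambda>z. z j) = gauss1" for j :: "nat \<times> 'p"
      unfolding noise_def by (rule distr_PiM_component) (simp_all add: prob_space_gauss1)
    ultimately show "distr noise (PiM UNIV (\<lambda>_. gauss1)) (\<lambda>z. \<lambda>j\<in>UNIV. z j)
        = PiM UNIV (\<lambda>j::nat \<times> 'p. distr noise gauss1 (\<lambda>z. z j))"
      by (simp add: noise_def)
    show "(\<lambda>z. z j) \<in> noise \<rightarrow>\<^sub>M gauss1" for j :: "nat \<times> 'p"
      unfolding noise_def by simp
  qed simp
  define K where "K = (\<lambda>i::nat. {i} \<times> (UNIV :: 'p set))"
  define X where "X = (\<lambda>(i::nat) z. U *v (\<chi> k. z (i, k)) :: real^'p)"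
  have Uc: "continuous_on UNIV (\<lambda>x. U *v x)"
    by (intro linear_continuous_on) (simp add: matrix_vector_mul_bounded_linear)
  have Um [measurable]: "(\<lambda>x. U *v x) \<in> borel_measurable borel"
    using Uc by (rule borel_measurable_continuous_onI)
  have Xm: "X i \<in> borel_measurable (PiM (K i) (\<lambda>_. gauss1))" for i :: nat
  proof -
    have "(\<lambda>z::nat \<times> 'p \<Rightarrow> real. \<chi> k. z (i, k)) \<in> borel_measurable (PiM (K i) (\<lambda>_. gauss1))"
    proof (rule borel_measurable_vecI)
      fix k
      have "(\<lambda>z. z (i, k)) \<in> PiM (K i) (\<lambda>_. gauss1) \<rightarrow>\<^sub>M gauss1"
        by (rule measurable_component_singleton) (simp add: K_def)
      then show "(\<lambda>z. (\<chi> k. z (i, k)) $ k) \<in> borel_measurable (PiM (K i) (\<lambda>_. gauss1))"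
        by simp
    qed
    then show ?thesis unfolding X_def by measurable
  qed
  have Vm [measurable]: "(\<lambda>z::nat \<times> 'p \<Rightarrow> real. \<chi> k. z (i, k)) \<in> borel_measurable (PiM UNIV (\<lambda>_. borel))" for i
    by (rule borel_measurable_vecI) simp
  have [measurable]: "X i \<in> borel_measurable (PiM UNIV (\<lambda>_. borel))" for i
    unfolding X_def by measurable
  have "P.indep_vars (\<lambda>i. PiM (K i) (\<lambda>_. gauss1)) (\<lambda>i z. restrict (\<lambda>j. z j) (K i)) {1..}"
    by (rule P.indep_vars_restrict[OF ind]) (auto simp: K_def disjoint_family_on_def)
  then have "P.indep_vars (\<lambda>i. borel) (\<lambda>i z. X i (restrict (\<lambda>j. z j) (K i))) {1..}"
    by (rule P.indep_vars_compose2) (simp add: Xm)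
  moreover have "X i (restrict (\<lambda>j. z j) (K i)) = X i z" for i z
    by (simp add: X_def K_def)
  ultimately have "P.indep_vars (\<lambda>i. borel) X {1..}" by simp
  moreover have "P.random_variable borel (X i)" for i
    by simp
  ultimately have "distr noise (PiM {1..} (\<lambda>_. borel)) (\<lambda>z. \<lambda>i\<in>{1..}. X i z) = PiM {1..} (\<lambda>i. distr noise borel (X i))"
    by (subst (asm) P.indep_vars_iff_distr_eq_PiM') auto
  moreover have "distr noise borel (X i) = std_gaussian" for i
  proof -
    have [measurable]: "(\<lambda>z. \<chi> k. z k :: real^'p) \<in> borel_measurable (PiM UNIV (\<lambda>_. borel))"
      by (rule borel_measurable_vecI) simp
    have sets_eq [measurable_cong]: "sets (PiM UNIV (\<lambda>_::'p. gauss1)) = sets (PiM UNIV (\<lambda>_::'p. borel))"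
      by (intro sets_PiM_cong) simp_all
    have [measurable]: "(\<lambda>z. \<lambda>k\<in>UNIV. z (i, k)) \<in> noise \<rightarrow>\<^sub>M PiM UNIV (\<lambda>_::'p. borel)"
      by (rule measurable_restrict) simp
    have row: "distr noise (PiM UNIV (\<lambda>_. gauss1)) (\<lambda>z. \<lambda>k\<in>UNIV. z (i, k)) = PiM UNIV (\<lambda>_::'p. gauss1)"
      unfolding noise_def using prob_space_gauss1
      by (intro distr_PiM_reindex) (auto simp: inj_on_def)
    have "std_gaussian = distr (distr noise (PiM UNIV (\<lambda>_. gauss1)) (\<lambda>z. \<lambda>k\<in>UNIV. z (i, k))) borel (\<lambda>z. \<chi> k::'p. z k)"
      unfolding row by (rule std_gaussian_product)
    also have "\<dots> = distr noise borel (\<lambda>z. \<chi> k. z (i, k))"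
    proof (subst distr_distr)
      show "(\<lambda>z. \<lambda>k\<in>UNIV. z (i, k)) \<in> noise \<rightarrow>\<^sub>M PiM UNIV (\<lambda>_::'p. gauss1)" by measurable
    qed (simp_all add: comp_def restrict_UNIV)
    finally have "distr noise borel (\<lambda>z. \<chi> k::'p. z (i, k)) = std_gaussian" ..
    then have "std_gaussian = distr (distr noise borel (\<lambda>z. \<chi> k::'p. z (i, k))) borel ((*v) U)"
      by (simp add: std_gaussian_distr_orthogonal[OF orthogonal_transformation_U])
    also have "\<dots> = distr noise borel (X i)"
      by (subst distr_distr) (simp_all add: comp_def X_def)
    finally show ?thesis ..
  qed
  ultimately show ?thesis by (simp add: X_def)
qed

lemma (in eigenframe) obs_law_eq:
  "obs_law \<epsilon> \<theta> = distr noise obs_space (\<lambda>z. \<lambda>i\<in>{1..}. \<theta> i + \<epsilon> *\<^sub>R (\<Sum>k\<in>UNIV. z (i, k) *\<^sub>R u k))"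
proof -
  have [measurable]: "(\<lambda>x. U *v x) \<in> borel_measurable borel"
    by (intro borel_measurable_continuous_onI linear_continuous_on) (simp add: matrix_vector_mul_bounded_linear)
  have [measurable]: "(\<lambda>z::nat \<times> 'p \<Rightarrow> real. \<chi> k. z (i, k)) \<in> borel_measurable (PiM UNIV (\<lambda>_. borel))" for i
    by (rule borel_measurable_vecI) simp
  have [measurable]: "(\<lambda>z. \<lambda>i\<in>{1..}. U *v (\<chi> k. z (i, k))) \<in> noise \<rightarrow>\<^sub>M obs_space"
    by (rule measurable_restrict) simp
  have [measurable]: "(\<lambda>\<xi>. \<lambda>i\<in>{1..}. \<theta> i + \<epsilon> *\<^sub>R \<xi> i) \<in> obs_space \<rightarrow>\<^sub>M obs_space"
    by (rule measurable_restrict) simp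
  show ?thesis
    unfolding obs_law_def PiM_std_gaussian
    by (subst distr_distr) (auto simp: comp_def U_mult intro!: distr_cong)
qed

section \<open>Regularised inverses of Gram matrices\<close>

text \<open>With \<open>\<delta> = 0\<close> this is the matrix that the estimator inverts.\<close>

definition gram :: "real \<Rightarrow> 'i set \<Rightarrow> ('i \<Rightarrow> real^'p) \<Rightarrow> real^'p^'p" where
  "gram \<delta> B y = \<delta> *\<^sub>R mat 1 + (\<Sum>k\<in>B. (\<chi> a b. y k $ a * y k $ b))"

lemma matrix_add_rdistrib_vec: "(A + B) *v x = A *v x + B *v (x :: real^'n)"
  by (simp add: matrix_vector_mult_def vec_eq_iff sum.distrib distrib_right)

lemma outer_mult: "(\<chi> a b. v $ a * v $ b) *v x = (v \<bullet> x) *\<^sub>R (v :: real^'n)"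
  by (simp add: matrix_vector_mult_def vec_eq_iff inner_vec_def sum_distrib_left mult_ac)

lemma sum_matrix_mult: "(\<Sum>k\<in>B. A k) *v x = (\<Sum>k\<in>B. A k *v (x :: real^'n))"
  by (induction B rule: infinite_finite_induct) (simp_all add: matrix_add_rdistrib_vec)

lemma gram_mult: "gram \<delta> B y *v x = \<delta> *\<^sub>R x + (\<Sum>k\<in>B. (y k \<bullet> x) *\<^sub>R y k)"
  by (simp add: gram_def matrix_add_rdistrib_vec sum_matrix_mult outer_mult scaleR_matrix_vector_assoc[symmetric])

lemma gram_form: "x \<bullet> (gram \<delta> B y *v x) = \<delta> * (x \<bullet> x) + (\<Sum>k\<in>B. (y k \<bullet> x)\<^sup>2)"
  by (simp add: gram_mult inner_add_right inner_sum_right power2_eq_square inner_commute[of x "y _"])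

lemma gram_self_adjoint: "x \<bullet> (gram \<delta> B y *v z) = (gram \<delta> B y *v x) \<bullet> z"
proof -
  have "x \<bullet> (gram \<delta> B y *v z) = \<delta> * (x \<bullet> z) + (\<Sum>k\<in>B. (y k \<bullet> z) * (x \<bullet> y k))"
    by (simp add: gram_mult inner_add_right inner_sum_right)
  also have "(\<Sum>k\<in>B. (y k \<bullet> z) * (x \<bullet> y k)) = (\<Sum>k\<in>B. (y k \<bullet> x) * (y k \<bullet> z))"
    by (rule sum.cong) (simp_all add: inner_commute[of x "y _"])
  finally show ?thesis by (simp add: gram_mult inner_add_left inner_sum_left)
qed

lemma gram_insert:
  assumes "finite B" "i \<in> B"
  shows "gram \<delta> B y *v x = gram \<delta> (B - {i}) y *v x + (y i \<bullet> x) *\<^sub>R y i"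
  by (simp add: gram_mult sum.remove[OF assms] add_ac)

lemma invertibleI_ker:
  fixes A :: "real^'n^'n"
  assumes "\<And>x. A *v x = 0 \<Longrightarrow> x = 0"
  shows "invertible A"
  using assms matrix_left_invertible_ker[of A] by (auto simp: invertible_left_inverse)

lemma gram_invertible:
  assumes "\<delta> > 0"
  shows "invertible (gram \<delta> B y)"
proof (rule invertibleI_ker)
  fix x assume "gram \<delta> B y *v x = 0"
  then have "\<delta> * (x \<bullet> x) + (\<Sum>k\<in>B. (y k \<bullet> x)\<^sup>2) = 0"
    using gram_form[of x \<delta> B y] by simp
  moreover have "(\<Sum>k\<in>B. (y k \<bullet> x)\<^sup>2) \<ge> 0" by (simp add: sum_nonneg)
  moreover have "\<delta> * (x \<bullet> x) \<ge> 0" using assms by simp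
  ultimately have "\<delta> * (x \<bullet> x) = 0" by linarith
  then show "x = 0" using assms by simp
qed

lemma matrix_inv_mult_vec:
  fixes A :: "real^'n^'n"
  assumes "invertible A"
  shows "A *v (matrix_inv A *v x) = x" "matrix_inv A *v (A *v x) = x"
  using matrix_inv_inverse[OF assms] by (simp_all add: matrix_vector_mul_assoc)

definition resolvent :: "real \<Rightarrow> 'i set \<Rightarrow> ('i \<Rightarrow> real^'p) \<Rightarrow> real^'p \<Rightarrow> real^'p" where
  "resolvent \<delta> B y x = matrix_inv (gram \<delta> B y) *v x"

context
  fixes \<delta> :: real and B :: "'i set" and y :: "'i \<Rightarrow> real^'p"
  assumes pos: "\<delta> > 0"
begin

abbreviation (input) "S \<equiv> (*v) (gram \<delta> B y)"
abbreviation (input) "R \<equiv> resolvent \<delta> B y"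

lemma gram_resolvent: "S (R x) = x" "R (S x) = x"
  using matrix_inv_mult_vec[OF gram_invertible[OF pos]] by (simp_all add: resolvent_def)

lemma resolvent_eqI: "S v = x \<Longrightarrow> R x = v"
  using gram_resolvent(2) by metis

lemma resolvent_self_adjoint: "x \<bullet> R z = R x \<bullet> z"
  by (metis gram_resolvent(1) gram_self_adjoint)

lemma resolvent_linear: "linear R"
  unfolding resolvent_def by (rule matrix_vector_mul_linear)

lemma resolvent_form: "x \<bullet> R x = \<delta> * (R x \<bullet> R x) + (\<Sum>k\<in>B. (y k \<bullet> R x)\<^sup>2)"
  using gram_form[of "R x" \<delta> B y] by (simp add: gram_resolvent inner_commute)

lemma resolvent_form_nonneg: "x \<bullet> R x \<ge> 0"
  unfolding resolvent_form using pos by (simp add: sum_nonneg)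

lemma resolvent_form_le: "x \<bullet> R x \<le> (x \<bullet> x) / \<delta>"
proof -
  have "\<delta> * (norm (R x))\<^sup>2 \<le> x \<bullet> R x"
    unfolding resolvent_form by (simp add: sum_nonneg power2_norm_eq_inner)
  also have "x \<bullet> R x \<le> norm x * norm (R x)" by (rule norm_cauchy_schwarz)
  finally have 1: "\<delta> * norm (R x) * norm (R x) \<le> norm x * norm (R x)"
    by (simp add: power2_eq_square mult.assoc)
  have "\<delta> * norm (R x) \<le> norm x"
    using mult_right_le_imp_le[OF 1] by (cases "norm (R x) = 0") auto
  then have "norm (R x) \<le> norm x / \<delta>" using pos by (simp add: field_simps)
  then have "norm x * norm (R x) \<le> norm x * (norm x / \<delta>)" by (intro mult_left_mono) auto
  also have "\<dots> = (x \<bullet> x) / \<delta>" by (simp add: power2_norm_eq_inner[symmetric] power2_eq_square)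
  finally show ?thesis using norm_cauchy_schwarz[of x "R x"] by linarith
qed

text \<open>The Cauchy--Schwarz inequality for the form of the Gram matrix, applied to \<open>R x\<close> and \<open>z\<close>.\<close>

lemma resolvent_cauchy_schwarz: "(x \<bullet> z)\<^sup>2 \<le> (x \<bullet> R x) * (z \<bullet> S z)"
proof -
  define a b c where "a = x \<bullet> R x" and "b = x \<bullet> z" and "c = z \<bullet> S z"
  have form: "w \<bullet> S w \<ge> 0" for w
    unfolding gram_form using pos by (simp add: sum_nonneg)
  have lin: "S (w + t *\<^sub>R w') = S w + t *\<^sub>R S w'" for w w' t
    by (simp add: matrix_vector_right_distrib matrix_vector_mult_scaleR)
  have quad: "a + 2 * t * b + t * t * c \<ge> 0" for t
  proof -
    have "(R x + t *\<^sub>R z) \<bullet> S (R x + t *\<^sub>R z) = a + 2 * t * b + t * t * c"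
      unfolding lin
      using gram_self_adjoint[of "R x" \<delta> B y z]
      by (simp add: inner_add_left inner_add_right gram_resolvent a_def b_def c_def inner_commute algebra_simps)
    then show ?thesis using form[of "R x + t *\<^sub>R z"] by simp
  qed
  have "b\<^sup>2 \<le> a * c"
  proof (cases "c = 0")
    case True
    have "b = 0"
    proof (rule ccontr)
      assume "b \<noteq> 0"
      then show False using quad[of "- (a + 1) / (2 * b)"] True by (simp add: field_simps)
    qed
    then show ?thesis using True by simp
  next
    case False
    then have "c > 0" using form[of z] by (simp add: c_def)
    then show ?thesis using quad[of "- b / c"] by (simp add: field_simps power2_eq_square)
  qed
  then show ?thesis by (simp add: a_def b_def c_def)
qed

end

text \<open>The Sherman--Morrison formula: removing the observation \<open>y i\<close> from the Gram matrix is a rank-one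
change.\<close>

lemma resolvent_rank_one:
  fixes y :: "'i \<Rightarrow> real^'p"
  assumes pos: "\<delta> > 0" and fin: "finite B" "i \<in> B"
  defines "By \<equiv> resolvent \<delta> (B - {i}) y (y i)"
  defines "q \<equiv> y i \<bullet> By"
  shows "resolvent \<delta> B y x = resolvent \<delta> (B - {i}) y x - ((By \<bullet> x) / (1 + q)) *\<^sub>R By"
proof (rule resolvent_eqI[OF pos])
  have q: "q \<ge> 0" unfolding q_def By_def by (rule resolvent_form_nonneg[OF pos])
  let ?R = "resolvent \<delta> (B - {i}) y"
  have 1: "gram \<delta> (B - {i}) y *v By = y i" unfolding By_def by (rule gram_resolvent[OF pos])
  have 2: "y i \<bullet> ?R x = By \<bullet> x" unfolding By_def by (rule resolvent_self_adjoint[OF pos])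
  have "gram \<delta> B y *v (?R x - ((By \<bullet> x) / (1 + q)) *\<^sub>R By)
     = (x - ((By \<bullet> x) / (1 + q)) *\<^sub>R y i) + ((By \<bullet> x) - ((By \<bullet> x) / (1 + q)) * q) *\<^sub>R y i"
    unfolding gram_insert[OF fin]
    by (simp add: matrix_vector_mult_diff_distrib matrix_vector_mult_scaleR gram_resolvent[OF pos] 1 inner_diff_right 2 q_def[symmetric])
  also have "\<dots> = x + ((By \<bullet> x) - ((By \<bullet> x) / (1 + q)) * (1 + q)) *\<^sub>R y i"
  proof -
    have "(x - k *\<^sub>R w) + (c - k * q) *\<^sub>R w = x + (c - k * (1 + q)) *\<^sub>R w" for k c and w :: "real^'p"
      by (simp add: algebra_simps)
    then show ?thesis .
  qed
  also have "\<dots> = x" using q by simp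
  finally show "gram \<delta> B y *v (?R x - ((By \<bullet> x) / (1 + q)) *\<^sub>R By) = x" .
qed

text \<open>When \<open>y i\<close> moves along the line \<open>v + t u\<close>, the Sherman--Morrison formula expresses all quantities by
the inverse without \<open>y i\<close>, which does not move. With \<open>\<alpha> + t \<beta>\<close> for \<open>u \<bullet> R' (y i)\<close> and \<open>q t\<close> for
\<open>y i \<bullet> R' (y i)\<close>, where \<open>R'\<close> is that inverse, \<open>g t = (\<alpha> + t \<beta>) / (1 + q t)\<close> with a nonnegative
quadratic polynomial \<open>q\<close>. So \<open>g\<close> is an explicit rational function and its bounds depend on \<open>\<delta>\<close> only.\<close>

lemma resolvent_derivative:
  fixes u v :: "real^'p" and y :: "'i \<Rightarrow> real^'p"
  assumes pos: "\<delta> > 0" and fin: "finite B" "i \<in> B" and u: "u \<bullet> u = 1"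
  defines "Y \<equiv> \<lambda>t. y(i := v + t *\<^sub>R u)"
  defines "g \<equiv> \<lambda>t. u \<bullet> resolvent \<delta> B (Y t) (Y t i)"
  defines "g' \<equiv> \<lambda>t. (1 - Y t i \<bullet> resolvent \<delta> B (Y t) (Y t i)) * (u \<bullet> resolvent \<delta> B (Y t) u) - (g t)\<^sup>2"
  shows "(g has_real_derivative g' t) (at t)" "isCont g' t"
    "\<bar>g t\<bar> \<le> 1 + 1 / \<delta>" "\<bar>g' t\<bar> \<le> 3 / \<delta>"
proof -
  let ?R = "resolvent \<delta> (B - {i}) y"
  have [simp]: "resolvent \<delta> (B - {i}) (Y t) = ?R" for t
  proof -
    have "gram \<delta> (B - {i}) (Y t) = gram \<delta> (B - {i}) y"
      unfolding gram_def by (intro arg_cong2[where f="(+)"] refl sum.cong) (auto simp: Y_def)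
    then show ?thesis by (auto simp: resolvent_def)
  qed
  have lin: "?R (v + t *\<^sub>R u) = ?R v + t *\<^sub>R ?R u" for t
    using resolvent_linear[OF pos, of "B - {i}" y] by (simp add: linear_add linear_scale)
  define \<alpha> \<beta> c where "\<alpha> = u \<bullet> ?R v" and "\<beta> = u \<bullet> ?R u" and "c = v \<bullet> ?R v"
  have uv: "v \<bullet> ?R u = \<alpha>" unfolding \<alpha>_def using resolvent_self_adjoint[OF pos] by (metis inner_commute)
  define q where "q = (\<lambda>t. c + 2 * t * \<alpha> + t\<^sup>2 * \<beta>)"
  have q_eq: "Y t i \<bullet> ?R (Y t i) = q t" for t
    by (simp add: Y_def lin inner_add_left inner_add_right \<alpha>_def[symmetric] \<beta>_def[symmetric] c_def[symmetric] uv q_def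
        power2_eq_square algebra_simps)
  have q: "q t \<ge> 0" for t unfolding q_eq[symmetric] by (rule resolvent_form_nonneg[OF pos])
  then have q1: "1 + q t > 0" for t by (smt (verit))
  have num: "u \<bullet> ?R (Y t i) = \<alpha> + t * \<beta>" for t
    by (simp add: Y_def lin inner_add_right \<alpha>_def \<beta>_def)
  have num': "?R (Y t i) \<bullet> w = Y t i \<bullet> ?R w" for t w
    by (simp add: resolvent_self_adjoint[OF pos])
  have num2: "Y t i \<bullet> ?R u = \<alpha> + t * \<beta>" for t
    using num[of t] resolvent_self_adjoint[OF pos] by (metis inner_commute)
  note rank = resolvent_rank_one[OF pos fin, of "Y _"]
  have Ry: "w \<bullet> resolvent \<delta> B (Y t) (Y t i) = (w \<bullet> ?R (Y t i)) / (1 + q t)" for t w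
    using q1[of t] by (simp add: rank num' q_eq inner_diff_right field_simps)
  have g_eq: "g t = (\<alpha> + t * \<beta>) / (1 + q t)" for t by (simp add: g_def Ry num)
  have h_eq: "Y t i \<bullet> resolvent \<delta> B (Y t) (Y t i) = q t / (1 + q t)" for t by (simp add: Ry q_eq)
  have Ru: "u \<bullet> resolvent \<delta> B (Y t) u = \<beta> - (\<alpha> + t * \<beta>)\<^sup>2 / (1 + q t)" for t
    by (simp add: rank inner_diff_right num q_eq num' num2 \<beta>_def[symmetric] power2_eq_square)
  have g'_eq: "g' t = \<beta> / (1 + q t) - 2 * (\<alpha> + t * \<beta>)\<^sup>2 / (1 + q t)\<^sup>2" for t
  proof -
    have "1 - q t / (1 + q t) = 1 / (1 + q t)" using q1[of t] by (simp add: field_simps)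
    moreover have "1 / s * (\<beta> - a\<^sup>2 / s) - (a / s)\<^sup>2 = \<beta> / s - 2 * a\<^sup>2 / s\<^sup>2" for s a :: real
      by (simp add: right_diff_distrib power_divide power2_eq_square)
    ultimately show ?thesis
      unfolding g'_def h_eq Ru g_eq by simp
  qed
  have dq: "(q has_real_derivative 2 * (\<alpha> + t * \<beta>)) (at t)" for t
    unfolding q_def by (auto intro!: derivative_eq_intros simp: algebra_simps)
  show "(g has_real_derivative g' t) (at t)"
  proof -
    have "((\<lambda>t. (\<alpha> + t * \<beta>) / (1 + q t)) has_real_derivative
        (\<beta> * (1 + q t) - (\<alpha> + t * \<beta>) * (2 * (\<alpha> + t * \<beta>))) / ((1 + q t) * (1 + q t))) (at t)"
      using q1[of t] by (auto intro!: derivative_eq_intros dq)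
    moreover have "(\<beta> * (1 + q t) - (\<alpha> + t * \<beta>) * (2 * (\<alpha> + t * \<beta>))) / ((1 + q t) * (1 + q t)) = g' t"
    proof -
      have *: "(b * s - a * (2 * a)) / (s * s) = b / s - 2 * a\<^sup>2 / s\<^sup>2" if "s \<noteq> 0" for a b s :: real
        using that by (simp add: diff_divide_distrib power2_eq_square)
      show ?thesis unfolding g'_eq by (rule *) (use q1[of t] in simp)
    qed
    moreover have "g = (\<lambda>t. (\<alpha> + t * \<beta>) / (1 + q t))" by (rule ext) (rule g_eq)
    ultimately show ?thesis by simp
  qed
  have "isCont q t" for t using dq DERIV_isCont by blast
  then show "isCont g' t"
    unfolding g'_eq[abs_def] using q1[of t] by (intro continuous_intros) auto
  have \<beta>0: "\<beta> \<ge> 0" unfolding \<beta>_def by (rule resolvent_form_nonneg[OF pos])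
  have \<beta>1: "\<beta> \<le> 1 / \<delta>" unfolding \<beta>_def using resolvent_form_le[OF pos, of u "B - {i}" y] u by simp
  have cs: "(\<alpha> + t * \<beta>)\<^sup>2 \<le> \<beta> * q t"
  proof -
    have "(u \<bullet> ?R (Y t i))\<^sup>2 \<le> (u \<bullet> ?R u) * (?R (Y t i) \<bullet> (gram \<delta> (B - {i}) y *v ?R (Y t i)))"
      by (rule resolvent_cauchy_schwarz[OF pos])
    then show ?thesis by (simp add: num gram_resolvent[OF pos] \<beta>_def[symmetric] inner_commute q_eq)
  qed
  have r1: "q t / (1 + q t) \<le> 1" using q1[of t] q[of t] by (simp add: field_simps)
  have r2: "(\<alpha> + t * \<beta>)\<^sup>2 / (1 + q t) \<le> \<beta>"
  proof -
    have "(\<alpha> + t * \<beta>)\<^sup>2 \<le> \<beta> * (1 + q t)" using cs \<beta>0 by (simp add: algebra_simps)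
    then show ?thesis using q1[of t] by (simp add: pos_divide_le_eq)
  qed
  have r3: "(\<alpha> + t * \<beta>)\<^sup>2 / (1 + q t)\<^sup>2 \<le> \<beta>"
  proof -
    have "(\<alpha> + t * \<beta>)\<^sup>2 / (1 + q t)\<^sup>2 = (\<alpha> + t * \<beta>)\<^sup>2 / (1 + q t) / (1 + q t)" by (simp add: power2_eq_square)
    also have "\<dots> \<le> \<beta> / (1 + q t)" using r2 q1[of t] by (intro divide_right_mono) auto
    also have "\<dots> \<le> \<beta> / 1" using \<beta>0 q[of t] by (intro divide_left_mono) auto
    finally show ?thesis by simp
  qed
  have "(g t)\<^sup>2 \<le> 1 / \<delta>" using r3 \<beta>1 by (simp add: g_eq power_divide)
  then have "\<bar>g t\<bar>\<^sup>2 \<le> 1 / \<delta>" by simp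
  moreover have "\<bar>g t\<bar> \<le> 1 + \<bar>g t\<bar>\<^sup>2"
    using zero_le_power2[of "\<bar>g t\<bar> - 1/2"] by (simp add: power2_eq_square algebra_simps)
  ultimately show "\<bar>g t\<bar> \<le> 1 + 1 / \<delta>" by linarith
  have "0 \<le> \<beta> / (1 + q t)" "\<beta> / (1 + q t) \<le> \<beta>"
    using \<beta>0 q[of t] q1[of t] by (auto simp: pos_divide_le_eq mult_le_cancel_left1 algebra_simps)
  moreover have "0 \<le> (\<alpha> + t * \<beta>)\<^sup>2 / (1 + q t)\<^sup>2" by simp
  moreover have "g' t = \<beta> / (1 + q t) - 2 * ((\<alpha> + t * \<beta>)\<^sup>2 / (1 + q t)\<^sup>2)" "3 / \<delta> = 3 * (1 / \<delta>)"
    by (simp_all add: g'_eq)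
  ultimately show "\<bar>g' t\<bar> \<le> 3 / \<delta>" using r3 \<beta>1 by linarith
qed

lemma borel_measurable_det:
  fixes A :: "'a \<Rightarrow> real^'n^'n"
  assumes "\<And>i j. (\<lambda>x. A x $ i $ j) \<in> borel_measurable M"
  shows "(\<lambda>x. det (A x)) \<in> borel_measurable M"
  unfolding det_def by (intro borel_measurable_sum borel_measurable_times borel_measurable_prod borel_measurable_const assms)

text \<open>A singular matrix has no inverse to choose from, so the value is the same arbitrary matrix for all of
them. This makes the inverse measurable on the singular matrices as well.\<close>

lemma matrix_inv_singular: "\<not> invertible A \<Longrightarrow> matrix_inv (A :: real^'n^'n) = (SOME A'. False)"
  unfolding matrix_inv_def invertible_def by (rule arg_cong[where f=Eps]) auto

text \<open>Cramer's rule turns measurability and continuity of inverses into those of determinants.\<close>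

lemma matrix_inv_mult_cramer:
  fixes A :: "real^'n^'n"
  shows "matrix_inv A *v b = (if det A = 0 then (SOME A'. False) *v b
     else (\<chi> k. det (\<chi> i j. if j = k then b $ i else A $ i $ j) / det A))"
proof (cases "det A = 0")
  case True
  then show ?thesis by (simp add: matrix_inv_singular invertible_det_nz)
next
  case False
  then have "A *v (matrix_inv A *v b) = b" by (intro matrix_inv_mult_vec) (simp add: invertible_det_nz)
  then show ?thesis using False cramer[of A "matrix_inv A *v b" b] by simp
qed

lemma borel_measurable_matrix_inv_mult:
  fixes A :: "'a \<Rightarrow> real^'n^'n"
  assumes A [measurable]: "\<And>i j. (\<lambda>x. A x $ i $ j) \<in> borel_measurable M"
    and b [measurable]: "\<And>i. (\<lambda>x. b x $ i) \<in> borel_measurable M"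
  shows "(\<lambda>x. matrix_inv (A x) *v b x) \<in> borel_measurable M"
proof (rule borel_measurable_vecI)
  fix k
  have [measurable]: "(\<lambda>x. det (A x)) \<in> borel_measurable M" by (rule borel_measurable_det) (rule A)
  have [measurable]: "(\<lambda>x. det (\<chi> i j. if j = k then b x $ i else A x $ i $ j)) \<in> borel_measurable M"
  proof (rule borel_measurable_det)
    fix i j
    show "(\<lambda>x. (\<chi> i j. if j = k then b x $ i else A x $ i $ j) $ i $ j) \<in> borel_measurable M"
      by (cases "j = k") simp_all
  qed
  have [measurable]: "(\<lambda>x. ((SOME A'. False) *v b x) $ k) \<in> borel_measurable M"
    unfolding matrix_vector_mult_def by simp
  have "(\<lambda>x. (matrix_inv (A x) *v b x) $ k) = (\<lambda>x. if det (A x) = 0 then ((SOME A'. False) *v b x) $ k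
     else det (\<chi> i j. if j = k then b x $ i else A x $ i $ j) / det (A x))"
    by (auto simp: matrix_inv_mult_cramer)
  also have "\<dots> \<in> borel_measurable M" by measurable
  finally show "(\<lambda>x. (matrix_inv (A x) *v b x) $ k) \<in> borel_measurable M" .
qed

lemma resolvent_tendsto:
  assumes "invertible (gram 0 B y)"
  shows "((\<lambda>\<delta>. resolvent \<delta> B y x) \<longlongrightarrow> resolvent 0 B y x) (at 0)"
proof -
  have ent: "((\<lambda>\<delta>. gram \<delta> B y $ i $ j) \<longlongrightarrow> gram 0 B y $ i $ j) (at 0)" for i j
    unfolding gram_def by (auto intro!: tendsto_eq_intros)
  have det: "((\<lambda>\<delta>. det (A \<delta>)) \<longlongrightarrow> det (A 0)) (at 0)"
    if "\<And>i j. ((\<lambda>\<delta>. A \<delta> $ i $ j) \<longlongrightarrow> A 0 $ i $ j) (at 0)" for A :: "real \<Rightarrow> real^'a^'a"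
    unfolding det_def by (intro tendsto_intros that)
  have nz: "det (gram 0 B y) \<noteq> 0" using assms by (simp add: invertible_det_nz)
  have "\<forall>\<^sub>F \<delta> in at 0. det (gram \<delta> B y) \<noteq> 0"
    using det[OF ent] nz by (rule tendsto_imp_eventually_ne)
  then have ev: "\<forall>\<^sub>F \<delta> in at 0. (\<chi> k. det (\<chi> i j. if j = k then x $ i else gram \<delta> B y $ i $ j) / det (gram \<delta> B y))
      = resolvent \<delta> B y x"
    by eventually_elim (simp add: resolvent_def matrix_inv_mult_cramer)
  have "((\<lambda>\<delta>. (\<chi> k. det (\<chi> i j. if j = k then x $ i else gram \<delta> B y $ i $ j) / det (gram \<delta> B y)))
     \<longlongrightarrow> (\<chi> k. det (\<chi> i j. if j = k then x $ i else gram 0 B y $ i $ j) / det (gram 0 B y))) (at 0)"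
    by (intro tendsto_vec_lambda tendsto_divide det ent nz) (auto intro: ent)
  also have "(\<chi> k. det (\<chi> i j. if j = k then x $ i else gram 0 B y $ i $ j) / det (gram 0 B y)) = resolvent 0 B y x"
    unfolding resolvent_def matrix_inv_mult_cramer using nz by simp
  finally show ?thesis using ev by (rule Lim_transform_eventually)
qed

section \<open>Stein's identity\<close>

lemma has_field_derivative_std_normal_density:
  "(std_normal_density has_real_derivative (- t * std_normal_density t)) (at t)"
  unfolding std_normal_density_def[abs_def]
  by (auto intro!: derivative_eq_intros simp: field_simps)

lemma std_normal_density_tendsto_0:
  "(std_normal_density \<longlongrightarrow> 0) at_top" "(std_normal_density \<longlongrightarrow> 0) at_bot"
proof -
  show "(std_normal_density \<longlongrightarrow> 0) at_top"
    unfolding std_normal_density_def[abs_def] by real_asymp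
  show "(std_normal_density \<longlongrightarrow> 0) at_bot"
    unfolding std_normal_density_def[abs_def] by real_asymp
qed

text \<open>Integrate the derivative of \<open>g\<close> times the density over the real line; the boundary terms vanish.\<close>

lemma stein_identity:
  fixes g g' :: "real \<Rightarrow> real"
  assumes g: "\<And>t. (g has_real_derivative g' t) (at t)"
    and cont: "\<And>t. isCont g' t"
    and bg: "\<And>t. \<bar>g t\<bar> \<le> C" and bg': "\<And>t. \<bar>g' t\<bar> \<le> C"
  shows "(\<integral>t. t * g t \<partial>gauss1) = (\<integral>t. g' t \<partial>gauss1)"
    "integrable gauss1 (\<lambda>t. t * g t)" "integrable gauss1 g'"
proof -
  let ?n = std_normal_density
  have gc: "isCont g t" for t using g DERIV_isCont by blast
  have [measurable]: "g \<in> borel_measurable borel" "g' \<in> borel_measurable borel"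
    using gc cont by (auto intro!: borel_measurable_continuous_onI continuous_at_imp_continuous_on)
  have i1: "integrable lborel (\<lambda>t. ?n t * (t * g t))"
  proof (rule Bochner_Integration.integrable_bound)
    show "integrable lborel (\<lambda>t. C * (?n t * \<bar>t\<bar> ^ 1))"
      by (intro integrable_mult_right integrable_std_normal_moment_abs)
    show "AE t in lborel. norm (?n t * (t * g t)) \<le> norm (C * (?n t * \<bar>t\<bar> ^ 1))"
    proof (rule AE_I2)
      fix t
      have "\<bar>t\<bar> * \<bar>g t\<bar> * ?n t \<le> \<bar>t\<bar> * C * ?n t" by (intro mult_right_mono mult_left_mono bg) auto
      also have "\<dots> \<le> \<bar>t\<bar> * \<bar>C\<bar> * ?n t" by (intro mult_right_mono mult_left_mono) auto
      finally show "norm (?n t * (t * g t)) \<le> norm (C * (?n t * \<bar>t\<bar> ^ 1))"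
        by (simp add: abs_mult mult_ac)
    qed
  qed simp
  have i2: "integrable lborel (\<lambda>t. ?n t * g' t)"
  proof (rule Bochner_Integration.integrable_bound)
    show "integrable lborel (\<lambda>t. C * ?n t)"
      by (intro integrable_mult_right integrable_normal_density) simp
    show "AE t in lborel. norm (?n t * g' t) \<le> norm (C * ?n t)"
    proof (rule AE_I2)
      fix t
      have "\<bar>g' t\<bar> * ?n t \<le> C * ?n t" by (intro mult_right_mono bg') auto
      also have "\<dots> \<le> \<bar>C\<bar> * ?n t" by (intro mult_right_mono) auto
      finally show "norm (?n t * g' t) \<le> norm (C * ?n t)" by (simp add: abs_mult mult_ac)
    qed
  qed simp
  show "integrable gauss1 (\<lambda>t. t * g t)" using i1 by (subst integrable_density) auto
  show "integrable gauss1 g'" using i2 by (subst integrable_density) auto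
  let ?F = "\<lambda>t. ?n t * g t"
  let ?f = "\<lambda>t. ?n t * g' t - ?n t * (t * g t)"
  have lim: "(?F \<longlongrightarrow> 0) at_top" "(?F \<longlongrightarrow> 0) at_bot"
  proof -
    have b: "norm (?F t) \<le> norm (?n t) * C" for t using bg[of t] by (simp add: abs_mult mult_left_mono)
    show "(?F \<longlongrightarrow> 0) at_top"
      by (rule Lim_null_comparison[OF always_eventually, OF allI, OF b])
        (use tendsto_mult_left_zero[OF tendsto_norm_zero[OF std_normal_density_tendsto_0(1)]] in simp)
    show "(?F \<longlongrightarrow> 0) at_bot"
      by (rule Lim_null_comparison[OF always_eventually, OF allI, OF b])
        (use tendsto_mult_left_zero[OF tendsto_norm_zero[OF std_normal_density_tendsto_0(2)]] in simp)
  qed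
  have "(LBINT t=-\<infinity>..\<infinity>. ?f t) = 0 - 0"
  proof (rule interval_integral_FTC_integrable)
    show "(?F has_vector_derivative ?f t) (at t)" for t
      unfolding has_real_derivative_iff_has_vector_derivative[symmetric]
      by (auto intro!: derivative_eq_intros has_field_derivative_std_normal_density g simp: algebra_simps)
    have nc: "isCont ?n t" for t using has_field_derivative_std_normal_density DERIV_isCont by blast
    show "isCont ?f t" for t by (intro continuous_intros nc gc cont)
    show "set_integrable lborel (einterval (- \<infinity>) \<infinity>) ?f"
      using i1 i2 by (simp add: set_integrable_def einterval_eq)
    show "((?F \<circ> real_of_ereal) \<longlongrightarrow> 0) (at_right (- \<infinity>))"
      using lim by (simp add: at_right_MInf filterlim_filtermap comp_def tendsto_compose_filtermap)
    show "((?F \<circ> real_of_ereal) \<longlongrightarrow> 0) (at_left \<infinity>)"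
      using lim by (simp add: at_left_PInf filterlim_filtermap comp_def tendsto_compose_filtermap)
  qed simp
  then have "(\<integral>t. ?f t \<partial>lborel) = 0"
    by (simp add: interval_lebesgue_integral_def set_lebesgue_integral_def einterval_eq)
  then have "(\<integral>t. ?n t * g' t \<partial>lborel) = (\<integral>t. ?n t * (t * g t) \<partial>lborel)"
    using i1 i2 by simp
  then show "(\<integral>t. t * g t \<partial>gauss1) = (\<integral>t. g' t \<partial>gauss1)"
    by (simp add: integral_density)
qed

lemma integral_noise_resample:
  fixes f :: "_ \<Rightarrow> real"
  assumes "integrable noise f"
  shows "(\<integral>z. f z \<partial>noise) = (\<integral>z. \<integral>t. f (z(j := t)) \<partial>gauss1 \<partial>noise)"
proof -
  have [measurable]: "f \<in> borel_measurable (PiM UNIV (\<lambda>_. borel))"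
    using borel_measurable_integrable[OF assms] by simp
  interpret N: prob_space gauss1 by (rule prob_space_gauss1)
  interpret P: prob_space noise by (rule prob_space_noise)
  interpret pair_sigma_finite gauss1 noise by unfold_locales
  have m: "(\<lambda>x. (snd x)(j := fst x)) \<in> gauss1 \<Otimes>\<^sub>M noise \<rightarrow>\<^sub>M noise" by measurable
  have int: "integrable (gauss1 \<Otimes>\<^sub>M noise) (\<lambda>x. f ((snd x)(j := fst x)))"
    using assms by (subst (asm) noise_resample[of j]) (subst (asm) integrable_distr_eq[OF m], auto)
  have "(\<integral>z. f z \<partial>noise) = (\<integral>x. f ((snd x)(j := fst x)) \<partial>(gauss1 \<Otimes>\<^sub>M noise))"
    by (subst noise_resample[of j], subst integral_distr[OF m]) auto
  also have "\<dots> = (\<integral>z. \<integral>t. f (z(j := t)) \<partial>gauss1 \<partial>noise)"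
    using integral_snd[of "\<lambda>t z. f (z(j := t))"] int by (simp add: split_beta')
  finally show ?thesis .
qed

lemma noise_second_moment:
  "integrable noise (\<lambda>z. (z j)\<^sup>2)" "(\<integral>z. (z j)\<^sup>2 \<partial>noise) = 1"
  "integrable noise (\<lambda>z. z j)" "(\<integral>z. z j \<partial>noise) = 0"
proof -
  have comp: "distr noise gauss1 (\<lambda>z. z j) = gauss1"
    unfolding noise_def by (rule distr_PiM_component) (simp_all add: prob_space_gauss1)
  have m: "(\<lambda>z. z j) \<in> noise \<rightarrow>\<^sub>M gauss1" by simp
  have i2: "integrable gauss1 (\<lambda>t. t\<^sup>2)" and v2: "(\<integral>t. t\<^sup>2 \<partial>gauss1) = 1"
    using std_normal_moment_even[of 1]
    by (auto simp: integrable_density integral_density has_bochner_integral_iff fact_2)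
  have i1: "integrable gauss1 (\<lambda>t. t)" and v1: "(\<integral>t. t \<partial>gauss1) = 0"
    using std_normal_moment_odd[of 0]
    by (auto simp: integrable_density integral_density has_bochner_integral_iff)
  have "integrable (distr noise gauss1 (\<lambda>z. z j)) (\<lambda>t. t\<^sup>2)" unfolding comp by (rule i2)
  then show "integrable noise (\<lambda>z. (z j)\<^sup>2)" by (subst (asm) integrable_distr_eq[OF m]) simp_all
  have "(\<integral>t. t\<^sup>2 \<partial>distr noise gauss1 (\<lambda>z. z j)) = 1" unfolding comp by (rule v2)
  then show "(\<integral>z. (z j)\<^sup>2 \<partial>noise) = 1" by (subst (asm) integral_distr[OF m]) simp_all
  have "integrable (distr noise gauss1 (\<lambda>z. z j)) (\<lambda>t. t)" unfolding comp by (rule i1)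
  then show "integrable noise (\<lambda>z. z j)" by (subst (asm) integrable_distr_eq[OF m]) simp_all
  have "(\<integral>t. t \<partial>distr noise gauss1 (\<lambda>z. z j)) = 0" unfolding comp by (rule v1)
  then show "(\<integral>z. z j \<partial>noise) = 0" by (subst (asm) integral_distr[OF m]) simp_all
qed

lemma noise_integrable_bounded:
  fixes f :: "_ \<Rightarrow> real"
  assumes "f \<in> borel_measurable (PiM UNIV (\<lambda>_. borel))" "\<And>z. \<bar>f z\<bar> \<le> C"
  shows "integrable noise f"
proof -
  interpret P: prob_space noise by (rule prob_space_noise)
  show ?thesis by (rule P.integrable_const_bound[of _ C]) (use assms in auto)
qed

lemma noise_stein_identity:
  fixes f f' :: "_ \<Rightarrow> real"
  assumes [measurable]: "f \<in> borel_measurable (PiM UNIV (\<lambda>_. borel))" "f' \<in> borel_measurable (PiM UNIV (\<lambda>_. borel))"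
    and d: "\<And>z t. ((\<lambda>t. f (z(j := t))) has_real_derivative f' (z(j := t))) (at t)"
    and c: "\<And>z t. isCont (\<lambda>t. f' (z(j := t))) t"
    and b: "\<And>z. \<bar>f z\<bar> \<le> C" and b': "\<And>z. \<bar>f' z\<bar> \<le> C"
  shows "(\<integral>z. z j * f z \<partial>noise) = (\<integral>z. f' z \<partial>noise)" "integrable noise (\<lambda>z. z j * f z)"
proof -
  show int: "integrable noise (\<lambda>z. z j * f z)"
  proof (rule Bochner_Integration.integrable_bound)
    show "integrable noise (\<lambda>z. C * z j)"
      by (intro integrable_mult_right noise_second_moment)
    show "AE z in noise. norm (z j * f z) \<le> norm (C * z j)"
    proof (rule AE_I2)
      fix z
      have "\<bar>z j\<bar> * \<bar>f z\<bar> \<le> \<bar>z j\<bar> * \<bar>C\<bar>" using b[of z] by (intro mult_left_mono) auto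
      then show "norm (z j * f z) \<le> norm (C * z j)" by (simp add: abs_mult mult_ac)
    qed
  qed simp
  have int': "integrable noise f'" by (rule noise_integrable_bounded[OF _ b']) simp
  have "(\<integral>z. z j * f z \<partial>noise) = (\<integral>z. \<integral>t. t * f (z(j := t)) \<partial>gauss1 \<partial>noise)"
    by (subst integral_noise_resample[OF int, of j]) simp
  also have "\<dots> = (\<integral>z. \<integral>t. f' (z(j := t)) \<partial>gauss1 \<partial>noise)"
    by (intro Bochner_Integration.integral_cong refl stein_identity(1)[OF d c b b'])
  also have "\<dots> = (\<integral>z. f' z \<partial>noise)" by (rule integral_noise_resample[OF int', symmetric])
  finally show "(\<integral>z. z j * f z \<partial>noise) = (\<integral>z. f' z \<partial>noise)" .
qed

section \<open>The Efron--Morris estimator on one block\<close>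

context eigenframe
begin

definition obs :: "real \<Rightarrow> (nat \<Rightarrow> real^'p) \<Rightarrow> (nat \<times> 'p \<Rightarrow> real) \<Rightarrow> nat \<Rightarrow> real^'p" where
  "obs \<epsilon> \<theta> z i = \<theta> i + \<epsilon> *\<^sub>R (\<Sum>k\<in>UNIV. z (i, k) *\<^sub>R u k)"

lemma inner_obs: "u k \<bullet> obs \<epsilon> \<theta> z i = u k \<bullet> \<theta> i + \<epsilon> * z (i, k)"
  by (simp add: obs_def inner_add_right inner_sum_frame)

lemma obs_resample:
  "obs \<epsilon> \<theta> (z((i, k) := t)) = (obs \<epsilon> \<theta> z)(i := obs \<epsilon> \<theta> (z((i, k) := 0)) i + (\<epsilon> * t) *\<^sub>R u k)"
proof
  fix i'
  show "obs \<epsilon> \<theta> (z((i, k) := t)) i' = ((obs \<epsilon> \<theta> z)(i := obs \<epsilon> \<theta> (z((i, k) := 0)) i + (\<epsilon> * t) *\<^sub>R u k)) i'"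
  proof (cases "i' = i")
    case True
    have "(\<Sum>k'\<in>UNIV. (z((i, k) := t)) (i, k') *\<^sub>R u k') = (\<Sum>k'\<in>UNIV. (z((i, k) := 0)) (i, k') *\<^sub>R u k') + t *\<^sub>R u k"
      by (simp add: sum.remove[of UNIV k])
    then show ?thesis using True by (simp add: obs_def scaleR_add_right)
  qed (simp add: obs_def)
qed

lemma measurable_obs [measurable]: "(\<lambda>z. obs \<epsilon> \<theta> z i) \<in> borel_measurable (PiM UNIV (\<lambda>_. borel))"
  unfolding obs_def by measurable

lemma measurable_resolvent_obs:
  assumes [measurable]: "b \<in> borel_measurable (PiM UNIV (\<lambda>_. borel))"
  shows "(\<lambda>z. resolvent \<delta> B (obs \<epsilon> \<theta> z) (b z)) \<in> borel_measurable (PiM UNIV (\<lambda>_. borel))"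
  unfolding resolvent_def
proof (rule borel_measurable_matrix_inv_mult)
  fix i j
  have [measurable]: "(\<lambda>z. obs \<epsilon> \<theta> z k $ i) \<in> borel_measurable (PiM UNIV (\<lambda>_. borel))" for k i
    using measurable_compose[OF measurable_obs, of "\<lambda>x. x $ i" borel] by simp
  show "(\<lambda>z. gram \<delta> B (obs \<epsilon> \<theta> z) $ i $ j) \<in> borel_measurable (PiM UNIV (\<lambda>_. borel))"
    unfolding gram_def by simp
  show "(\<lambda>z. b z $ i) \<in> borel_measurable (PiM UNIV (\<lambda>_. borel))"
    using measurable_compose[OF assms, of "\<lambda>x. x $ i" borel] by simp
qed

text \<open>The left sides are \<open>trace (R (S - \<delta> I))\<close> and \<open>x \<bullet> R (S - \<delta> I) R x\<close> for the Gram matrix \<open>S\<close> and its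
inverse \<open>R\<close>.\<close>

lemma sum_resolvent_le:
  fixes y :: "'i \<Rightarrow> real^'p"
  assumes pos: "\<delta> > 0" and fin: "finite B"
  shows "(\<Sum>i\<in>B. y i \<bullet> resolvent \<delta> B y (y i)) \<le> CARD('p)"
    "(\<Sum>i\<in>B. (x \<bullet> resolvent \<delta> B y (y i))\<^sup>2) \<le> x \<bullet> resolvent \<delta> B y x"
proof -
  let ?R = "resolvent \<delta> B y"
  have "(\<Sum>i\<in>B. y i \<bullet> ?R (y i)) = (\<Sum>i\<in>B. \<Sum>k\<in>UNIV. (u k \<bullet> y i) * (u k \<bullet> ?R (y i)))"
    by (subst inner_frame) simp
  also have "\<dots> = (\<Sum>k\<in>UNIV. \<Sum>i\<in>B. (u k \<bullet> y i) * (y i \<bullet> ?R (u k)))"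
    by (subst sum.swap) (simp add: resolvent_self_adjoint[OF pos, of _ _ _ "u _"] inner_commute)
  also have "\<dots> = (\<Sum>k\<in>UNIV. u k \<bullet> (gram \<delta> B y *v ?R (u k)) - \<delta> * (u k \<bullet> ?R (u k)))"
    by (simp add: gram_mult inner_add_right inner_sum_right mult.commute)
  also have "\<dots> \<le> (\<Sum>k\<in>(UNIV::'p set). 1)"
    using resolvent_form_nonneg[OF pos, of _ B y] pos
    by (intro sum_mono) (simp add: gram_resolvent[OF pos] orthonormal)
  finally show "(\<Sum>i\<in>B. y i \<bullet> ?R (y i)) \<le> CARD('p)" by simp
  have "(\<Sum>i\<in>B. (x \<bullet> ?R (y i))\<^sup>2) = (\<Sum>i\<in>B. (y i \<bullet> ?R x)\<^sup>2)"
    by (simp add: resolvent_self_adjoint[OF pos, of x] inner_commute)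
  also have "\<dots> \<le> x \<bullet> ?R x"
    unfolding resolvent_form[OF pos, of x] using pos by simp
  finally show "(\<Sum>i\<in>B. (x \<bullet> ?R (y i))\<^sup>2) \<le> x \<bullet> ?R x" .
qed

text \<open>Write the error of observation \<open>i\<close> in direction \<open>u k\<close> as \<open>\<epsilon> z - c G\<close>, with
\<open>G = u k \<bullet> R (y i)\<close> and \<open>c = \<epsilon>\<^sup>2 c\<^sub>1\<close>, and let \<open>h = y i \<bullet> R (y i)\<close>. Stein's identity replaces
\<open>E (z G)\<close> by \<open>\<epsilon> E ((1 - h) r - G\<^sup>2)\<close>. Summed over the block, \<open>h\<close> contributes at most \<open>p\<close> and
\<open>G\<^sup>2\<close> at most \<open>r\<close>, which leaves \<open>(n - p - 1) r\<close>; this is why \<open>c\<^sub>1 = n - p - 1\<close> is the right factor. The lower bound on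
\<open>E r\<close> is Jensen's inequality for \<open>1 / x\<close>.\<close>

lemma regularised_block_risk:
  fixes k :: 'p and \<epsilon> \<delta> :: real and \<theta> :: "nat \<Rightarrow> real^'p" and B :: "nat set"
  assumes fin: "finite B" and \<epsilon>: "\<epsilon> > 0" and pos: "\<delta> > 0" and card: "card B \<ge> CARD('p) + 1"
  defines "c\<^sub>1 \<equiv> real (card B) - real CARD('p) - 1"
  defines "e \<equiv> \<lambda>z i. u k \<bullet> (obs \<epsilon> \<theta> z i - (\<epsilon>\<^sup>2 * c\<^sub>1) *\<^sub>R resolvent \<delta> B (obs \<epsilon> \<theta> z) (obs \<epsilon> \<theta> z i) - \<theta> i)"
  defines "r \<equiv> \<lambda>z. u k \<bullet> resolvent \<delta> B (obs \<epsilon> \<theta> z) (u k)"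
  shows "integrable noise (\<lambda>z. \<Sum>i\<in>B. (e z i)\<^sup>2)"
    "(\<integral>z. (\<Sum>i\<in>B. (e z i)\<^sup>2) \<partial>noise) \<le> \<epsilon>\<^sup>2 * card B - \<epsilon>^4 * c\<^sub>1\<^sup>2 * (\<integral>z. r z \<partial>noise)"
    "1 / (\<delta> + card B * \<epsilon>\<^sup>2 + (\<Sum>i\<in>B. (u k \<bullet> \<theta> i)\<^sup>2)) \<le> (\<integral>z. r z \<partial>noise)"
    "integrable noise r"
proof -
  interpret P: prob_space "noise :: (nat \<times> 'p \<Rightarrow> real) measure" by (rule prob_space_noise)
  let ?M = "PiM UNIV (\<lambda>_. borel) :: (nat \<times> 'p \<Rightarrow> real) measure"
  define n where "n = card B"
  define c where "c = \<epsilon>\<^sup>2 * c\<^sub>1"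
  have c1: "c\<^sub>1 \<ge> 0" using card by (simp add: c\<^sub>1_def)
  then have c: "c \<ge> 0" by (simp add: c_def)
  define G where "G = (\<lambda>i z. u k \<bullet> resolvent \<delta> B (obs \<epsilon> \<theta> z) (obs \<epsilon> \<theta> z i))"
  define h where "h = (\<lambda>i z. obs \<epsilon> \<theta> z i \<bullet> resolvent \<delta> B (obs \<epsilon> \<theta> z) (obs \<epsilon> \<theta> z i))"
  have [measurable]: "(\<lambda>z. resolvent \<delta> B (obs \<epsilon> \<theta> z) (obs \<epsilon> \<theta> z i)) \<in> borel_measurable ?M" for i
    by (rule measurable_resolvent_obs) simp
  have [measurable]: "(\<lambda>z. resolvent \<delta> B (obs \<epsilon> \<theta> z) (u k)) \<in> borel_measurable ?M"
    by (rule measurable_resolvent_obs) simp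
  have [measurable]: "G i \<in> borel_measurable ?M" "h i \<in> borel_measurable ?M" "r \<in> borel_measurable ?M" for i
    unfolding G_def h_def r_def by measurable
  have r0: "r z \<ge> 0" for z unfolding r_def by (rule resolvent_form_nonneg[OF pos])
  have r1: "r z \<le> 1 / \<delta>" for z
    unfolding r_def using resolvent_form_le[OF pos, of "u k"] orthonormal[of k k] by simp
  show int_r: "integrable noise r"
    by (rule noise_integrable_bounded[of _ "1 / \<delta>"]) (use r0 r1 in \<open>simp_all add: abs_of_nonneg\<close>)
  define C where "C = 1 + 1 / \<delta> + \<epsilon> * (3 / \<delta>)"
  have stein: "(\<integral>z. z (i, k) * G i z \<partial>noise) = (\<integral>z. \<epsilon> * ((1 - h i z) * r z - (G i z)\<^sup>2) \<partial>noise)"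
      "integrable noise (\<lambda>z. z (i, k) * G i z)" "integrable noise (\<lambda>z. (G i z)\<^sup>2)"
      "integrable noise (\<lambda>z. (1 - h i z) * r z - (G i z)\<^sup>2)" if i: "i \<in> B" for i
  proof -
    let ?f' = "\<lambda>z. \<epsilon> * ((1 - h i z) * r z - (G i z)\<^sup>2)"
    have uu: "u k \<bullet> u k = 1" by (simp add: orthonormal)
    let ?Y = "\<lambda>z t. (obs \<epsilon> \<theta> z)(i := obs \<epsilon> \<theta> (z((i, k) := 0)) i + t *\<^sub>R u k)"
    define g where "g = (\<lambda>z t. u k \<bullet> resolvent \<delta> B (?Y z t) (?Y z t i))"
    define g' where "g' = (\<lambda>z t. (1 - ?Y z t i \<bullet> resolvent \<delta> B (?Y z t) (?Y z t i)) *
      (u k \<bullet> resolvent \<delta> B (?Y z t) (u k)) - (g z t)\<^sup>2)"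
    have D: "(g z has_real_derivative g' z t) (at t)" "isCont (g' z) t"
      "\<bar>g z t\<bar> \<le> 1 + 1 / \<delta>" "\<bar>g' z t\<bar> \<le> 3 / \<delta>" for z t
      using resolvent_derivative[OF pos fin i uu, where y = "obs \<epsilon> \<theta> z" and v = "obs \<epsilon> \<theta> (z((i, k) := 0)) i" and t = t]
      unfolding g_def g'_def by blast+
    have G_g: "G i (z((i, k) := t)) = g z (\<epsilon> * t)" for z t
      by (simp only: G_def g_def obs_resample[of \<epsilon> \<theta> z i k t])
    have f'_g': "?f' (z((i, k) := t)) = \<epsilon> * g' z (\<epsilon> * t)" for z t
      by (simp only: g'_def G_g h_def r_def obs_resample[of \<epsilon> \<theta> z i k t])
    have "0 \<le> 1 / \<delta>" "0 \<le> \<epsilon> * (3 / \<delta>)" using pos \<epsilon> by auto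
    have bG: "\<bar>G i z\<bar> \<le> 1 + 1 / \<delta>" for z
      using D(3)[of z "\<epsilon> * z (i, k)"] G_g[of z "z (i, k)"] by simp
    have bf: "\<bar>?f' z\<bar> \<le> \<epsilon> * (3 / \<delta>)" for z
    proof -
      have "\<bar>?f' z\<bar> = \<epsilon> * \<bar>g' z (\<epsilon> * z (i, k))\<bar>"
        using f'_g'[of z "z (i, k)"] \<epsilon> by (simp add: abs_mult)
      then show ?thesis using mult_left_mono[OF D(4)[of z "\<epsilon> * z (i, k)"], of \<epsilon>] \<epsilon> by simp
    qed
    have bG': "\<bar>G i z\<bar> \<le> C" for z using bG[of z] \<open>0 \<le> \<epsilon> * (3 / \<delta>)\<close> unfolding C_def by linarith
    have bf': "\<bar>?f' z\<bar> \<le> C" for z using bf[of z] \<open>0 \<le> 1 / \<delta>\<close> unfolding C_def by linarith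
    have der: "((\<lambda>t. G i (z((i, k) := t))) has_real_derivative ?f' (z((i, k) := t))) (at t)" for z t
    proof -
      have "((\<lambda>t. g z (\<epsilon> * t)) has_real_derivative g' z (\<epsilon> * t) * \<epsilon>) (at t)"
        by (rule DERIV_chain2[OF D(1)]) (auto intro!: derivative_eq_intros)
      then show ?thesis
        by (subst f'_g') (simp only: G_g mult.commute)
    qed
    have cont: "isCont (\<lambda>t. ?f' (z((i, k) := t))) t" for z t
      unfolding f'_g' by (intro continuous_intros isCont_o2[OF _ D(2)])
    show "(\<integral>z. z (i, k) * G i z \<partial>noise) = (\<integral>z. ?f' z \<partial>noise)" "integrable noise (\<lambda>z. z (i, k) * G i z)"
      by (rule noise_stein_identity[OF _ _ der cont bG' bf']; simp)+
    show "integrable noise (\<lambda>z. (G i z)\<^sup>2)"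
    proof (rule noise_integrable_bounded[of _ "C\<^sup>2"])
      fix z
      have "\<bar>G i z\<bar>\<^sup>2 \<le> C\<^sup>2" by (rule power_mono[OF bG']) simp
      then show "\<bar>(G i z)\<^sup>2\<bar> \<le> C\<^sup>2" by simp
    qed simp
    show "integrable noise (\<lambda>z. (1 - h i z) * r z - (G i z)\<^sup>2)"
    proof (rule noise_integrable_bounded[of _ "C / \<epsilon>"])
      fix z
      show "\<bar>(1 - h i z) * r z - (G i z)\<^sup>2\<bar> \<le> C / \<epsilon>"
        using bf'[of z] \<epsilon> by (simp add: abs_mult pos_le_divide_eq mult.commute)
    qed simp
  qed
  have e_eq: "e z i = \<epsilon> * z (i, k) - c * G i z" for z i
    unfolding e_def G_def c_def by (simp add: inner_diff_right inner_obs)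
  have e2: "(e z i)\<^sup>2 = \<epsilon>\<^sup>2 * (z (i, k))\<^sup>2 - 2 * c * \<epsilon> * (z (i, k) * G i z) + c\<^sup>2 * (G i z)\<^sup>2" for z i
    by (simp add: e_eq power2_eq_square algebra_simps)
  have int_e: "integrable noise (\<lambda>z. (e z i)\<^sup>2)" if "i \<in> B" for i
    unfolding e2 by (intro Bochner_Integration.integrable_add Bochner_Integration.integrable_diff
        integrable_mult_right noise_second_moment stein that)
  then show "integrable noise (\<lambda>z. \<Sum>i\<in>B. (e z i)\<^sup>2)" by (intro Bochner_Integration.integrable_sum)
  let ?D = "\<lambda>i z. (1 - h i z) * r z - (G i z)\<^sup>2"
  have ie: "(\<integral>z. (e z i)\<^sup>2 \<partial>noise) = \<epsilon>\<^sup>2 + (\<integral>z. c\<^sup>2 * (G i z)\<^sup>2 - 2 * c * \<epsilon>\<^sup>2 * ?D i z \<partial>noise)" if i: "i \<in> B" for i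
  proof -
    have "(\<integral>z. (e z i)\<^sup>2 \<partial>noise) = \<epsilon>\<^sup>2 * (\<integral>z. (z (i, k))\<^sup>2 \<partial>noise) - 2 * c * \<epsilon> * (\<integral>z. z (i, k) * G i z \<partial>noise)
        + c\<^sup>2 * (\<integral>z. (G i z)\<^sup>2 \<partial>noise)"
      unfolding e2 using stein(2,3)[OF i] noise_second_moment(1)[of "(i, k)"] by simp
    also have "\<dots> = \<epsilon>\<^sup>2 * 1 - 2 * c * \<epsilon> * (\<epsilon> * (\<integral>z. ?D i z \<partial>noise)) + c\<^sup>2 * (\<integral>z. (G i z)\<^sup>2 \<partial>noise)"
      unfolding stein(1)[OF i] noise_second_moment(2) by simp
    also have "\<dots> = \<epsilon>\<^sup>2 + (c\<^sup>2 * (\<integral>z. (G i z)\<^sup>2 \<partial>noise) - 2 * c * \<epsilon>\<^sup>2 * (\<integral>z. ?D i z \<partial>noise))"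
      by (simp add: power2_eq_square)
    also have "\<dots> = \<epsilon>\<^sup>2 + (\<integral>z. c\<^sup>2 * (G i z)\<^sup>2 - 2 * c * \<epsilon>\<^sup>2 * ?D i z \<partial>noise)"
      using stein(3,4)[OF i] by simp
    finally show ?thesis .
  qed
  have pw: "(\<Sum>i\<in>B. c\<^sup>2 * (G i z)\<^sup>2 - 2 * c * \<epsilon>\<^sup>2 * ?D i z) \<le> - (\<epsilon>^4 * c\<^sub>1\<^sup>2) * r z" for z
  proof -
    have H: "(\<Sum>i\<in>B. h i z) \<le> CARD('p)" unfolding h_def by (rule sum_resolvent_le[OF pos fin])
    have G2: "(\<Sum>i\<in>B. (G i z)\<^sup>2) \<le> r z" unfolding G_def r_def by (rule sum_resolvent_le[OF pos fin])
    have "(\<Sum>i\<in>B. ?D i z) = (real n - (\<Sum>i\<in>B. h i z)) * r z - (\<Sum>i\<in>B. (G i z)\<^sup>2)"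
      by (simp add: sum_subtractf sum_distrib_right left_diff_distrib n_def)
    also have "\<dots> \<ge> (real n - CARD('p)) * r z - r z"
      using H G2 r0[of z] by (intro diff_mono mult_right_mono) auto
    finally have D: "(\<Sum>i\<in>B. ?D i z) \<ge> c\<^sub>1 * r z" by (simp add: c\<^sub>1_def n_def algebra_simps)
    have "(\<Sum>i\<in>B. c\<^sup>2 * (G i z)\<^sup>2 - 2 * c * \<epsilon>\<^sup>2 * ?D i z) = c\<^sup>2 * (\<Sum>i\<in>B. (G i z)\<^sup>2) - 2 * c * \<epsilon>\<^sup>2 * (\<Sum>i\<in>B. ?D i z)"
      by (subst sum_subtractf) (simp only: sum_distrib_left)
    also have "\<dots> \<le> c\<^sup>2 * r z - 2 * c * \<epsilon>\<^sup>2 * (c\<^sub>1 * r z)"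
      using G2 D c by (intro diff_mono mult_left_mono) auto
    also have "\<dots> = - (\<epsilon>^4 * c\<^sub>1\<^sup>2) * r z"
      by (simp add: c_def power2_eq_square power4_eq_xxxx algebra_simps)
    finally show ?thesis .
  qed
  have "(\<integral>z. (\<Sum>i\<in>B. (e z i)\<^sup>2) \<partial>noise) = (\<Sum>i\<in>B. \<epsilon>\<^sup>2 + (\<integral>z. c\<^sup>2 * (G i z)\<^sup>2 - 2 * c * \<epsilon>\<^sup>2 * ?D i z \<partial>noise))"
    using int_e by (subst Bochner_Integration.integral_sum) (auto simp: ie)
  also have "\<dots> = \<epsilon>\<^sup>2 * n + (\<integral>z. (\<Sum>i\<in>B. c\<^sup>2 * (G i z)\<^sup>2 - 2 * c * \<epsilon>\<^sup>2 * ?D i z) \<partial>noise)"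
    by (subst Bochner_Integration.integral_sum)
      (auto simp: sum.distrib n_def intro!: Bochner_Integration.integrable_diff integrable_mult_right stein)
  also have "\<dots> \<le> \<epsilon>\<^sup>2 * n + (\<integral>z. - (\<epsilon>^4 * c\<^sub>1\<^sup>2) * r z \<partial>noise)"
    by (intro add_left_mono integral_mono pw integrable_mult_right int_r Bochner_Integration.integrable_sum
        Bochner_Integration.integrable_diff stein)
  finally show "(\<integral>z. (\<Sum>i\<in>B. (e z i)\<^sup>2) \<partial>noise) \<le> \<epsilon>\<^sup>2 * card B - \<epsilon>^4 * c\<^sub>1\<^sup>2 * (\<integral>z. r z \<partial>noise)"
    by (simp add: n_def)
  define X where "X = (\<lambda>z. \<delta> + (\<Sum>i\<in>B. (u k \<bullet> obs \<epsilon> \<theta> z i)\<^sup>2))"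
  define \<mu> where "\<mu> = \<delta> + card B * \<epsilon>\<^sup>2 + (\<Sum>i\<in>B. (u k \<bullet> \<theta> i)\<^sup>2)"
  have \<mu>: "\<mu> > 0" unfolding \<mu>_def using pos by (intro add_pos_nonneg) (auto simp: sum_nonneg)
  have X0: "X z > 0" for z unfolding X_def using pos by (intro add_pos_nonneg) (auto simp: sum_nonneg)
  have sq: "(u k \<bullet> obs \<epsilon> \<theta> z i)\<^sup>2 = (u k \<bullet> \<theta> i)\<^sup>2 + 2 * (u k \<bullet> \<theta> i) * \<epsilon> * z (i, k) + \<epsilon>\<^sup>2 * (z (i, k))\<^sup>2" for z i
    by (simp add: inner_obs power2_eq_square algebra_simps)
  have isq: "integrable noise (\<lambda>z. (u k \<bullet> obs \<epsilon> \<theta> z i)\<^sup>2)" for i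
    unfolding sq by (intro Bochner_Integration.integrable_add integrable_mult_right noise_second_moment P.integrable_const)
  have int_X: "integrable noise X" unfolding X_def by (intro Bochner_Integration.integrable_add Bochner_Integration.integrable_sum P.integrable_const isq)
  have EX: "(\<integral>z. X z \<partial>noise) = \<mu>"
  proof -
    have "(\<integral>z. (u k \<bullet> obs \<epsilon> \<theta> z i)\<^sup>2 \<partial>noise) = (u k \<bullet> \<theta> i)\<^sup>2 + \<epsilon>\<^sup>2" for i
      unfolding sq using noise_second_moment[of "(i, k)"] P.prob_space by simp
    then show ?thesis unfolding X_def \<mu>_def using isq P.prob_space
      by (simp add: Bochner_Integration.integral_sum sum.distrib)
  qed
  (* r is at least 1 / X, and 1 / X lies above its tangent at the mean \<mu> of X. *)
  have tang: "2 / \<mu> - X z / \<mu>\<^sup>2 \<le> r z" for z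
  proof -
    have "1 = (u k \<bullet> u k)\<^sup>2" by (simp add: orthonormal)
    also have "\<dots> \<le> r z * (u k \<bullet> (gram \<delta> B (obs \<epsilon> \<theta> z) *v u k))"
      unfolding r_def by (rule resolvent_cauchy_schwarz[OF pos])
    also have "u k \<bullet> (gram \<delta> B (obs \<epsilon> \<theta> z) *v u k) = X z"
      by (simp add: gram_form X_def orthonormal inner_commute)
    finally have 1: "1 / X z \<le> r z" using X0[of z] by (simp add: pos_divide_le_eq)
    have "0 \<le> (X z - \<mu>)\<^sup>2 / (X z * \<mu>\<^sup>2)" using X0[of z] by simp
    also have "\<dots> = 1 / X z - (2 / \<mu> - X z / \<mu>\<^sup>2)"
      using X0[of z] \<mu> by (simp add: field_simps power2_eq_square)
    finally show ?thesis using 1 by linarith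
  qed
  have "1 / \<mu> = (\<integral>z. 2 / \<mu> - X z / \<mu>\<^sup>2 \<partial>noise)"
    using int_X \<mu> P.prob_space by (simp add: EX power2_eq_square)
  also have "\<dots> \<le> (\<integral>z. r z \<partial>noise)"
    by (intro integral_mono tang int_r) (use int_X in auto)
  finally show "1 / (\<delta> + card B * \<epsilon>\<^sup>2 + (\<Sum>i\<in>B. (u k \<bullet> \<theta> i)\<^sup>2)) \<le> (\<integral>z. r z \<partial>noise)"
    unfolding \<mu>_def .
qed

lemma measurable_det_gram [measurable]:
  "(\<lambda>z. det (gram \<delta> B (obs \<epsilon> \<theta> z))) \<in> borel_measurable (PiM UNIV (\<lambda>_. borel))"
proof (rule borel_measurable_det)
  fix i j
  have [measurable]: "(\<lambda>z. obs \<epsilon> \<theta> z k $ i) \<in> borel_measurable (PiM UNIV (\<lambda>_. borel))" for k i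
    using measurable_compose[OF measurable_obs, of "\<lambda>x. x $ i" borel] by simp
  show "(\<lambda>z. gram \<delta> B (obs \<epsilon> \<theta> z) $ i $ j) \<in> borel_measurable (PiM UNIV (\<lambda>_. borel))"
    unfolding gram_def by simp
qed

text \<open>The risk of the regularised estimator is nonnegative, so the bound on it yields a bound \<open>K\<close> on the
expectation of the sum over \<open>k\<close> of \<open>u k \<bullet> R (u k)\<close> that does not depend on \<open>\<delta>\<close>. On the singular event this sum is
at least \<open>1 / \<delta>\<close>. The bound on the block length enters because \<open>n - p - 1\<close> has to be positive.\<close>

lemma AE_gram_invertible:
  fixes \<theta> :: "nat \<Rightarrow> real^'p" and \<epsilon> :: real
  assumes fin: "finite B" and \<epsilon>: "\<epsilon> > 0" and card: "card B \<ge> CARD('p) + 2"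
  shows "AE z in noise. invertible (gram 0 B (obs \<epsilon> \<theta> z))"
proof -
  interpret P: prob_space "noise :: (nat \<times> 'p \<Rightarrow> real) measure" by (rule prob_space_noise)
  define c\<^sub>1 where "c\<^sub>1 = real (card B) - real CARD('p) - 1"
  have c1: "c\<^sub>1 > 0" using card by (simp add: c\<^sub>1_def)
  have card': "card B \<ge> CARD('p) + 1" using card by simp
  define E where "E = {z :: nat \<times> 'p \<Rightarrow> real. det (gram 0 B (obs \<epsilon> \<theta> z)) = 0}"
  have E [measurable]: "E \<in> sets noise"
  proof -
    have "{z \<in> space (PiM UNIV (\<lambda>_. borel)). det (gram 0 B (obs \<epsilon> \<theta> z)) = 0} \<in> sets (PiM UNIV (\<lambda>_::nat \<times> 'p. borel))"
      by measurable
    then show ?thesis by (simp add: E_def space_PiM)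
  qed
  define K where "K = CARD('p) * (card B / (\<epsilon>\<^sup>2 * c\<^sub>1\<^sup>2))"
  (* K does not depend on \<delta>, so letting \<delta> tend to 0 shows that E is a null set. *)
  have bound: "P.prob E \<le> \<delta> * K" if \<delta>: "\<delta> > 0" for \<delta>
  proof -
    define r where "r = (\<lambda>k z. u k \<bullet> resolvent \<delta> B (obs \<epsilon> \<theta> z) (u k))"
    have int_r: "integrable noise (r k)" for k
      unfolding r_def by (rule regularised_block_risk(4)[OF fin \<epsilon> \<delta> card'])
    have Er: "(\<integral>z. r k z \<partial>noise) \<le> card B / (\<epsilon>\<^sup>2 * c\<^sub>1\<^sup>2)" for k
    proof -
      let ?e = "\<lambda>z i. u k \<bullet> (obs \<epsilon> \<theta> z i - (\<epsilon>\<^sup>2 * c\<^sub>1) *\<^sub>R resolvent \<delta> B (obs \<epsilon> \<theta> z) (obs \<epsilon> \<theta> z i) - \<theta> i)"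
      have "0 \<le> (\<integral>z. (\<Sum>i\<in>B. (?e z i)\<^sup>2) \<partial>noise)"
        by (rule Bochner_Integration.integral_nonneg) (simp add: sum_nonneg)
      also have "\<dots> \<le> \<epsilon>\<^sup>2 * card B - \<epsilon>^4 * c\<^sub>1\<^sup>2 * (\<integral>z. r k z \<partial>noise)"
        unfolding r_def c\<^sub>1_def by (rule regularised_block_risk(2)[OF fin \<epsilon> \<delta> card'])
      finally have "\<epsilon>\<^sup>2 * (\<epsilon>\<^sup>2 * c\<^sub>1\<^sup>2 * (\<integral>z. r k z \<partial>noise)) \<le> \<epsilon>\<^sup>2 * card B"
        by (simp add: power2_eq_square power4_eq_xxxx mult_ac)
      then have "\<epsilon>\<^sup>2 * c\<^sub>1\<^sup>2 * (\<integral>z. r k z \<partial>noise) \<le> card B"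
        using \<epsilon> by (subst (asm) mult_le_cancel_left_pos) auto
      then show ?thesis using \<epsilon> c1 by (simp add: pos_le_divide_eq mult.commute)
    qed
    have pw: "indicator E z / \<delta> \<le> (\<Sum>k\<in>UNIV. r k z)" for z
    proof (cases "z \<in> E")
      case False
      then show ?thesis by (simp add: sum_nonneg r_def resolvent_form_nonneg[OF \<delta>])
    next
      case True
      then have "\<not> invertible (gram 0 B (obs \<epsilon> \<theta> z))" by (simp add: E_def invertible_det_nz)
      then obtain v where v: "gram 0 B (obs \<epsilon> \<theta> z) *v v = 0" "v \<noteq> 0"
        using invertibleI_ker by blast
      have "gram \<delta> B (obs \<epsilon> \<theta> z) *v v = \<delta> *\<^sub>R v" using v(1) by (simp add: gram_mult)
      then have "(u k \<bullet> v)\<^sup>2 \<le> r k z * (\<delta> * (v \<bullet> v))" for k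
        using resolvent_cauchy_schwarz[OF \<delta>, of "u k" v B "obs \<epsilon> \<theta> z"] by (simp add: r_def)
      then have "(\<Sum>k\<in>UNIV. (u k \<bullet> v)\<^sup>2) \<le> (\<Sum>k\<in>UNIV. r k z * (\<delta> * (v \<bullet> v)))" by (rule sum_mono)
      then have "(v \<bullet> v) * 1 \<le> (v \<bullet> v) * ((\<Sum>k\<in>UNIV. r k z) * \<delta>)"
        unfolding sum_distrib_right[symmetric] power2_eq_square inner_frame[of v v, symmetric]
        by (simp add: mult_ac)
      then have "1 \<le> (\<Sum>k\<in>UNIV. r k z) * \<delta>"
        using v(2) by (subst (asm) mult_le_cancel_left_pos) auto
      then show ?thesis using \<delta> True by (simp add: pos_divide_le_eq)
    qed
    have "P.prob E / \<delta> = (\<integral>z. indicator E z / \<delta> \<partial>noise)" by simp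
    also have "\<dots> \<le> (\<integral>z. (\<Sum>k\<in>UNIV. r k z) \<partial>noise)"
    proof (intro integral_mono pw Bochner_Integration.integrable_sum int_r)
      have "integrable noise (indicator E :: _ \<Rightarrow> real)"
        by (rule integrable_real_indicator[OF E]) (simp add: P.emeasure_eq_measure)
      then show "integrable noise (\<lambda>z. indicat_real E z / \<delta>)" by simp
    qed
    also have "\<dots> = (\<Sum>k\<in>UNIV. \<integral>z. r k z \<partial>noise)" using int_r by simp
    also have "\<dots> \<le> K" unfolding K_def using sum_bounded_above[of UNIV "\<lambda>k. \<integral>z. r k z \<partial>noise", OF Er] by simp
    finally show ?thesis using \<delta> by (simp add: pos_divide_le_eq mult.commute)
  qed
  have "K \<ge> 0" unfolding K_def by simp
  have "P.prob E \<le> 0"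
  proof (rule field_le_epsilon)
    fix e :: real assume e: "e > 0"
    have "P.prob E \<le> e / (K + 1) * K" by (rule bound) (use e \<open>K \<ge> 0\<close> in simp)
    also have "\<dots> \<le> e / (K + 1) * (K + 1)" using e \<open>K \<ge> 0\<close> by (intro mult_left_mono) auto
    also have "\<dots> = e" using \<open>K \<ge> 0\<close> by simp
    finally show "P.prob E \<le> 0 + e" by simp
  qed
  then have "P.prob E = 0" by (simp add: measure_le_0_iff)
  then have "E \<in> null_sets noise" using E by (simp add: P.emeasure_eq_measure null_sets_def)
  moreover have "{z \<in> space noise. \<not> invertible (gram 0 B (obs \<epsilon> \<theta> z))} \<subseteq> E"
    by (auto simp: E_def invertible_det_nz)
  ultimately show ?thesis by (rule AE_I')
qed

text \<open>Fatou's lemma for \<open>\<delta> = 1 / (j + 1)\<close>: where the Gram matrix is invertible, the regularised estimators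
converge to the estimator itself.\<close>

lemma efron_morris_block_risk:
  fixes k :: 'p and \<theta> :: "nat \<Rightarrow> real^'p" and \<epsilon> :: real
  assumes fin: "finite B" and \<epsilon>: "\<epsilon> > 0" and card: "card B \<ge> CARD('p) + 2"
  defines "c\<^sub>1 \<equiv> real (card B) - real CARD('p) - 1"
  defines "m \<equiv> \<Sum>i\<in>B. (u k \<bullet> \<theta> i)\<^sup>2"
  shows "(\<integral>\<^sup>+z. (\<Sum>i\<in>B. ennreal ((u k \<bullet> (obs \<epsilon> \<theta> z i - (\<epsilon>\<^sup>2 * c\<^sub>1) *\<^sub>R resolvent 0 B (obs \<epsilon> \<theta> z) (obs \<epsilon> \<theta> z i) - \<theta> i))\<^sup>2)) \<partial>noise)
     \<le> ennreal (\<epsilon>\<^sup>2 * card B - \<epsilon>^4 * c\<^sub>1\<^sup>2 / (card B * \<epsilon>\<^sup>2 + m))"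
proof -
  have card': "card B \<ge> CARD('p) + 1" using card by simp
  define e where "e = (\<lambda>\<delta> z i. u k \<bullet> (obs \<epsilon> \<theta> z i - (\<epsilon>\<^sup>2 * c\<^sub>1) *\<^sub>R resolvent \<delta> B (obs \<epsilon> \<theta> z) (obs \<epsilon> \<theta> z i) - \<theta> i))"
  define F where "F = (\<lambda>\<delta> z. \<Sum>i\<in>B. ennreal ((e \<delta> z i)\<^sup>2))"
  define a where "a = (\<lambda>\<delta>. \<epsilon>\<^sup>2 * card B - \<epsilon>^4 * c\<^sub>1\<^sup>2 / (\<delta> + card B * \<epsilon>\<^sup>2 + m))"
  define \<delta> where "\<delta> = (\<lambda>j. 1 / real (Suc j))"
  have \<delta>0: "\<delta> j > 0" for j by (simp add: \<delta>_def)
  have "\<delta> \<longlonglongrightarrow> 0" unfolding \<delta>_def by (rule lim_1_over_n[THEN LIMSEQ_Suc])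
  then have \<delta>lim: "filterlim \<delta> (at 0) sequentially"
    using \<delta>0 by (simp add: filterlim_at less_imp_neq[symmetric])
  have m: "m \<ge> 0" unfolding m_def by (simp add: sum_nonneg)
  have nB: "card B * \<epsilon>\<^sup>2 > 0" using card \<epsilon> by simp
  have Fm: "F d \<in> borel_measurable noise" for d
  proof -
    have [measurable]: "(\<lambda>z. resolvent d B (obs \<epsilon> \<theta> z) (obs \<epsilon> \<theta> z i)) \<in> borel_measurable (PiM UNIV (\<lambda>_. borel))" for i
      by (rule measurable_resolvent_obs) simp
    show ?thesis unfolding F_def e_def by measurable
  qed
  have Fb: "(\<integral>\<^sup>+z. F d z \<partial>noise) \<le> ennreal (a d)" if d: "d > 0" for d
  proof -
    have "(\<integral>\<^sup>+z. F d z \<partial>noise) = (\<integral>\<^sup>+z. ennreal (\<Sum>i\<in>B. (e d z i)\<^sup>2) \<partial>noise)"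
      unfolding F_def by (simp add: sum_ennreal)
    also have "\<dots> = ennreal (\<integral>z. (\<Sum>i\<in>B. (e d z i)\<^sup>2) \<partial>noise)"
      unfolding e_def c\<^sub>1_def
      by (rule nn_integral_eq_integral[OF regularised_block_risk(1)[OF fin \<epsilon> d card']]) (simp add: sum_nonneg)
    also have "\<dots> \<le> ennreal (a d)"
    proof (rule ennreal_leI)
      have "(\<integral>z. (\<Sum>i\<in>B. (e d z i)\<^sup>2) \<partial>noise) \<le> \<epsilon>\<^sup>2 * card B - \<epsilon>^4 * c\<^sub>1\<^sup>2 * (\<integral>z. u k \<bullet> resolvent d B (obs \<epsilon> \<theta> z) (u k) \<partial>noise)"
        unfolding e_def c\<^sub>1_def by (rule regularised_block_risk(2)[OF fin \<epsilon> d card'])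
      also have "\<dots> \<le> \<epsilon>\<^sup>2 * card B - \<epsilon>^4 * c\<^sub>1\<^sup>2 * (1 / (d + card B * \<epsilon>\<^sup>2 + m))"
        unfolding m_def using regularised_block_risk(3)[OF fin \<epsilon> d card']
        by (intro diff_left_mono mult_left_mono) auto
      finally show "(\<integral>z. (\<Sum>i\<in>B. (e d z i)\<^sup>2) \<partial>noise) \<le> a d" by (simp add: a_def)
    qed
    finally show ?thesis .
  qed
  have "AE z in noise. F 0 z = liminf (\<lambda>j. F (\<delta> j) z)"
    using AE_gram_invertible[OF fin \<epsilon> card, of \<theta>]
  proof eventually_elim
    case (elim z)
    have "((\<lambda>d. F d z) \<longlongrightarrow> F 0 z) (at 0)"
      unfolding F_def e_def
      by (intro tendsto_intros tendsto_ennrealI resolvent_tendsto elim)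
    then have "(\<lambda>j. F (\<delta> j) z) \<longlonglongrightarrow> F 0 z" using \<delta>lim by (rule filterlim_compose)
    then show ?case by (simp add: lim_imp_Liminf)
  qed
  then have "(\<integral>\<^sup>+z. F 0 z \<partial>noise) = (\<integral>\<^sup>+z. liminf (\<lambda>j. F (\<delta> j) z) \<partial>noise)"
    by (rule nn_integral_cong_AE)
  also have "\<dots> \<le> liminf (\<lambda>j. \<integral>\<^sup>+z. F (\<delta> j) z \<partial>noise)"
    by (rule nn_integral_liminf) (rule Fm)
  also have "\<dots> \<le> liminf (\<lambda>j. ennreal (a (\<delta> j)))"
    by (intro Liminf_mono always_eventually allI Fb \<delta>0)
  also have "\<dots> = ennreal (a 0)"
  proof (rule lim_imp_Liminf)
    have "(a \<longlongrightarrow> a 0) (at 0)"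
      unfolding a_def using nB m by (intro tendsto_intros) auto
    then show "(\<lambda>j. ennreal (a (\<delta> j))) \<longlonglongrightarrow> ennreal (a 0)"
      using \<delta>lim by (intro tendsto_ennrealI) (rule filterlim_compose)
  qed simp
  finally show ?thesis by (simp add: F_def e_def a_def)
qed

text \<open>With \<open>V = n \<epsilon>\<^sup>2\<close>, the main part \<open>V m / (V + m)\<close> is the minimum over \<open>w\<close> of
\<open>w\<^sup>2 V + (1 - w)\<^sup>2 m\<close>, the risk of multiplying the block by \<open>w\<close>. The difference between \<open>n\<close> and
\<open>n - P\<close> costs at most \<open>2 P \<epsilon>\<^sup>2\<close>.\<close>

lemma efron_morris_block_oracle:
  fixes n m \<epsilon> w P :: real
  assumes \<epsilon>: "\<epsilon> > 0" and n: "n > 0" "P \<ge> 0" "n \<ge> P" and m: "m \<ge> 0"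
  shows "\<epsilon>\<^sup>2 * n - \<epsilon>^4 * (n - P)\<^sup>2 / (n * \<epsilon>\<^sup>2 + m) \<le> w\<^sup>2 * (n * \<epsilon>\<^sup>2) + (1 - w)\<^sup>2 * m + 2 * P * \<epsilon>\<^sup>2"
proof -
  define V where "V = n * \<epsilon>\<^sup>2"
  have V: "V > 0" using \<epsilon> n by (simp add: V_def)
  define s where "s = V + m"
  have s: "s > 0" using V m by (simp add: s_def)
  have "\<epsilon>\<^sup>2 * n - \<epsilon>^4 * (n - P)\<^sup>2 / (n * \<epsilon>\<^sup>2 + m) = V - (V - P * \<epsilon>\<^sup>2)\<^sup>2 / s"
    by (simp add: V_def s_def power2_eq_square power4_eq_xxxx algebra_simps)
  also have "\<dots> = (V * s - V\<^sup>2) / s + (2 * V * (P * \<epsilon>\<^sup>2) - (P * \<epsilon>\<^sup>2)\<^sup>2) / s"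
    using s by (simp add: field_simps power2_eq_square)
  also have "\<dots> \<le> (w\<^sup>2 * V + (1 - w)\<^sup>2 * m) + 2 * P * \<epsilon>\<^sup>2"
  proof (rule add_mono)
    have "(w\<^sup>2 * V + (1 - w)\<^sup>2 * m) * s - (V * s - V\<^sup>2) = (w * s - m)\<^sup>2"
      by (simp add: s_def power2_eq_square algebra_simps)
    then have "V * s - V\<^sup>2 \<le> (w\<^sup>2 * V + (1 - w)\<^sup>2 * m) * s"
      using zero_le_power2[of "w * s - m"] by linarith
    then show "(V * s - V\<^sup>2) / s \<le> w\<^sup>2 * V + (1 - w)\<^sup>2 * m" using s by (simp add: pos_divide_le_eq)
    have "2 * V * (P * \<epsilon>\<^sup>2) - (P * \<epsilon>\<^sup>2)\<^sup>2 \<le> 2 * s * (P * \<epsilon>\<^sup>2) - 0"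
      using m n \<epsilon> by (intro diff_mono mult_right_mono mult_left_mono) (auto simp: s_def)
    then show "(2 * V * (P * \<epsilon>\<^sup>2) - (P * \<epsilon>\<^sup>2)\<^sup>2) / s \<le> 2 * P * \<epsilon>\<^sup>2"
      using s by (simp add: pos_divide_le_eq mult_ac)
  qed
  finally show ?thesis by (simp add: V_def)
qed

end

section \<open>Sums of Pinsker's weights\<close>

text \<open>The comparison of a sum with the integral of a decreasing function, with the integral given by an
antiderivative \<open>G\<close> on the support \<open>{0..h}\<close>.\<close>

lemma antimono_sum_bounds:
  fixes f G :: "real \<Rightarrow> real" and h :: real
  assumes h: "h > 0" and anti: "\<And>x y. 0 \<le> x \<Longrightarrow> x \<le> y \<Longrightarrow> f y \<le> f x"
    and nn: "\<And>x. x \<ge> 0 \<Longrightarrow> f x \<ge> 0" and zero: "\<And>x. x \<ge> h \<Longrightarrow> f x = 0"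
    and cont: "continuous_on {0..h} G"
    and der: "\<And>x. 0 < x \<Longrightarrow> x < h \<Longrightarrow> (G has_real_derivative f x) (at x)"
    and G0: "G 0 = 0"
  shows "(\<Sum>i=1..n. f (real i)) \<le> G h"
    "h \<le> real n \<Longrightarrow> G h \<le> f 0 + (\<Sum>i=1..n. f (real i))"
proof -
  define H where "H = (\<lambda>x. G (min x h))"
  (* The mean value theorem is applied on the part of [x, y] below h; beyond h both H and f are flat. *)
  have inc: "(y - x) * f y \<le> H y - H x \<and> H y - H x \<le> (y - x) * f x" if xy: "0 \<le> x" "x \<le> y" for x y
  proof (cases "x < h \<and> x < y")
    case False
    then consider "x \<ge> h" | "x = y" using xy by linarith
    then show ?thesis using xy zero by cases (auto simp: H_def min_absorb2)
  next
    case True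
    define y' where "y' = min y h"
    have y': "x < y'" "y' \<le> h" "y' \<le> y" using True by (auto simp: y'_def)
    have "\<exists>l z. x < z \<and> z < y' \<and> (G has_real_derivative l) (at z) \<and> G y' - G x = (y' - x) * l"
    proof (rule MVT)
      show "continuous_on {x..y'} G" using cont by (rule continuous_on_subset) (use xy y' in auto)
      show "G differentiable (at z)" if "x < z" "z < y'" for z
        using der[of z] that xy y' by (auto simp: real_differentiable_def)
    qed (use y' in simp)
    then obtain l z where z: "x < z" "z < y'" "(G has_real_derivative l) (at z)" "G y' - G x = (y' - x) * l" by blast
    have l: "l = f z" using DERIV_unique[OF z(3) der[of z]] z xy y' by simp
    have HH: "H y - H x = (y' - x) * f z" using z l True by (simp add: H_def y'_def)
    have "(y' - x) * f z \<le> (y' - x) * f x" using anti[of x z] xy z y' by (intro mult_left_mono) auto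
    also have "\<dots> \<le> (y - x) * f x" using nn[of x] xy y' by (intro mult_right_mono) auto
    finally have up: "(y' - x) * f z \<le> (y - x) * f x" .
    have "(y - x) * f y \<le> (y' - x) * f z"
    proof (cases "y \<le> h")
      case True
      then have "y' = y" by (simp add: y'_def)
      then show ?thesis using anti[of z y] z xy by (intro mult_mono) (auto intro: nn)
    next
      case False
      then have "f y = 0" by (simp add: zero)
      then show ?thesis using nn[of z] z xy by simp
    qed
    then show ?thesis using up HH by simp
  qed
  have Hh: "H x = G h" if "x \<ge> h" for x using that by (simp add: H_def min_absorb2)
  have H0: "H 0 = 0" using h G0 by (simp add: H_def)
  have le: "H x \<le> G h" if "x \<ge> 0" for x
  proof (cases "x \<ge> h")
    case False
    then have "0 \<le> (h - x) * f h" by (simp add: nn h less_imp_le)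
    also have "\<dots> \<le> H h - H x" using inc[of x h] that False by simp
    finally show ?thesis using Hh[of h] by simp
  qed (simp add: Hh)
  have "(\<Sum>i=1..n. f (real i)) \<le> H (real n) \<and> H (real n) \<le> (\<Sum>i<n. f (real i))" for n
  proof (induction n)
    case (Suc n)
    have "f (real (Suc n)) \<le> H (real (Suc n)) - H (real n) \<and> H (real (Suc n)) - H (real n) \<le> f (real n)"
      using inc[of "real n" "real (Suc n)"] by simp
    then show ?case using Suc.IH by (simp add: sum.nat_ivl_Suc')
  qed (simp add: H0)
  note tele = this
  show "(\<Sum>i=1..n. f (real i)) \<le> G h"
    using tele[of n] le[of "real n"] by simp
  assume hn: "h \<le> real n"
  have "G h \<le> (\<Sum>i<n. f (real i))" using tele[of n] Hh[OF hn] by simp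
  also have "\<dots> \<le> (\<Sum>i<Suc n. f (real i))" using nn[of "real n"] by simp
  also have "(\<Sum>i<Suc n. f (real i)) = f 0 + (\<Sum>i=1..n. f (real i))"
    by (simp only: sum.lessThan_Suc_shift One_nat_def sum.atLeast1_atMost_eq of_nat_0)
  finally show "G h \<le> f 0 + (\<Sum>i=1..n. f (real i))" .
qed

text \<open>The weight of coordinate \<open>i\<close> is \<open>pinsker_weight \<beta> (i / h)\<close>, where the frequency \<open>h\<close> is the
\<open>cutoff\<close> of the frame vector.\<close>

definition pinsker_weight :: "real \<Rightarrow> real \<Rightarrow> real" where
  "pinsker_weight \<beta> x = max 0 (1 - x powr \<beta>)"

lemma pinsker_weight_bounds: "0 \<le> pinsker_weight \<beta> x" "pinsker_weight \<beta> x \<le> 1"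
  by (simp_all add: pinsker_weight_def)

lemma pinsker_weight_antimono:
  "\<beta> > 0 \<Longrightarrow> 0 \<le> x \<Longrightarrow> x \<le> y \<Longrightarrow> pinsker_weight \<beta> y \<le> pinsker_weight \<beta> x"
  unfolding pinsker_weight_def using powr_mono2[of \<beta> x y] by auto

lemma pinsker_weight_zero: "\<beta> > 0 \<Longrightarrow> x \<ge> 1 \<Longrightarrow> pinsker_weight \<beta> x = 0"
  unfolding pinsker_weight_def using ge_one_powr_ge_zero[of x \<beta>] by auto

text \<open>The factor \<open>\<beta> / (\<beta> + 1)\<close> is the integral of \<open>1 - x powr \<beta>\<close> over the unit interval.\<close>

lemma pinsker_weight_sum1:
  assumes \<beta>: "\<beta> > 0" and h: "h > 0"
  shows "(\<Sum>i=1..n. pinsker_weight \<beta> (real i / h)) \<le> h * (\<beta> / (\<beta> + 1))"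
    "h \<le> real n \<Longrightarrow> h * (\<beta> / (\<beta> + 1)) - 1 \<le> (\<Sum>i=1..n. pinsker_weight \<beta> (real i / h))"
proof -
  define G where "G = (\<lambda>x. x - x powr (\<beta> + 1) / ((\<beta> + 1) * h powr \<beta>))"
  have Gh: "G h = h * (\<beta> / (\<beta> + 1))"
  proof -
    have "h powr (\<beta> + 1) / ((\<beta> + 1) * h powr \<beta>) = h / (\<beta> + 1)"
      using h by (simp add: powr_add)
    then have "G h = h - h / (\<beta> + 1)" by (simp only: G_def)
    also have "\<dots> = h * (\<beta> / (\<beta> + 1))" using \<beta> by (simp add: field_simps)
    finally show ?thesis .
  qed
  have cp: "continuous_on {0..h} (\<lambda>x. x powr a)" if "a > 0" for a
    using that by (intro continuous_on_powr' continuous_on_id continuous_on_const) auto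
  have "(\<beta> + 1) * h powr \<beta> \<noteq> 0" "(2 * \<beta> + 1) * h powr (2 * \<beta>) \<noteq> 0" using \<beta> h by auto
  then have cont: "continuous_on {0..h} G" unfolding G_def using \<beta>
    by (intro continuous_on_add continuous_on_diff continuous_on_divide continuous_on_mult
        continuous_on_id continuous_on_const cp) simp_all
  have der: "(G has_real_derivative pinsker_weight \<beta> (x / h)) (at x)" if x: "0 < x" "x < h" for x
  proof -
    have "pinsker_weight \<beta> (x / h) = 1 - x powr \<beta> / h powr \<beta>"
      using x \<beta> powr_le1[of \<beta> "x / h"] by (simp add: pinsker_weight_def powr_divide)
    then show ?thesis
      unfolding G_def using x h \<beta> by (auto intro!: derivative_eq_intros)
  qed
  have anti: "pinsker_weight \<beta> (y / h) \<le> pinsker_weight \<beta> (x / h)" if "0 \<le> x" "x \<le> y" for x y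
    using that \<beta> h by (intro pinsker_weight_antimono pinsker_weight_bounds divide_right_mono) auto
  have zero: "pinsker_weight \<beta> (x / h) = 0" if "x \<ge> h" for x
    using that \<beta> h by (simp add: pinsker_weight_zero)
  have nn: "pinsker_weight \<beta> (x / h) \<ge> 0" for x by (simp add: pinsker_weight_bounds)
  have G0: "G 0 = 0" using \<beta> by (simp add: G_def)
  note * = antimono_sum_bounds[where f = "\<lambda>x. pinsker_weight \<beta> (x / h)", OF h anti nn zero cont der G0, of n]
  show "(\<Sum>i=1..n. pinsker_weight \<beta> (real i / h)) \<le> h * (\<beta> / (\<beta> + 1))" using * Gh by simp
  show "h \<le> real n \<Longrightarrow> h * (\<beta> / (\<beta> + 1)) - 1 \<le> (\<Sum>i=1..n. pinsker_weight \<beta> (real i / h))"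
    using * Gh pinsker_weight_bounds(2)[of \<beta> 0] by auto
qed

text \<open>The factor is the integral of \<open>(1 - x powr \<beta>)\<^sup>2\<close> over the unit interval.\<close>

lemma pinsker_weight_sum2:
  assumes \<beta>: "\<beta> > 0" and h: "h > 0"
  shows "(\<Sum>i=1..n. (pinsker_weight \<beta> (real i / h))\<^sup>2) \<le> h * (2 * \<beta>\<^sup>2 / ((\<beta> + 1) * (2 * \<beta> + 1)))"
    "h \<le> real n \<Longrightarrow> h * (2 * \<beta>\<^sup>2 / ((\<beta> + 1) * (2 * \<beta> + 1))) - 1 \<le> (\<Sum>i=1..n. (pinsker_weight \<beta> (real i / h))\<^sup>2)"
proof -
  define G where "G = (\<lambda>x. x - 2 * x powr (\<beta> + 1) / ((\<beta> + 1) * h powr \<beta>) + x powr (2 * \<beta> + 1) / ((2 * \<beta> + 1) * h powr (2 * \<beta>)))"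
  have Gh: "G h = h * (2 * \<beta>\<^sup>2 / ((\<beta> + 1) * (2 * \<beta> + 1)))"
  proof -
    have "2 * h powr (\<beta> + 1) / ((\<beta> + 1) * h powr \<beta>) = 2 * h / (\<beta> + 1)"
      "h powr (2 * \<beta> + 1) / ((2 * \<beta> + 1) * h powr (2 * \<beta>)) = h / (2 * \<beta> + 1)"
    proof -
      have P: "b * (p * h) / (q * p) = b * h / q" if "p \<noteq> 0" for b p q :: real using that by simp
      show "2 * h powr (\<beta> + 1) / ((\<beta> + 1) * h powr \<beta>) = 2 * h / (\<beta> + 1)"
        using h P[of "h powr \<beta>" 2] by (simp add: powr_add)
      show "h powr (2 * \<beta> + 1) / ((2 * \<beta> + 1) * h powr (2 * \<beta>)) = h / (2 * \<beta> + 1)"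
        using h P[of "h powr (2 * \<beta>)" 1] by (simp add: powr_add)
    qed
    then have "G h = h - 2 * h / (\<beta> + 1) + h / (2 * \<beta> + 1)" by (simp only: G_def)
    also have "\<dots> = h * (2 * \<beta>\<^sup>2 / ((\<beta> + 1) * (2 * \<beta> + 1)))"
    proof -
      have "\<beta> + 1 \<noteq> 0" "2 * \<beta> + 1 \<noteq> 0" using \<beta> by auto
      then show ?thesis by (simp add: divide_simps) (simp add: power2_eq_square algebra_simps)
    qed
    finally show ?thesis .
  qed
  have cp: "continuous_on {0..h} (\<lambda>x. x powr a)" if "a > 0" for a
    using that by (intro continuous_on_powr' continuous_on_id continuous_on_const) auto
  have "(\<beta> + 1) * h powr \<beta> \<noteq> 0" "(2 * \<beta> + 1) * h powr (2 * \<beta>) \<noteq> 0" using \<beta> h by auto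
  then have cont: "continuous_on {0..h} G" unfolding G_def using \<beta>
    by (intro continuous_on_add continuous_on_diff continuous_on_divide continuous_on_mult
        continuous_on_id continuous_on_const cp) simp_all
  have der: "(G has_real_derivative (pinsker_weight \<beta> (x / h))\<^sup>2) (at x)" if x: "0 < x" "x < h" for x
  proof -
    have "pinsker_weight \<beta> (x / h) = 1 - x powr \<beta> / h powr \<beta>"
      using x \<beta> powr_le1[of \<beta> "x / h"] by (simp add: pinsker_weight_def powr_divide)
    then have eq: "(pinsker_weight \<beta> (x / h))\<^sup>2 = 1 - 2 * (x powr \<beta> / h powr \<beta>) + x powr (2 * \<beta>) / h powr (2 * \<beta>)"
    proof -
      have "t powr (2 * \<beta>) = (t powr \<beta>)\<^sup>2" for t :: real
        unfolding mult_2 powr_add power2_eq_square ..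
      then show ?thesis using \<open>pinsker_weight \<beta> (x / h) = _\<close>
        by (simp add: power2_diff power_divide)
    qed
    show ?thesis
      unfolding G_def eq using x h \<beta> by (auto intro!: derivative_eq_intros)
  qed
  have anti: "(pinsker_weight \<beta> (y / h))\<^sup>2 \<le> (pinsker_weight \<beta> (x / h))\<^sup>2" if "0 \<le> x" "x \<le> y" for x y
    using that \<beta> h by (intro power_mono pinsker_weight_antimono pinsker_weight_bounds divide_right_mono) auto
  have zero: "(pinsker_weight \<beta> (x / h))\<^sup>2 = 0" if "x \<ge> h" for x
    using that \<beta> h by (simp add: pinsker_weight_zero)
  have nn: "(pinsker_weight \<beta> (x / h))\<^sup>2 \<ge> 0" for x by (simp add: pinsker_weight_bounds)
  have G0: "G 0 = 0" using \<beta> by (simp add: G_def)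
  note * = antimono_sum_bounds[where f = "\<lambda>x. (pinsker_weight \<beta> (x / h))\<^sup>2", OF h anti nn zero cont der G0, of n]
  show "(\<Sum>i=1..n. (pinsker_weight \<beta> (real i / h))\<^sup>2) \<le> h * (2 * \<beta>\<^sup>2 / ((\<beta> + 1) * (2 * \<beta> + 1)))" using * Gh by simp
  have "(pinsker_weight \<beta> 0)\<^sup>2 \<le> 1" using pinsker_weight_bounds[of \<beta> 0] by (simp add: power_le_one)
  then show "h \<le> real n \<Longrightarrow> h * (2 * \<beta>\<^sup>2 / ((\<beta> + 1) * (2 * \<beta> + 1))) - 1 \<le> (\<Sum>i=1..n. (pinsker_weight \<beta> (real i / h))\<^sup>2)"
    using * Gh by auto
qed

section \<open>Geometry of the weakly geometric blocks\<close>

context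
  fixes \<epsilon> L :: real
  assumes \<epsilon>: "0 < \<epsilon>" and L: "L = ln (1 / \<epsilon>)" and L1: "2 < L"
begin

lemma wgb_rho_eq: "wgb_rho \<epsilon> = 1 / L"
  by (simp add: wgb_rho_def L)

text \<open>The block ends before rounding.\<close>

definition "wgb_x j = L * (1 + 1 / L) ^ j"

lemma wgb_x_eq: "1 / wgb_rho \<epsilon> * (1 + wgb_rho \<epsilon>) ^ j = wgb_x j"
  by (simp add: wgb_x_def wgb_rho_eq)

lemma wgb_x_Suc: "wgb_x (Suc j) = wgb_x j * (1 + 1 / L)"
  by (simp add: wgb_x_def)

lemma wgb_x_mono: "i \<le> j \<Longrightarrow> wgb_x i \<le> wgb_x j"
  unfolding wgb_x_def using L1 by (intro mult_left_mono power_increasing) auto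

lemma wgb_x_ge: "wgb_x j \<ge> L"
  using wgb_x_mono[of 0 j] by (simp add: wgb_x_def)

lemma exp_L: "1 / \<epsilon>\<^sup>2 = exp (2 * L)"
proof -
  have "exp L = 1 / \<epsilon>" unfolding L using \<epsilon> by simp
  then show ?thesis by (simp add: exp_double power_divide)
qed

lemma L_less: "L + 1 < 1 / \<epsilon>\<^sup>2"
proof -
  have "L + 1 \<le> exp L" using exp_ge_add_one_self[of L] by (simp add: add.commute)
  also have "\<dots> < exp (2 * L)" using L1 by simp
  finally show ?thesis by (simp add: exp_L)
qed

lemma wgb_J_props:
  shows "1 / \<epsilon>\<^sup>2 \<le> wgb_x (wgb_J \<epsilon>)" "j < wgb_J \<epsilon> \<Longrightarrow> wgb_x j < 1 / \<epsilon>\<^sup>2" "wgb_J \<epsilon> \<ge> 2"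
proof -
  have J: "wgb_J \<epsilon> = (LEAST j. 1 / \<epsilon>\<^sup>2 \<le> wgb_x j)"
    unfolding wgb_J_def wgb_x_eq ..
  have ex: "\<exists>j. 1 / \<epsilon>\<^sup>2 \<le> wgb_x j"
  proof -
    obtain j where j: "1 / \<epsilon>\<^sup>2 < (1 + 1 / L) ^ j" using real_arch_pow[of "1 + 1 / L" "1 / \<epsilon>\<^sup>2"] L1 by auto
    note j
    also have "(1 + 1 / L) ^ j \<le> wgb_x j"
      using mult_right_mono[of 1 L "(1 + 1 / L) ^ j"] L1 by (simp add: wgb_x_def)
    finally show ?thesis by (auto intro: less_imp_le)
  qed
  show 1: "1 / \<epsilon>\<^sup>2 \<le> wgb_x (wgb_J \<epsilon>)" unfolding J by (rule LeastI_ex[OF ex])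
  show "j < wgb_J \<epsilon> \<Longrightarrow> wgb_x j < 1 / \<epsilon>\<^sup>2" unfolding J using not_less_Least[of j] by force
  show "wgb_J \<epsilon> \<ge> 2"
  proof (rule ccontr)
    assume "\<not> wgb_J \<epsilon> \<ge> 2"
    then have "wgb_x (wgb_J \<epsilon>) \<le> wgb_x 1" by (intro wgb_x_mono) simp
    also have "wgb_x 1 = L + 1" using L1 by (simp add: wgb_x_def field_simps)
    finally show False using 1 L_less by simp
  qed
qed

lemma wgb_l_0: "wgb_l \<epsilon> 0 = 0" and wgb_l_J: "wgb_l \<epsilon> (wgb_J \<epsilon>) = wgb_N \<epsilon>"
  using wgb_J_props(3) by (simp_all add: wgb_l_def)

lemma wgb_l_less: "0 < j \<Longrightarrow> j < wgb_J \<epsilon> \<Longrightarrow> wgb_l \<epsilon> j = nat \<lfloor>wgb_x j\<rfloor>"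
  unfolding wgb_l_def wgb_x_eq by simp

lemma wgb_l_le: "j \<le> wgb_J \<epsilon> \<Longrightarrow> real (wgb_l \<epsilon> j) \<le> wgb_x j"
proof -
  assume j: "j \<le> wgb_J \<epsilon>"
  have x0: "0 \<le> wgb_x j" using wgb_x_ge[of j] L1 by linarith
  consider "j = 0" | "0 < j" "j < wgb_J \<epsilon>" | "j = wgb_J \<epsilon>" using j by linarith
  then show ?thesis
  proof cases
    case 3
    have "real (wgb_N \<epsilon>) \<le> 1 / \<epsilon>\<^sup>2" unfolding wgb_N_def by (simp add: of_nat_floor)
    then show ?thesis using wgb_J_props(1) 3 by (simp add: wgb_l_J)
  qed (use x0 in \<open>simp_all add: wgb_l_0 wgb_l_less of_nat_floor\<close>)
qed

lemma wgb_l_Suc: "j < wgb_J \<epsilon> \<Longrightarrow> wgb_l \<epsilon> j \<le> wgb_l \<epsilon> (Suc j)"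
proof -
  assume j: "j < wgb_J \<epsilon>"
  consider "j = 0" | "0 < j" "Suc j < wgb_J \<epsilon>" | "0 < j" "Suc j = wgb_J \<epsilon>" using j by linarith
  then show ?thesis
  proof cases
    case 2
    then show ?thesis using wgb_x_mono[of j "Suc j"] by (simp add: wgb_l_less nat_mono floor_mono)
  next
    case 3
    have "wgb_l \<epsilon> j = nat \<lfloor>wgb_x j\<rfloor>" using 3 by (simp add: wgb_l_less)
    also have "\<dots> \<le> nat \<lfloor>1 / \<epsilon>\<^sup>2\<rfloor>" using wgb_J_props(2)[OF j] by (intro nat_mono floor_mono) simp
    also have "\<dots> = wgb_l \<epsilon> (Suc j)" unfolding 3(2) wgb_l_J wgb_N_def ..
    finally show ?thesis .
  qed (simp add: wgb_l_0)
qed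

lemma wgb_l_mono: "i \<le> j \<Longrightarrow> j \<le> wgb_J \<epsilon> \<Longrightarrow> wgb_l \<epsilon> i \<le> wgb_l \<epsilon> j"
proof (induction j rule: dec_induct)
  case (step n)
  then show ?case using wgb_l_Suc[of n] by simp
qed simp

lemma sum_wgb_blocks:
  fixes f :: "nat \<Rightarrow> 'a::comm_monoid_add"
  shows "(\<Sum>i=1..wgb_N \<epsilon>. f i) = (\<Sum>j=1..wgb_J \<epsilon>. \<Sum>i\<in>wgb_block \<epsilon> j. f i)"
proof -
  have "j \<le> wgb_J \<epsilon> \<Longrightarrow> (\<Sum>i=1..wgb_l \<epsilon> j. f i) = (\<Sum>j=1..j. \<Sum>i\<in>wgb_block \<epsilon> j. f i)" for j
  proof (induction j)
    case (Suc j)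
    have "{1..wgb_l \<epsilon> (Suc j)} = {1..wgb_l \<epsilon> j} \<union> wgb_block \<epsilon> (Suc j)"
      using wgb_l_Suc[of j] Suc.prems by (auto simp: wgb_block_def)
    then have "(\<Sum>i=1..wgb_l \<epsilon> (Suc j). f i) = (\<Sum>i=1..wgb_l \<epsilon> j. f i) + (\<Sum>i\<in>wgb_block \<epsilon> (Suc j). f i)"
      by (simp only:, intro sum.union_disjoint) (auto simp: wgb_block_def)
    then show ?case using Suc by simp
  qed (simp add: wgb_l_0)
  from this[of "wgb_J \<epsilon>"] show ?thesis by (simp add: wgb_l_J)
qed

lemma block_of_eq:
  assumes j: "j \<in> {1..wgb_J \<epsilon>}" and i: "i \<in> wgb_block \<epsilon> j"
  shows "block_of \<epsilon> i = wgb_block \<epsilon> j"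
proof -
  have "(THE j. j \<in> {1..wgb_J \<epsilon>} \<and> i \<in> wgb_block \<epsilon> j) = j"
  proof (rule the_equality)
    fix j' assume j': "j' \<in> {1..wgb_J \<epsilon>} \<and> i \<in> wgb_block \<epsilon> j'"
    have False if "a < b" "b \<le> wgb_J \<epsilon>" "i \<in> wgb_block \<epsilon> a" "i \<in> wgb_block \<epsilon> b" for a b
    proof -
      have "wgb_l \<epsilon> a \<le> wgb_l \<epsilon> (b - 1)" using that by (intro wgb_l_mono) auto
      then show False using that by (auto simp: wgb_block_def)
    qed
    from this[of j j'] this[of j' j] show "j' = j" using j j' i by (cases j j' rule: linorder_cases) auto
  qed (use j i in auto)
  then show ?thesis by (simp add: block_of_def)
qed

lemma wgb_block_le: "j \<in> {1..wgb_J \<epsilon>} \<Longrightarrow> i \<in> wgb_block \<epsilon> j \<Longrightarrow> 1 \<le> i \<and> i \<le> wgb_N \<epsilon>"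
  using wgb_l_mono[of j "wgb_J \<epsilon>"] by (auto simp: wgb_block_def wgb_l_J)

text \<open>The blocks grow by the factor \<open>1 + 1 / L\<close> and end near \<open>exp (2 L)\<close>, so about
\<open>2 L / ln (1 + 1 / L)\<close> of them suffice.\<close>

lemma wgb_J_le: "real (wgb_J \<epsilon>) \<le> 1 + 4 * L\<^sup>2"
proof -
  define j where "j = wgb_J \<epsilon> - 1"
  have j: "j < wgb_J \<epsilon>" using wgb_J_props(3) by (simp add: j_def)
  have "(1 + 1 / L) ^ j \<le> L * (1 + 1 / L) ^ j" using mult_right_mono[of 1 L "(1 + 1 / L) ^ j"] L1 by simp
  also have "\<dots> < exp (2 * L)" using wgb_J_props(2)[OF j] by (simp add: wgb_x_def exp_L)
  finally have "real j * ln (1 + 1 / L) < 2 * L"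
    using L1 by (subst (asm) ln_less_cancel_iff[symmetric]) (auto simp: ln_realpow add_pos_pos)
  moreover have "1 / (2 * L) \<le> ln (1 + 1 / L)"
  proof -
    define y where "y = 1 / L"
    have y: "0 \<le> y" "y \<le> 1 / 2" using L1 by (auto simp: y_def field_simps)
    have "y - y\<^sup>2 \<le> ln (1 + y)" using ln_one_plus_pos_lower_bound[of y] y by simp
    moreover have "y\<^sup>2 \<le> y / 2" using mult_left_mono[OF y(2,1)] by (simp add: power2_eq_square)
    ultimately have "y / 2 \<le> ln (1 + y)" by linarith
    then show ?thesis by (simp add: y_def mult.commute)
  qed
  ultimately have "real j * (1 / (2 * L)) < 2 * L"
    using mult_left_mono[of "1 / (2 * L)" "ln (1 + 1 / L)" "real j"] by linarith
  then have "real j < 4 * L\<^sup>2" using L1 by (simp add: field_simps power2_eq_square)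
  then show ?thesis using j unfolding j_def by linarith
qed

lemma wgb_block_1: "i \<in> wgb_block \<epsilon> 1 \<Longrightarrow> real i \<le> L + 1"
proof -
  assume "i \<in> wgb_block \<epsilon> 1"
  then have "real i \<le> real (wgb_l \<epsilon> 1)" by (simp add: wgb_block_def)
  also have "\<dots> \<le> wgb_x 1" using wgb_J_props(3) by (intro wgb_l_le) simp
  also have "wgb_x 1 = L + 1" using L1 by (simp add: wgb_x_def field_simps)
  finally show ?thesis .
qed

text \<open>From the second block on, the elements of a block differ from its start by a factor close to 1. For this
reason weights that are constant on the blocks lose nothing asymptotically.\<close>

lemma wgb_block_ratio:
  assumes j: "2 \<le> j" "j \<le> wgb_J \<epsilon>" and i: "i \<in> wgb_block \<epsilon> j"
  shows "(L - 1) / (L + 1) * real i \<le> real (wgb_l \<epsilon> (j - 1))"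
proof -
  obtain j' where j': "j = Suc j'" using j by (cases j) auto
  have "real i \<le> real (wgb_l \<epsilon> j)" using i by (simp add: wgb_block_def)
  also have "\<dots> \<le> wgb_x j" by (rule wgb_l_le[OF j(2)])
  also have "\<dots> = wgb_x j' * (1 + 1 / L)" by (simp add: j' wgb_x_Suc)
  finally have i_le: "real i \<le> wgb_x j' * (1 + 1 / L)" .
  have "(L - 1) / (L + 1) * real i \<le> (L - 1) / (L + 1) * (wgb_x j' * (1 + 1 / L))"
    using i_le L1 by (intro mult_left_mono) auto
  also have "\<dots> = wgb_x j' - wgb_x j' / L"
  proof -
    have "(L - 1) / (L + 1) * (w * (1 + 1 / L)) = w - w / L" for w
      using L1 by (simp add: divide_simps) (simp add: algebra_simps)
    then show ?thesis .
  qed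
  also have "\<dots> \<le> wgb_x j' - 1" using wgb_x_ge[of j'] L1 by (simp add: pos_le_divide_eq)
  also have "\<dots> \<le> real (nat \<lfloor>wgb_x j'\<rfloor>)" by linarith
  also have "\<dots> = real (wgb_l \<epsilon> (j - 1))" using j j' by (simp add: wgb_l_less)
  finally show ?thesis .
qed

lemma wgb_N_ge: "real (wgb_N \<epsilon>) \<ge> 1 / (2 * \<epsilon>\<^sup>2)"
proof -
  have "real (wgb_N \<epsilon>) \<ge> 1 / \<epsilon>\<^sup>2 - 1" unfolding wgb_N_def by linarith
  moreover have "1 / \<epsilon>\<^sup>2 \<ge> 2" using L_less L1 by simp
  moreover have "1 / (2 * \<epsilon>\<^sup>2) = (1 / \<epsilon>\<^sup>2) / 2" by simp
  ultimately show ?thesis by linarith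
qed

end

section \<open>Risk bound for the blockwise estimator\<close>

lemma sobolev_weight_bounds:
  assumes "\<beta> > 0" "i \<ge> 1"
  shows "(real i - 1) powr \<beta> \<le> sobolev_weight \<beta> i" "sobolev_weight \<beta> i \<le> real i powr \<beta>"
  using assms by (auto simp: sobolev_weight_def intro!: powr_mono2)

lemma block_of_subset: "block_of \<epsilon> i \<subseteq> {1..}" "finite (block_of \<epsilon> i)"
  by (auto simp: block_of_def wgb_block_def)

lemma bem_eq:
  fixes y :: "nat \<Rightarrow> real^'p"
  shows "bem \<epsilon> y i = (if i > wgb_N \<epsilon> then 0
     else if card (block_of \<epsilon> i) < CARD('p) + 2 then y i
     else y i - (\<epsilon>\<^sup>2 * (real (card (block_of \<epsilon> i)) - real CARD('p) - 1)) *\<^sub>R resolvent 0 (block_of \<epsilon> i) y (y i))"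
  unfolding bem_def Let_def resolvent_def gram_def
  by (simp add: matrix_vector_mult_diff_rdistrib scaleR_matrix_vector_assoc[symmetric])

lemma bem_estimator: "(bem \<epsilon> :: (nat \<Rightarrow> real^'p) \<Rightarrow> nat \<Rightarrow> real^'p) \<in> estimators"
  unfolding estimators_def
proof (safe)
  fix i :: nat assume i: "1 \<le> i"
  let ?M = "obs_space :: (nat \<Rightarrow> real^'p) measure"
  have comp: "(\<lambda>y. y k) \<in> borel_measurable ?M" if "k \<ge> 1" for k
    using that by (intro measurable_component_singleton) simp
  have nth: "(\<lambda>y. y k $ a) \<in> borel_measurable ?M" if "k \<ge> 1" for k a
    using measurable_compose[OF comp[OF that], of "\<lambda>x. x $ a" borel] by simp
  have [measurable]: "(\<lambda>y. y i) \<in> borel_measurable ?M" by (rule comp[OF i])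
  have [measurable]: "(\<lambda>y. resolvent 0 (block_of \<epsilon> i) y (y i)) \<in> borel_measurable ?M"
    unfolding resolvent_def
  proof (rule borel_measurable_matrix_inv_mult)
    fix a b
    show "(\<lambda>y. gram 0 (block_of \<epsilon> i) y $ a $ b) \<in> borel_measurable ?M"
      unfolding gram_def using block_of_subset(1)[of \<epsilon> i]
      by (auto intro!: borel_measurable_sum borel_measurable_times nth simp del: One_nat_def)
    show "(\<lambda>y. y i $ a) \<in> borel_measurable ?M" by (rule nth[OF i])
  qed
  show "(\<lambda>y. bem \<epsilon> y i) \<in> borel_measurable ?M"
    unfolding bem_eq by measurable
qed

context eigenframe
begin

text \<open>A sample point of \<open>obs_space\<close>, which is undefined at time 0, in contrast to \<open>obs\<close>.\<close>

definition data :: "real \<Rightarrow> (nat \<Rightarrow> real^'p) \<Rightarrow> (nat \<times> 'p \<Rightarrow> real) \<Rightarrow> nat \<Rightarrow> real^'p" where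
  "data \<epsilon> \<theta> z = (\<lambda>i\<in>{1..}. obs \<epsilon> \<theta> z i)"

lemma data_apply: "i \<ge> 1 \<Longrightarrow> data \<epsilon> \<theta> z i = obs \<epsilon> \<theta> z i"
  by (simp add: data_def)

lemma measurable_data [measurable]: "data \<epsilon> \<theta> \<in> PiM UNIV (\<lambda>_. borel) \<rightarrow>\<^sub>M obs_space"
  unfolding data_def[abs_def] by (rule measurable_restrict) simp

lemma obs_law_data: "obs_law \<epsilon> \<theta> = distr noise obs_space (data \<epsilon> \<theta>)"
  unfolding obs_law_eq data_def[abs_def] obs_def ..

definition coord_risk :: "real \<Rightarrow> (nat \<Rightarrow> real^'p) \<Rightarrow> ((nat \<Rightarrow> real^'p) \<Rightarrow> nat \<Rightarrow> real^'p) \<Rightarrow> nat \<Rightarrow> 'p \<Rightarrow> ennreal" where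
  "coord_risk \<epsilon> \<theta> \<delta> i k = (\<integral>\<^sup>+z. ennreal ((u k \<bullet> (\<delta> (data \<epsilon> \<theta> z) i - \<theta> i))\<^sup>2) \<partial>noise)"

lemma estimator_measurable:
  "\<delta> \<in> estimators \<Longrightarrow> i \<ge> 1 \<Longrightarrow> (\<lambda>y. \<delta> y i) \<in> borel_measurable obs_space"
  by (simp add: estimators_def)

lemma Q_form_ennreal: "ennreal (x \<bullet> (Q *v x)) = (\<Sum>k\<in>UNIV. ennreal (d k) * ennreal ((u k \<bullet> x)\<^sup>2))"
  unfolding Q_form using d_pos by (simp add: sum_ennreal[symmetric] ennreal_mult less_imp_le)

lemma risk_eq:
  assumes \<delta>: "\<delta> \<in> estimators"
  shows "risk Q \<epsilon> \<theta> \<delta> = (\<Sum>n. \<Sum>k\<in>UNIV. ennreal (d k) * coord_risk \<epsilon> \<theta> \<delta> (Suc n) k)"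
proof -
  have [measurable]: "(\<lambda>y. \<delta> y (Suc n)) \<in> borel_measurable obs_space" for n
    by (rule estimator_measurable[OF \<delta>]) simp
  have loss: "loss Q \<theta> t = (\<Sum>n. \<Sum>k\<in>UNIV. ennreal (d k) * ennreal ((u k \<bullet> (t (Suc n) - \<theta> (Suc n)))\<^sup>2))" for t
    unfolding loss_def Let_def Q_form_ennreal ..
  have m: "(\<lambda>z. \<delta> (data \<epsilon> \<theta> z) (Suc n)) \<in> borel_measurable noise" for n by measurable
  have "risk Q \<epsilon> \<theta> \<delta> = (\<integral>\<^sup>+z. loss Q \<theta> (\<delta> (data \<epsilon> \<theta> z)) \<partial>noise)"
    unfolding risk_def obs_law_data loss by (subst nn_integral_distr) measurable
  also have "\<dots> = (\<Sum>n. \<Sum>k\<in>UNIV. \<integral>\<^sup>+z. ennreal (d k) * ennreal ((u k \<bullet> (\<delta> (data \<epsilon> \<theta> z) (Suc n) - \<theta> (Suc n)))\<^sup>2) \<partial>noise)"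
    unfolding loss using m by (subst nn_integral_suminf) (auto simp: nn_integral_sum)
  finally show ?thesis
    unfolding coord_risk_def using m by (simp add: nn_integral_cmult)
qed

definition sobolev_term :: "real \<Rightarrow> (nat \<Rightarrow> real^'p) \<Rightarrow> nat \<Rightarrow> 'p \<Rightarrow> real" where
  "sobolev_term \<beta> \<theta> i k = (sobolev_weight \<beta> i)\<^sup>2 * (u k \<bullet> \<theta> i)\<^sup>2 / d k"

lemma sobolev_term_nonneg: "sobolev_term \<beta> \<theta> i k \<ge> 0"
  unfolding sobolev_term_def using d_pos[of k] by simp

lemma sobolev_ellipsoid_iff:
  "\<theta> \<in> sobolev_ellipsoid \<beta> Q \<longleftrightarrow> (\<Sum>n. ennreal (\<Sum>k\<in>UNIV. sobolev_term \<beta> \<theta> (Suc n) k)) \<le> 1"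
  unfolding sobolev_ellipsoid_def Let_def sobolev_term_def Q_inv_form
  by (simp add: sum_distrib_left)

lemma sobolev_ellipsoid_partial_sum:
  assumes "\<theta> \<in> sobolev_ellipsoid \<beta> Q"
  shows "(\<Sum>i=1..n. \<Sum>k\<in>UNIV. sobolev_term \<beta> \<theta> i k) \<le> 1"
proof -
  have "(\<Sum>n<n. ennreal (\<Sum>k\<in>UNIV. sobolev_term \<beta> \<theta> (Suc n) k)) \<le> 1"
    using assms sum_le_suminf[of "\<lambda>n. ennreal (\<Sum>k\<in>UNIV. sobolev_term \<beta> \<theta> (Suc n) k)" "{..<n}"]
    unfolding sobolev_ellipsoid_iff by (meson finite_lessThan order_trans summableI zero_le)
  then have "ennreal (\<Sum>n<n. \<Sum>k\<in>UNIV. sobolev_term \<beta> \<theta> (Suc n) k) \<le> ennreal 1"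
    by (subst (asm) sum_ennreal) (auto simp: sum_nonneg sobolev_term_nonneg)
  then have "(\<Sum>n<n. \<Sum>k\<in>UNIV. sobolev_term \<beta> \<theta> (Suc n) k) \<le> 1" by simp
  then show ?thesis by (simp only: One_nat_def sum.atLeast1_atMost_eq)
qed

lemma coord_risk_identity:
  assumes i: "i \<ge> 1" and eq: "\<And>y. \<delta> y i = y i"
  shows "coord_risk \<epsilon> \<theta> \<delta> i k = ennreal (\<epsilon>\<^sup>2)"
proof -
  have "coord_risk \<epsilon> \<theta> \<delta> i k = (\<integral>\<^sup>+z. ennreal (\<epsilon>\<^sup>2 * (z (i, k))\<^sup>2) \<partial>noise)"
    unfolding coord_risk_def eq data_apply[OF i] by (simp add: inner_diff_right inner_obs power_mult_distrib)
  also have "\<dots> = ennreal (\<integral>z. \<epsilon>\<^sup>2 * (z (i, k))\<^sup>2 \<partial>noise)"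
    by (rule nn_integral_eq_integral) (auto intro: noise_second_moment)
  finally show ?thesis by (simp add: noise_second_moment)
qed

lemma coord_risk_zero:
  assumes eq: "\<And>y. \<delta> y i = 0"
  shows "coord_risk \<epsilon> \<theta> \<delta> i k = ennreal ((u k \<bullet> \<theta> i)\<^sup>2)"
proof -
  interpret P: prob_space "noise :: (nat \<times> 'p \<Rightarrow> real) measure" by (rule prob_space_noise)
  show ?thesis unfolding coord_risk_def eq using P.emeasure_space_1 by simp
qed

text \<open>Blocks that are too short for shrinkage have at most \<open>p + 1\<close> elements, so their risk \<open>n \<epsilon>\<^sup>2\<close> is
absorbed by the same remainder as the cost of shrinkage in the long blocks.\<close>

lemma bem_block_risk:
  fixes \<epsilon> w :: real
  assumes \<epsilon>: "0 < \<epsilon>" and L1: "2 < ln (1 / \<epsilon>)" and j: "j \<in> {1..wgb_J \<epsilon>}"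
  defines "B \<equiv> wgb_block \<epsilon> j"
  shows "(\<Sum>i\<in>B. coord_risk \<epsilon> \<theta> (bem \<epsilon>) i k)
    \<le> ennreal (w\<^sup>2 * (card B * \<epsilon>\<^sup>2) + (1 - w)\<^sup>2 * (\<Sum>i\<in>B. (u k \<bullet> \<theta> i)\<^sup>2) + 2 * (real CARD('p) + 1) * \<epsilon>\<^sup>2)"
proof -
  let ?m = "\<Sum>i\<in>B. (u k \<bullet> \<theta> i)\<^sup>2"
  have m0: "?m \<ge> 0" by (simp add: sum_nonneg)
  have fin: "finite B" by (simp add: B_def wgb_block_def)
  have blk: "block_of \<epsilon> i = B" "1 \<le> i" "i \<le> wgb_N \<epsilon>" if "i \<in> B" for i
    using block_of_eq[OF \<epsilon> refl L1 j] wgb_block_le[OF \<epsilon> refl L1 j] that by (auto simp: B_def)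
  show ?thesis
  proof (cases "card B < CARD('p) + 2")
    case True
    have "(\<Sum>i\<in>B. coord_risk \<epsilon> \<theta> (bem \<epsilon>) i k) = (\<Sum>i\<in>B. ennreal (\<epsilon>\<^sup>2))"
    proof (rule sum.cong[OF refl])
      fix i assume i: "i \<in> B"
      show "coord_risk \<epsilon> \<theta> (bem \<epsilon>) i k = ennreal (\<epsilon>\<^sup>2)"
        by (rule coord_risk_identity) (use blk[OF i] True in \<open>auto simp: bem_eq\<close>)
    qed
    also have "\<dots> = ennreal (card B * \<epsilon>\<^sup>2)" by (simp add: ennreal_mult ennreal_of_nat_eq_real_of_nat)
    also have "\<dots> \<le> ennreal (w\<^sup>2 * (card B * \<epsilon>\<^sup>2) + (1 - w)\<^sup>2 * ?m + 2 * (real CARD('p) + 1) * \<epsilon>\<^sup>2)"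
    proof (rule ennreal_leI)
      have "card B * \<epsilon>\<^sup>2 \<le> 2 * (real CARD('p) + 1) * \<epsilon>\<^sup>2" using True by (intro mult_right_mono) auto
      moreover have "0 \<le> w\<^sup>2 * (card B * \<epsilon>\<^sup>2)" "0 \<le> (1 - w)\<^sup>2 * ?m" using m0 by auto
      ultimately show "card B * \<epsilon>\<^sup>2 \<le> w\<^sup>2 * (card B * \<epsilon>\<^sup>2) + (1 - w)\<^sup>2 * ?m + 2 * (real CARD('p) + 1) * \<epsilon>\<^sup>2"
        by linarith
    qed
    finally show ?thesis .
  next
    case False
    then have card: "card B \<ge> CARD('p) + 2" by simp
    have "resolvent 0 B (data \<epsilon> \<theta> z) = resolvent 0 B (obs \<epsilon> \<theta> z)" for z
    proof -
      have "gram 0 B (data \<epsilon> \<theta> z) = gram 0 B (obs \<epsilon> \<theta> z)"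
        unfolding gram_def by (intro arg_cong2[where f="(+)"] refl sum.cong) (simp_all add: data_apply blk del: One_nat_def)
      then show ?thesis by (auto simp: resolvent_def)
    qed
    then have eq: "bem \<epsilon> (data \<epsilon> \<theta> z) i = obs \<epsilon> \<theta> z i
        - (\<epsilon>\<^sup>2 * (real (card B) - real CARD('p) - 1)) *\<^sub>R resolvent 0 B (obs \<epsilon> \<theta> z) (obs \<epsilon> \<theta> z i)" if "i \<in> B" for z i
      using blk[OF that] False by (simp add: bem_eq data_apply)
    have [measurable]: "(\<lambda>z. resolvent 0 B (obs \<epsilon> \<theta> z) (obs \<epsilon> \<theta> z i)) \<in> borel_measurable (PiM UNIV (\<lambda>_. borel))" for i
      by (rule measurable_resolvent_obs) simp
    have "(\<Sum>i\<in>B. coord_risk \<epsilon> \<theta> (bem \<epsilon>) i k)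
      = (\<integral>\<^sup>+z. (\<Sum>i\<in>B. ennreal ((u k \<bullet> (obs \<epsilon> \<theta> z i - (\<epsilon>\<^sup>2 * (real (card B) - real CARD('p) - 1)) *\<^sub>R resolvent 0 B (obs \<epsilon> \<theta> z) (obs \<epsilon> \<theta> z i) - \<theta> i))\<^sup>2)) \<partial>noise)"
      unfolding coord_risk_def by (subst nn_integral_sum) (simp_all add: eq)
    also have "\<dots> \<le> ennreal (\<epsilon>\<^sup>2 * card B - \<epsilon>^4 * (real (card B) - real CARD('p) - 1)\<^sup>2 / (card B * \<epsilon>\<^sup>2 + ?m))"
      by (rule efron_morris_block_risk[OF fin \<epsilon> card])
    also have "\<dots> \<le> ennreal (w\<^sup>2 * (card B * \<epsilon>\<^sup>2) + (1 - w)\<^sup>2 * ?m + 2 * (real CARD('p) + 1) * \<epsilon>\<^sup>2)"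
      using efron_morris_block_oracle[of \<epsilon> "real (card B)" "real CARD('p) + 1" ?m w] \<epsilon> card m0
      by (intro ennreal_leI) (simp add: diff_diff_eq)
    finally show ?thesis .
  qed
qed

text \<open>On the block \<open>j\<close> compare with the weight \<open>w j k\<close> that Pinsker's solution assigns to the end of the
preceding block. As \<open>a\<^sub>i\<close> is at least the \<open>\<beta>\<close>-th power of that end, the bias is at most \<open>\<kappa>\<^sup>2\<close> times
the value of the ellipsoid's form, hence at most \<open>\<kappa>\<^sup>2\<close>. The variance is a sum of squared Pinsker
weights, up to the first block, where the weight is 1. The remaining terms are the tail beyond \<open>N\<close> and the cost per block.\<close>

lemma bem_risk_le:
  fixes \<epsilon> L \<kappa> \<beta> D :: real
  assumes \<theta>: "\<theta> \<in> sobolev_ellipsoid \<beta> Q"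
    and \<epsilon>: "0 < \<epsilon>" and L: "L = ln (1 / \<epsilon>)" and L1: "2 < L" and \<kappa>: "\<kappa> > 0" and \<beta>: "\<beta> > 0"
    and D: "\<And>k. d k \<le> D"
  shows "risk Q \<epsilon> \<theta> (bem \<epsilon>) \<le> ennreal (\<kappa>\<^sup>2 + D\<^sup>2 * (2 * \<epsilon>\<^sup>2) powr (2 * \<beta>)
    + \<epsilon>\<^sup>2 * (\<Sum>k\<in>UNIV. d k * (L + 1 + (d k / \<kappa>) powr (1 / \<beta>) * ((L + 1) / (L - 1)) * (2 * \<beta>\<^sup>2 / ((\<beta> + 1) * (2 * \<beta> + 1)))))
    + 2 * (real CARD('p) + 1) * \<epsilon>\<^sup>2 * (1 + 4 * L\<^sup>2) * (\<Sum>k\<in>UNIV. d k))"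
proof -
  let ?I2 = "2 * \<beta>\<^sup>2 / ((\<beta> + 1) * (2 * \<beta> + 1))"
  let ?N = "wgb_N \<epsilon>" and ?J = "wgb_J \<epsilon>" and ?B = "wgb_block \<epsilon>"
  let ?P = "real CARD('p) + 1"
  define x where "x = (\<lambda>i k. (u k \<bullet> \<theta> i)\<^sup>2)"
  define q where "q = sobolev_term \<beta> \<theta>"
  define \<tau> where "\<tau> = D\<^sup>2 * (2 * \<epsilon>\<^sup>2) powr (2 * \<beta>)"
  define cr where "cr = coord_risk \<epsilon> \<theta> (bem \<epsilon>)"
  define f where "f = (\<lambda>n. \<Sum>k\<in>UNIV. ennreal (d k) * cr (Suc n) k)"
  define h where "h = (\<lambda>k. (d k / \<kappa>) powr (1 / \<beta>))"
  define r where "r = (L - 1) / (L + 1)"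
  define w where "w = (\<lambda>j k. pinsker_weight \<beta> (real (wgb_l \<epsilon> (j - 1)) / h k))"
  have d0: "d k \<ge> 0" for k using d_pos[of k] by simp
  have h: "h k > 0" for k unfolding h_def using d_pos[of k] \<kappa> by simp
  have r: "r > 0" unfolding r_def using L1 by simp
  have q0: "q i k \<ge> 0" for i k unfolding q_def by (rule sobolev_term_nonneg)
  have x0: "x i k \<ge> 0" for i k by (simp add: x_def)
  have \<tau>0: "\<tau> \<ge> 0" by (simp add: \<tau>_def)
  have L1': "2 < ln (1 / \<epsilon>)" using L L1 by simp
  note blk = \<epsilon> L L1
  have N: "real ?N \<ge> 1 / (2 * \<epsilon>\<^sup>2)" by (rule wgb_N_ge[OF blk])
  (* Beyond N the estimate is 0 and the loss is the parameter itself. *)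
  have tail: "f n \<le> ennreal \<tau> * ennreal (\<Sum>k\<in>UNIV. q (Suc n) k)" if n: "n \<ge> ?N" for n
  proof -
    have cr: "cr (Suc n) k = ennreal (x (Suc n) k)" for k
      unfolding cr_def x_def by (rule coord_risk_zero) (use n in \<open>simp add: bem_eq\<close>)
    have le: "d k * x (Suc n) k \<le> \<tau> * q (Suc n) k" for k
    proof -
      have "1 / (2 * \<epsilon>\<^sup>2) \<le> real n" using N n by (meson of_nat_le_iff order_trans)
      then have "(1 / (2 * \<epsilon>\<^sup>2)) powr \<beta> \<le> real n powr \<beta>" using \<epsilon> \<beta> by (intro powr_mono2) auto
      also have "\<dots> \<le> sobolev_weight \<beta> (Suc n)" using sobolev_weight_bounds(1)[OF \<beta>, of "Suc n"] by simp
      finally have "((1 / (2 * \<epsilon>\<^sup>2)) powr \<beta>)\<^sup>2 \<le> (sobolev_weight \<beta> (Suc n))\<^sup>2" by (rule power_mono) simp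
      moreover have "((1 / (2 * \<epsilon>\<^sup>2)) powr \<beta>)\<^sup>2 * (2 * \<epsilon>\<^sup>2) powr (2 * \<beta>) = 1"
      proof -
        have "((1 / (2 * \<epsilon>\<^sup>2)) powr \<beta>)\<^sup>2 = (1 / (2 * \<epsilon>\<^sup>2)) powr (2 * \<beta>)"
          unfolding power2_eq_square powr_add[symmetric] by simp
        then show ?thesis using \<epsilon> by (simp add: powr_divide)
      qed
      ultimately have 1: "1 \<le> (sobolev_weight \<beta> (Suc n))\<^sup>2 * (2 * \<epsilon>\<^sup>2) powr (2 * \<beta>)"
        by (metis mult_right_mono powr_ge_zero)
      have 2: "(d k)\<^sup>2 \<le> D\<^sup>2" using D[of k] d0[of k] by (rule power_mono)
      have "d k * x (Suc n) k = (d k)\<^sup>2 * 1 * (x (Suc n) k / d k)" using d_pos[of k] by (simp add: power2_eq_square)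
      also have "\<dots> \<le> D\<^sup>2 * ((sobolev_weight \<beta> (Suc n))\<^sup>2 * (2 * \<epsilon>\<^sup>2) powr (2 * \<beta>)) * (x (Suc n) k / d k)"
        using 1 2 d0 x0 by (intro mult_right_mono mult_mono) auto
      also have "\<dots> = \<tau> * q (Suc n) k" by (simp add: \<tau>_def q_def sobolev_term_def x_def)
      finally show ?thesis .
    qed
    have "f n = ennreal (\<Sum>k\<in>UNIV. d k * x (Suc n) k)"
      unfolding f_def cr using d0 x0 by (simp add: sum_ennreal ennreal_mult[symmetric])
    also have "\<dots> \<le> ennreal (\<tau> * (\<Sum>k\<in>UNIV. q (Suc n) k))"
      unfolding sum_distrib_left by (intro ennreal_leI sum_mono le)
    finally show ?thesis using \<tau>0 q0 by (simp add: ennreal_mult sum_nonneg)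
  qed
  have block: "(\<Sum>i\<in>?B j. \<Sum>k\<in>UNIV. ennreal (d k) * cr i k)
     \<le> ennreal (\<Sum>k\<in>UNIV. d k * ((w j k)\<^sup>2 * (card (?B j) * \<epsilon>\<^sup>2) + (1 - w j k)\<^sup>2 * (\<Sum>i\<in>?B j. x i k) + 2 * ?P * \<epsilon>\<^sup>2))"
    if j: "j \<in> {1..?J}" for j
  proof -
    have "(\<Sum>i\<in>?B j. \<Sum>k\<in>UNIV. ennreal (d k) * cr i k) = (\<Sum>k\<in>UNIV. ennreal (d k) * (\<Sum>i\<in>?B j. cr i k))"
      by (subst sum.swap) (simp add: sum_distrib_left)
    also have "\<dots> \<le> (\<Sum>k\<in>UNIV. ennreal (d k) * ennreal ((w j k)\<^sup>2 * (card (?B j) * \<epsilon>\<^sup>2) + (1 - w j k)\<^sup>2 * (\<Sum>i\<in>?B j. x i k) + 2 * ?P * \<epsilon>\<^sup>2))"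
      unfolding cr_def x_def by (intro sum_mono mult_left_mono bem_block_risk[OF \<epsilon> L1' j]) simp
    also have "\<dots> = ennreal (\<Sum>k\<in>UNIV. d k * ((w j k)\<^sup>2 * (card (?B j) * \<epsilon>\<^sup>2) + (1 - w j k)\<^sup>2 * (\<Sum>i\<in>?B j. x i k) + 2 * ?P * \<epsilon>\<^sup>2))"
      using d0 x0 by (subst sum_ennreal[symmetric]) (auto simp: ennreal_mult sum_nonneg)
    finally show ?thesis .
  qed
  (* 1 - w is at most \<kappa> times (previous block end)^\<beta> / d, and sobolev_weight is at least (i - 1)^\<beta>. *)
  have bias: "d k * (1 - w j k)\<^sup>2 * x i k \<le> \<kappa>\<^sup>2 * q i k" if j: "j \<in> {1..?J}" and i: "i \<in> ?B j" for i j k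
  proof -
    let ?l = "real (wgb_l \<epsilon> (j - 1))"
    have "?l powr \<beta> \<le> (real i - 1) powr \<beta>" using i \<beta> by (intro powr_mono2) (auto simp: wgb_block_def)
    also have "\<dots> \<le> sobolev_weight \<beta> i" using i by (intro sobolev_weight_bounds[OF \<beta>]) (auto simp: wgb_block_def)
    finally have a: "?l powr \<beta> \<le> sobolev_weight \<beta> i" .
    have hb: "h k powr \<beta> = d k / \<kappa>" unfolding h_def using \<beta> d_pos[of k] \<kappa> by (simp add: powr_powr)
    have "1 - w j k \<le> (?l / h k) powr \<beta>" unfolding w_def pinsker_weight_def by simp
    also have "\<dots> = ?l powr \<beta> * \<kappa> / d k" using h[of k] by (simp add: powr_divide hb)
    also have "\<dots> \<le> sobolev_weight \<beta> i * \<kappa> / d k" using a \<kappa> d0[of k] by (intro divide_right_mono mult_right_mono) auto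
    finally have "1 - w j k \<le> sobolev_weight \<beta> i * \<kappa> / d k" .
    moreover have "0 \<le> 1 - w j k" unfolding w_def using pinsker_weight_bounds(2) by simp
    ultimately have "(1 - w j k)\<^sup>2 \<le> (sobolev_weight \<beta> i * \<kappa> / d k)\<^sup>2" by (rule power_mono)
    then have "d k * (1 - w j k)\<^sup>2 * x i k \<le> d k * (sobolev_weight \<beta> i * \<kappa> / d k)\<^sup>2 * x i k"
      using d0 x0 by (intro mult_right_mono mult_left_mono) auto
    also have "\<dots> = \<kappa>\<^sup>2 * q i k" using d_pos[of k]
      by (simp add: q_def sobolev_term_def x_def power_mult_distrib power_divide power2_eq_square)
    finally show ?thesis .
  qed
  have var: "(w j k)\<^sup>2 \<le> (if j = 1 then 1 else 0) + (pinsker_weight \<beta> (real i / (h k / r)))\<^sup>2"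
    if j: "j \<in> {1..?J}" and i: "i \<in> ?B j" for i j k
  proof (cases "j = 1")
    case True
    have "(w j k)\<^sup>2 \<le> 1" unfolding w_def using pinsker_weight_bounds by (simp add: power_le_one)
    then show ?thesis using True by (simp add: add_increasing2)
  next
    case False
    have "r * real i \<le> real (wgb_l \<epsilon> (j - 1))"
      unfolding r_def by (rule wgb_block_ratio[OF blk]) (use j i False in auto)
    then have "r * real i / h k \<le> real (wgb_l \<epsilon> (j - 1)) / h k" using h[of k] by (intro divide_right_mono) auto
    then have "w j k \<le> pinsker_weight \<beta> (r * real i / h k)"
      unfolding w_def using r h[of k] by (intro pinsker_weight_antimono[OF \<beta>]) auto
    then have "(w j k)\<^sup>2 \<le> (pinsker_weight \<beta> (r * real i / h k))\<^sup>2"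
      by (rule power_mono) (simp add: w_def pinsker_weight_bounds)
    then show ?thesis using False by (simp add: mult.commute)
  qed
  have card1: "real (card (?B 1)) \<le> L + 1"
  proof (cases "?B 1 = {}")
    case False
    then have "wgb_l \<epsilon> 1 \<in> ?B 1" by (simp add: wgb_block_def wgb_l_0[OF blk])
    from wgb_block_1[OF blk this] show ?thesis by (simp add: wgb_block_def wgb_l_0[OF blk])
  qed (use L1 in simp)
  have J: "1 \<le> ?J" using wgb_J_props(3)[OF blk] by simp
  have varsum: "(\<Sum>j=1..?J. card (?B j) * (w j k)\<^sup>2) \<le> L + 1 + h k / r * ?I2" for k
  proof -
    have "(\<Sum>j=1..?J. card (?B j) * (w j k)\<^sup>2) = (\<Sum>j=1..?J. \<Sum>i\<in>?B j. (w j k)\<^sup>2)" by simp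
    also have "\<dots> \<le> (\<Sum>j=1..?J. \<Sum>i\<in>?B j. (if j = 1 then 1 else 0) + (pinsker_weight \<beta> (real i / (h k / r)))\<^sup>2)"
      by (intro sum_mono var)
    also have "\<dots> = (\<Sum>j=1..?J. if j = 1 then real (card (?B j)) else 0)
        + (\<Sum>j=1..?J. \<Sum>i\<in>?B j. (pinsker_weight \<beta> (real i / (h k / r)))\<^sup>2)"
      unfolding sum.distrib by (intro arg_cong2[where f="(+)"] sum.cong) auto
    also have "(\<Sum>j=1..?J. if j = 1 then real (card (?B j)) else 0) = card (?B 1)"
      using J by (simp add: sum.delta')
    also have "(\<Sum>j=1..?J. \<Sum>i\<in>?B j. (pinsker_weight \<beta> (real i / (h k / r)))\<^sup>2) = (\<Sum>i=1..?N. (pinsker_weight \<beta> (real i / (h k / r)))\<^sup>2)"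
      by (rule sum_wgb_blocks[OF blk, symmetric])
    also have "\<dots> \<le> h k / r * ?I2" by (rule pinsker_weight_sum2(1)[OF \<beta>]) (use h[of k] r in simp)
    finally show ?thesis using card1 by linarith
  qed
  have qsum: "(\<Sum>j=1..?J. \<Sum>i\<in>?B j. \<Sum>k\<in>UNIV. q i k) \<le> 1"
    unfolding q_def sum_wgb_blocks[OF blk, symmetric] by (rule sobolev_ellipsoid_partial_sum[OF \<theta>])
  define V where "V = \<epsilon>\<^sup>2 * (\<Sum>k\<in>UNIV. d k * (L + 1 + h k / r * ?I2)) + 2 * ?P * \<epsilon>\<^sup>2 * (1 + 4 * L\<^sup>2) * (\<Sum>k\<in>UNIV. d k)"
  have main: "(\<Sum>n<?N. f n) \<le> ennreal (\<kappa>\<^sup>2 + V)"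
  proof -
    have "(\<Sum>n<?N. f n) = (\<Sum>i=1..?N. \<Sum>k\<in>UNIV. ennreal (d k) * cr i k)"
      unfolding f_def by (simp only: One_nat_def sum.atLeast1_atMost_eq)
    also have "\<dots> = (\<Sum>j=1..?J. \<Sum>i\<in>?B j. \<Sum>k\<in>UNIV. ennreal (d k) * cr i k)"
      by (rule sum_wgb_blocks[OF blk])
    also have "\<dots> \<le> (\<Sum>j=1..?J. ennreal (\<Sum>k\<in>UNIV. d k * ((w j k)\<^sup>2 * (card (?B j) * \<epsilon>\<^sup>2) + (1 - w j k)\<^sup>2 * (\<Sum>i\<in>?B j. x i k) + 2 * ?P * \<epsilon>\<^sup>2)))"
      by (rule sum_mono) (rule block)
    also have "\<dots> = ennreal (\<Sum>j=1..?J. \<Sum>k\<in>UNIV. d k * ((w j k)\<^sup>2 * (card (?B j) * \<epsilon>\<^sup>2) + (1 - w j k)\<^sup>2 * (\<Sum>i\<in>?B j. x i k) + 2 * ?P * \<epsilon>\<^sup>2))"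
      using d0 x0 by (intro sum_ennreal sum_nonneg mult_nonneg_nonneg add_nonneg_nonneg) auto
    also have "\<dots> \<le> ennreal (\<kappa>\<^sup>2 + V)"
    proof (rule ennreal_leI)
      have "(\<Sum>j=1..?J. \<Sum>k\<in>UNIV. d k * ((w j k)\<^sup>2 * (card (?B j) * \<epsilon>\<^sup>2) + (1 - w j k)\<^sup>2 * (\<Sum>i\<in>?B j. x i k) + 2 * ?P * \<epsilon>\<^sup>2))
        = (\<Sum>j=1..?J. \<Sum>k\<in>UNIV. d k * (w j k)\<^sup>2 * (card (?B j) * \<epsilon>\<^sup>2))
        + (\<Sum>j=1..?J. \<Sum>k\<in>UNIV. d k * (1 - w j k)\<^sup>2 * (\<Sum>i\<in>?B j. x i k))
        + (\<Sum>j=1..?J. \<Sum>k\<in>UNIV. d k * (2 * ?P * \<epsilon>\<^sup>2))"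
        by (simp add: distrib_left sum.distrib mult.assoc)
      also have "\<dots> \<le> \<epsilon>\<^sup>2 * (\<Sum>k\<in>UNIV. d k * (L + 1 + h k / r * ?I2)) + \<kappa>\<^sup>2
          + 2 * ?P * \<epsilon>\<^sup>2 * (1 + 4 * L\<^sup>2) * (\<Sum>k\<in>UNIV. d k)"
      proof (intro add_mono)
        have "(\<Sum>j=1..?J. \<Sum>k\<in>UNIV. d k * (w j k)\<^sup>2 * (card (?B j) * \<epsilon>\<^sup>2)) = \<epsilon>\<^sup>2 * (\<Sum>k\<in>UNIV. d k * (\<Sum>j=1..?J. card (?B j) * (w j k)\<^sup>2))"
          by (subst sum.swap) (simp add: sum_distrib_left mult_ac)
        also have "\<dots> \<le> \<epsilon>\<^sup>2 * (\<Sum>k\<in>UNIV. d k * (L + 1 + h k / r * ?I2))"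
          by (intro mult_left_mono sum_mono varsum d0) simp
        finally show "(\<Sum>j=1..?J. \<Sum>k\<in>UNIV. d k * (w j k)\<^sup>2 * (card (?B j) * \<epsilon>\<^sup>2)) \<le> \<dots>" .
        have "(\<Sum>j=1..?J. \<Sum>k\<in>UNIV. d k * (1 - w j k)\<^sup>2 * (\<Sum>i\<in>?B j. x i k)) = (\<Sum>j=1..?J. \<Sum>i\<in>?B j. \<Sum>k\<in>UNIV. d k * (1 - w j k)\<^sup>2 * x i k)"
          by (intro sum.cong refl, subst sum.swap) (simp add: sum_distrib_left)
        also have "\<dots> \<le> (\<Sum>j=1..?J. \<Sum>i\<in>?B j. \<Sum>k\<in>UNIV. \<kappa>\<^sup>2 * q i k)"
          by (intro sum_mono bias)
        also have "\<dots> = \<kappa>\<^sup>2 * (\<Sum>j=1..?J. \<Sum>i\<in>?B j. \<Sum>k\<in>UNIV. q i k)" by (simp add: sum_distrib_left)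
        also have "\<dots> \<le> \<kappa>\<^sup>2 * 1" using qsum by (intro mult_left_mono) auto
        finally show "(\<Sum>j=1..?J. \<Sum>k\<in>UNIV. d k * (1 - w j k)\<^sup>2 * (\<Sum>i\<in>?B j. x i k)) \<le> \<kappa>\<^sup>2" by simp
        have "(\<Sum>j=1..?J. \<Sum>k\<in>UNIV. d k * (2 * ?P * \<epsilon>\<^sup>2)) = 2 * ?P * \<epsilon>\<^sup>2 * real ?J * (\<Sum>k\<in>UNIV. d k)"
          by (simp add: sum_distrib_right[symmetric])
        also have "\<dots> \<le> 2 * ?P * \<epsilon>\<^sup>2 * (1 + 4 * L\<^sup>2) * (\<Sum>k\<in>UNIV. d k)"
          using wgb_J_le[OF blk] d0 by (intro mult_right_mono mult_left_mono) (auto simp: sum_nonneg)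
        finally show "(\<Sum>j=1..?J. \<Sum>k\<in>UNIV. d k * (2 * ?P * \<epsilon>\<^sup>2)) \<le> \<dots>" .
      qed
      finally show "(\<Sum>j=1..?J. \<Sum>k\<in>UNIV. d k * ((w j k)\<^sup>2 * (card (?B j) * \<epsilon>\<^sup>2) + (1 - w j k)\<^sup>2 * (\<Sum>i\<in>?B j. x i k) + 2 * ?P * \<epsilon>\<^sup>2)) \<le> \<kappa>\<^sup>2 + V"
        by (simp add: V_def)
    qed
    finally show ?thesis .
  qed
  have "V \<ge> 0"
  proof -
    have "0 \<le> h k / r" "0 \<le> ?I2" for k using h[of k] r \<beta> by simp_all
    then show ?thesis unfolding V_def using d0 L1 by (intro add_nonneg_nonneg mult_nonneg_nonneg sum_nonneg) auto
  qed
  have "risk Q \<epsilon> \<theta> (bem \<epsilon>) = (\<Sum>n. f n)"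
    unfolding risk_eq[OF bem_estimator] f_def cr_def ..
  also have "\<dots> \<le> (\<Sum>n. (if n < ?N then f n else 0) + ennreal \<tau> * ennreal (\<Sum>k\<in>UNIV. q (Suc n) k))"
    by (intro suminf_le summableI) (use tail in auto)
  also have "\<dots> = (\<Sum>n. if n < ?N then f n else 0) + (\<Sum>n. ennreal \<tau> * ennreal (\<Sum>k\<in>UNIV. q (Suc n) k))"
    by (intro suminf_add[symmetric] summableI)
  also have "(\<Sum>n. if n < ?N then f n else 0) = (\<Sum>n<?N. f n)"
    by (subst suminf_finite[of "{..<?N}"]) auto
  also have "(\<Sum>n. ennreal \<tau> * ennreal (\<Sum>k\<in>UNIV. q (Suc n) k)) = ennreal \<tau> * (\<Sum>n. ennreal (\<Sum>k\<in>UNIV. q (Suc n) k))"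
    by (rule ennreal_suminf_cmult)
  also have "\<dots> \<le> ennreal \<tau> * 1"
    using \<theta> unfolding q_def sobolev_ellipsoid_iff by (intro mult_left_mono) auto
  also note main
  finally have "risk Q \<epsilon> \<theta> (bem \<epsilon>) \<le> ennreal (\<kappa>\<^sup>2 + V) + ennreal \<tau>" by (simp add: add_right_mono add_left_mono)
  also have "\<dots> = ennreal (\<kappa>\<^sup>2 + V + \<tau>)" using \<tau>0 \<open>V \<ge> 0\<close> by simp
  also have "\<kappa>\<^sup>2 + V + \<tau> = \<kappa>\<^sup>2 + D\<^sup>2 * (2 * \<epsilon>\<^sup>2) powr (2 * \<beta>)
    + \<epsilon>\<^sup>2 * (\<Sum>k\<in>UNIV. d k * (L + 1 + (d k / \<kappa>) powr (1 / \<beta>) * ((L + 1) / (L - 1)) * ?I2))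
    + 2 * ?P * \<epsilon>\<^sup>2 * (1 + 4 * L\<^sup>2) * (\<Sum>k\<in>UNIV. d k)"
    by (simp add: V_def \<tau>_def h_def r_def)
  finally show ?thesis .
qed

end

section \<open>Gaussian priors in one coordinate\<close>

lemma normal_density_scale:
  "\<sigma> > 0 \<Longrightarrow> normal_density m \<sigma> (m + \<sigma> * t) = std_normal_density t / \<sigma>"
  by (simp add: normal_density_def real_sqrt_mult power_mult_distrib)

text \<open>The joint density of a normal prior and a normal observation, factored into the marginal density of the
observation and the posterior density.\<close>

lemma normal_density_posterior:
  fixes s \<epsilon> :: real
  assumes s: "s > 0" and \<epsilon>: "\<epsilon> > 0"
  defines "\<sigma> \<equiv> sqrt (s\<^sup>2 + \<epsilon>\<^sup>2)"
  shows "std_normal_density r * normal_density (s * r) \<epsilon> w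
    = normal_density 0 \<sigma> w * normal_density (s * w / \<sigma>\<^sup>2) (\<epsilon> / \<sigma>) r"
proof -
  have S: "s\<^sup>2 + \<epsilon>\<^sup>2 > 0" using s by (simp add: add_pos_nonneg)
  have \<sigma>2: "\<sigma>\<^sup>2 = s\<^sup>2 + \<epsilon>\<^sup>2" unfolding \<sigma>_def using S by simp
  have \<sigma>: "\<sigma> > 0" unfolding \<sigma>_def using S by simp
  have e: "- r\<^sup>2 / 2 + - (w - s * r)\<^sup>2 / (2 * \<epsilon>\<^sup>2) = - (w - 0)\<^sup>2 / (2 * \<sigma>\<^sup>2) + - (r - s * w / \<sigma>\<^sup>2)\<^sup>2 / (2 * (\<epsilon> / \<sigma>)\<^sup>2)"
  proof -
    have "(r - s * w / \<sigma>\<^sup>2)\<^sup>2 / (2 * (\<epsilon> / \<sigma>)\<^sup>2) = (\<sigma>\<^sup>2 * r - s * w)\<^sup>2 / (2 * \<epsilon>\<^sup>2 * \<sigma>\<^sup>2)"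
      using \<sigma> \<epsilon> by (simp add: field_simps power2_eq_square)
    moreover have "- r\<^sup>2 / 2 + - (w - s * r)\<^sup>2 / (2 * \<epsilon>\<^sup>2) = - w\<^sup>2 / (2 * \<sigma>\<^sup>2) - (\<sigma>\<^sup>2 * r - s * w)\<^sup>2 / (2 * \<epsilon>\<^sup>2 * \<sigma>\<^sup>2)"
    proof -
      have "- r\<^sup>2 / 2 + - (w - s * r)\<^sup>2 / (2 * \<epsilon>\<^sup>2) - (- w\<^sup>2 / (2 * T) - (T * r - s * w)\<^sup>2 / (2 * \<epsilon>\<^sup>2 * T)) = 0"
        if "T = s\<^sup>2 + \<epsilon>\<^sup>2" "T \<noteq> 0" for T
      proof -
        have "- r\<^sup>2 * (\<epsilon>\<^sup>2 * T) - (w - s * r)\<^sup>2 * T + w\<^sup>2 * \<epsilon>\<^sup>2 + (T * r - s * w)\<^sup>2 = 0"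
          unfolding that(1) by (simp add: power2_eq_square algebra_simps)
        moreover have "- r\<^sup>2 / 2 + - (w - s * r)\<^sup>2 / (2 * \<epsilon>\<^sup>2) - (- w\<^sup>2 / (2 * T) - (T * r - s * w)\<^sup>2 / (2 * \<epsilon>\<^sup>2 * T))
          = (- r\<^sup>2 * (\<epsilon>\<^sup>2 * T) - (w - s * r)\<^sup>2 * T + w\<^sup>2 * \<epsilon>\<^sup>2 + (T * r - s * w)\<^sup>2) / (2 * \<epsilon>\<^sup>2 * T)"
          using that(2) \<epsilon> by (simp add: add_divide_distrib diff_divide_distrib)
        ultimately show ?thesis by simp
      qed
      from this[OF \<sigma>2] \<sigma> show ?thesis by simp
    qed
    ultimately show ?thesis by simp
  qed
  have c: "1 / sqrt (2 * pi) * (1 / sqrt (2 * pi * \<epsilon>\<^sup>2)) = 1 / sqrt (2 * pi * \<sigma>\<^sup>2) * (1 / sqrt (2 * pi * (\<epsilon> / \<sigma>)\<^sup>2))"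
    using \<sigma> \<epsilon> by (simp add: real_sqrt_mult power_divide real_sqrt_divide)
  have "std_normal_density r * normal_density (s * r) \<epsilon> w
    = (1 / sqrt (2 * pi) * (1 / sqrt (2 * pi * \<epsilon>\<^sup>2))) * exp (- r\<^sup>2 / 2 + - (w - s * r)\<^sup>2 / (2 * \<epsilon>\<^sup>2))"
    unfolding exp_add by (simp add: normal_density_def)
  also have "\<dots> = normal_density 0 \<sigma> w * normal_density (s * w / \<sigma>\<^sup>2) (\<epsilon> / \<sigma>) r"
    unfolding e c exp_add by (simp add: normal_density_def)
  finally show ?thesis .
qed

text \<open>The variance of \<open>s r\<close> is a lower bound for its mean square distance from any constant.\<close>

lemma normal_mean_square_ge:
  fixes a s m \<tau> :: real
  assumes \<tau>: "\<tau> > 0"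
  shows "ennreal (s\<^sup>2 * \<tau>\<^sup>2) \<le> (\<integral>\<^sup>+r. ennreal (normal_density m \<tau> r) * ennreal ((a - s * r)\<^sup>2) \<partial>lborel)"
proof -
  let ?n = "normal_density m \<tau>"
  define b where "b = a - s * m"
  have m2: "has_bochner_integral lborel (\<lambda>r. ?n r * (r - m)\<^sup>2) (\<tau>\<^sup>2)"
    using normal_moment_even[OF \<tau>, of m 1] by (simp add: fact_2)
  have m1: "has_bochner_integral lborel (\<lambda>r. ?n r * (r - m)) 0"
    using normal_moment_odd[OF \<tau>, of m 0] by simp
  have m0: "has_bochner_integral lborel (\<lambda>r. ?n r) 1"
    using normal_moment_even[OF \<tau>, of m 0] by simp
  have "has_bochner_integral lborel (\<lambda>r. b\<^sup>2 * ?n r + (- 2 * b * s) * (?n r * (r - m)) + s\<^sup>2 * (?n r * (r - m)\<^sup>2))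
     (b\<^sup>2 * 1 + (- 2 * b * s) * 0 + s\<^sup>2 * \<tau>\<^sup>2)"
    by (intro has_bochner_integral_add has_bochner_integral_mult_right m0 m1 m2)
  moreover have "b\<^sup>2 * ?n r + (- 2 * b * s) * (?n r * (r - m)) + s\<^sup>2 * (?n r * (r - m)\<^sup>2) = ?n r * (a - s * r)\<^sup>2" for r
    by (simp add: b_def power2_eq_square algebra_simps)
  ultimately have B: "has_bochner_integral lborel (\<lambda>r. ?n r * (a - s * r)\<^sup>2) (b\<^sup>2 + s\<^sup>2 * \<tau>\<^sup>2)" by simp
  have "ennreal (s\<^sup>2 * \<tau>\<^sup>2) \<le> ennreal (b\<^sup>2 + s\<^sup>2 * \<tau>\<^sup>2)" by (intro ennreal_leI) simp
  also have "\<dots> = (\<integral>\<^sup>+r. ennreal (?n r * (a - s * r)\<^sup>2) \<partial>lborel)"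
    using B by (subst nn_integral_eq_integral) (auto simp: has_bochner_integral_iff)
  finally show ?thesis by (simp add: ennreal_mult)
qed

text \<open>Given the observation \<open>w\<close>, the posterior variance of \<open>s r\<close> is
\<open>s\<^sup>2 \<epsilon>\<^sup>2 / (s\<^sup>2 + \<epsilon>\<^sup>2)\<close> whatever \<open>w\<close> is.\<close>

lemma gaussian_bayes_risk:
  fixes s \<epsilon> :: real
  assumes g [measurable]: "g \<in> borel_measurable borel" and s: "s > 0" and \<epsilon>: "\<epsilon> > 0"
  shows "ennreal (s\<^sup>2 * \<epsilon>\<^sup>2 / (s\<^sup>2 + \<epsilon>\<^sup>2)) \<le> (\<integral>\<^sup>+r. \<integral>\<^sup>+t. ennreal ((g (s * r + \<epsilon> * t) - s * r)\<^sup>2) \<partial>gauss1 \<partial>gauss1)"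
proof -
  define \<sigma> where "\<sigma> = sqrt (s\<^sup>2 + \<epsilon>\<^sup>2)"
  have S: "s\<^sup>2 + \<epsilon>\<^sup>2 > 0" using s by (simp add: add_pos_nonneg)
  have \<sigma>2: "\<sigma>\<^sup>2 = s\<^sup>2 + \<epsilon>\<^sup>2" unfolding \<sigma>_def using S by simp
  have \<sigma>: "\<sigma> > 0" unfolding \<sigma>_def using S by simp
  let ?v = "s\<^sup>2 * (\<epsilon> / \<sigma>)\<^sup>2"
  let ?F = "\<lambda>w r. ennreal ((g w - s * r)\<^sup>2)"
  have inner: "(\<integral>\<^sup>+t. ?F (s * r + \<epsilon> * t) r \<partial>gauss1) = (\<integral>\<^sup>+w. ennreal (normal_density (s * r) \<epsilon> w) * ?F w r \<partial>lborel)" for r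
  proof -
    have "(\<integral>\<^sup>+w. ennreal (normal_density (s * r) \<epsilon> w) * ?F w r \<partial>lborel)
       = ennreal \<bar>\<epsilon>\<bar> * (\<integral>\<^sup>+t. ennreal (normal_density (s * r) \<epsilon> (s * r + \<epsilon> * t)) * ?F (s * r + \<epsilon> * t) r \<partial>lborel)"
      by (rule nn_integral_real_affine) (use \<epsilon> in auto)
    also have "\<dots> = (\<integral>\<^sup>+t. ennreal (std_normal_density t) * ?F (s * r + \<epsilon> * t) r \<partial>lborel)"
      using \<epsilon> by (subst nn_integral_cmult[symmetric])
        (auto simp: normal_density_scale mult.assoc[symmetric] ennreal_mult[symmetric])
    also have "\<dots> = (\<integral>\<^sup>+t. ?F (s * r + \<epsilon> * t) r \<partial>gauss1)"
      by (subst nn_integral_density) auto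
    finally show ?thesis ..
  qed
  have "(\<integral>\<^sup>+r. \<integral>\<^sup>+t. ?F (s * r + \<epsilon> * t) r \<partial>gauss1 \<partial>gauss1)
      = (\<integral>\<^sup>+r. \<integral>\<^sup>+w. ennreal (normal_density (s * r) \<epsilon> w) * ?F w r \<partial>lborel \<partial>gauss1)"
    by (simp only: inner)
  also have "\<dots> = (\<integral>\<^sup>+r. ennreal (std_normal_density r) * (\<integral>\<^sup>+w. ennreal (normal_density (s * r) \<epsilon> w) * ?F w r \<partial>lborel) \<partial>lborel)"
    unfolding normal_density_def by (subst nn_integral_density) auto
  also have "\<dots> = (\<integral>\<^sup>+r. \<integral>\<^sup>+w. ennreal (std_normal_density r * normal_density (s * r) \<epsilon> w) * ?F w r \<partial>lborel \<partial>lborel)"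
    by (intro nn_integral_cong, subst nn_integral_cmult[symmetric])
      (auto simp: ennreal_mult mult.assoc)
  also have "\<dots> = (\<integral>\<^sup>+r. \<integral>\<^sup>+w. ennreal (normal_density 0 \<sigma> w) * (ennreal (normal_density (s * w / \<sigma>\<^sup>2) (\<epsilon> / \<sigma>) r) * ?F w r) \<partial>lborel \<partial>lborel)"
    unfolding normal_density_posterior[OF s \<epsilon>, folded \<sigma>_def] by (simp add: ennreal_mult mult.assoc)
  also have "\<dots> = (\<integral>\<^sup>+w. \<integral>\<^sup>+r. ennreal (normal_density 0 \<sigma> w) * (ennreal (normal_density (s * w / \<sigma>\<^sup>2) (\<epsilon> / \<sigma>) r) * ?F w r) \<partial>lborel \<partial>lborel)"
    unfolding normal_density_def by (rule lborel_pair.Fubini'[symmetric]) simp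
  also have "\<dots> \<ge> (\<integral>\<^sup>+w. ennreal (normal_density 0 \<sigma> w) * ennreal ?v \<partial>lborel)"
  proof (rule nn_integral_mono)
    fix w :: real
    have "ennreal (normal_density 0 \<sigma> w) * ennreal ?v
       \<le> ennreal (normal_density 0 \<sigma> w) * (\<integral>\<^sup>+r. ennreal (normal_density (s * w / \<sigma>\<^sup>2) (\<epsilon> / \<sigma>) r) * ?F w r \<partial>lborel)"
      using \<sigma> \<epsilon> by (intro mult_left_mono normal_mean_square_ge) auto
    also have "\<dots> = (\<integral>\<^sup>+r. ennreal (normal_density 0 \<sigma> w) * (ennreal (normal_density (s * w / \<sigma>\<^sup>2) (\<epsilon> / \<sigma>) r) * ?F w r) \<partial>lborel)"
      by (subst nn_integral_cmult) auto
    finally show "ennreal (normal_density 0 \<sigma> w) * ennreal ?v \<le> \<dots>" .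
  qed
  also have "(\<integral>\<^sup>+w. ennreal (normal_density 0 \<sigma> w) * ennreal ?v \<partial>lborel) = ennreal ?v"
  proof -
    have "(\<integral>\<^sup>+w. ennreal (normal_density 0 \<sigma> w) \<partial>lborel) = 1"
      using \<sigma> by (subst nn_integral_eq_integral) auto
    then show ?thesis by (subst nn_integral_multc) auto
  qed
  finally have "ennreal ?v \<le> (\<integral>\<^sup>+r. \<integral>\<^sup>+t. ?F (s * r + \<epsilon> * t) r \<partial>gauss1 \<partial>gauss1)" .
  moreover have "?v = s\<^sup>2 * \<epsilon>\<^sup>2 / (s\<^sup>2 + \<epsilon>\<^sup>2)" by (simp add: power_divide \<sigma>2)
  ultimately show ?thesis by simp
qed

text \<open>The integral equals \<open>1 / sqrt (1 - 2 x)\<close>. The exponential form multiplies well over coordinates.\<close>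

lemma gaussian_square_mgf:
  fixes x :: real
  assumes x: "0 \<le> x" "x \<le> 1 / 4"
  shows "(\<integral>\<^sup>+t. ennreal (exp (x * t\<^sup>2)) \<partial>gauss1) \<le> ennreal (exp (x + 4 * x\<^sup>2))"
proof -
  define \<sigma> where "\<sigma> = 1 / sqrt (1 - 2 * x)"
  have p: "1 - 2 * x > 0" using x by simp
  have \<sigma>: "\<sigma> > 0" and \<sigma>2: "\<sigma>\<^sup>2 = 1 / (1 - 2 * x)" using p by (auto simp: \<sigma>_def power_divide)
  have eq: "std_normal_density t * exp (x * t\<^sup>2) = \<sigma> * normal_density 0 \<sigma> t" for t
  proof -
    have "- t\<^sup>2 / 2 + x * t\<^sup>2 = - (t - 0)\<^sup>2 / (2 * \<sigma>\<^sup>2)" unfolding \<sigma>2 using p by (simp add: field_simps)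
    moreover have "1 / sqrt (2 * pi) = \<sigma> * (1 / sqrt (2 * pi * \<sigma>\<^sup>2))" using \<sigma> by (simp add: real_sqrt_mult)
    ultimately show ?thesis
      unfolding normal_density_def by (simp add: exp_add[symmetric])
  qed
  have "(\<integral>\<^sup>+t. ennreal (exp (x * t\<^sup>2)) \<partial>gauss1) = (\<integral>\<^sup>+t. ennreal \<sigma> * ennreal (normal_density 0 \<sigma> t) \<partial>lborel)"
    using \<sigma> by (subst nn_integral_density) (auto simp: ennreal_mult[symmetric] eq)
  also have "\<dots> = ennreal \<sigma>"
    using \<sigma> by (subst nn_integral_cmult) (auto simp: nn_integral_eq_integral)
  also have "\<dots> \<le> ennreal (exp (x + 4 * x\<^sup>2))"
  proof (rule ennreal_leI)
    have "- (2 * x) - 2 * (2 * x)\<^sup>2 \<le> ln (1 - 2 * x)"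
      using x by (intro ln_one_minus_pos_lower_bound) auto
    then have "- (1 / 2) * ln (1 - 2 * x) \<le> x + 4 * x\<^sup>2" by (simp add: power_mult_distrib)
    then have "exp (- (1 / 2) * ln (1 - 2 * x)) \<le> exp (x + 4 * x\<^sup>2)" by simp
    moreover have "\<sigma> = exp (- (1 / 2) * ln (1 - 2 * x))"
    proof -
      have "ln \<sigma> = - (1 / 2) * ln (1 - 2 * x)" unfolding \<sigma>_def using p by (simp add: ln_div ln_sqrt)
      then show ?thesis using \<sigma> by (metis exp_ln)
    qed
    ultimately show "\<sigma> \<le> exp (x + 4 * x\<^sup>2)" by simp
  qed
  finally show ?thesis .
qed

lemma nn_integral_noise_prod:
  assumes "finite F" and m: "\<And>j. \<phi> j \<in> borel_measurable borel"
  shows "(\<integral>\<^sup>+z. (\<Prod>j\<in>F. \<phi> j (z j)) \<partial>noise) = (\<Prod>j\<in>F. \<integral>\<^sup>+t. (\<phi> j t :: ennreal) \<partial>gauss1)"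
  using assms(1)
proof (induction F)
  case empty
  interpret P: prob_space "noise :: (nat \<times> 'a \<Rightarrow> real) measure" by (rule prob_space_noise)
  show ?case using P.emeasure_space_1 by simp
next
  case (insert j F)
  have [measurable]: "\<phi> j \<in> borel_measurable borel" for j by (rule m)
  have "(\<integral>\<^sup>+z. (\<Prod>j\<in>insert j F. \<phi> j (z j)) \<partial>noise) = (\<integral>\<^sup>+z. \<phi> j (z j) * (\<Prod>j\<in>F. \<phi> j (z j)) \<partial>noise)"
    using insert.hyps by simp
  also have "\<dots> = (\<integral>\<^sup>+z. \<integral>\<^sup>+t. \<phi> j t * (\<Prod>j'\<in>F. \<phi> j' ((z(j := t)) j')) \<partial>gauss1 \<partial>noise)"
    by (subst nn_integral_noise_resample[where j = j]) auto
  also have "\<dots> = (\<integral>\<^sup>+z. \<integral>\<^sup>+t. \<phi> j t * (\<Prod>j'\<in>F. \<phi> j' (z j')) \<partial>gauss1 \<partial>noise)"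
  proof (intro nn_integral_cong arg_cong2[where f="(*)"] refl prod.cong)
    fix z :: "nat \<times> 'a \<Rightarrow> real" and t j' assume "j' \<in> F"
    then have "j' \<noteq> j" using insert.hyps by auto
    then show "\<phi> j' ((z(j := t)) j') = \<phi> j' (z j')" by simp
  qed
  also have "\<dots> = (\<integral>\<^sup>+t. \<phi> j t \<partial>gauss1) * (\<integral>\<^sup>+z. (\<Prod>j'\<in>F. \<phi> j' (z j')) \<partial>noise)"
    by (simp add: nn_integral_multc nn_integral_cmult)
  finally show ?case using insert by simp
qed

text \<open>Resample the coordinate \<open>j\<close> of the prior and of the noise and keep all others fixed: the
observation then depends on the new values through \<open>s j * r + \<epsilon> * t\<close> only, which is the one-dimensional problem.\<close>

lemma noise_bayes_risk:
  fixes G :: "(nat \<times> 'p \<Rightarrow> real) \<Rightarrow> real" and s :: "nat \<times> 'p \<Rightarrow> real" and \<epsilon> :: real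
  assumes G [measurable]: "G \<in> borel_measurable (PiM UNIV (\<lambda>_. borel))" and s: "s j > 0" and \<epsilon>: "\<epsilon> > 0"
  shows "ennreal ((s j)\<^sup>2 * \<epsilon>\<^sup>2 / ((s j)\<^sup>2 + \<epsilon>\<^sup>2))
    \<le> (\<integral>\<^sup>+z. \<integral>\<^sup>+\<xi>. ennreal ((G (\<lambda>j. s j * z j + \<epsilon> * \<xi> j) - s j * z j)\<^sup>2) \<partial>noise \<partial>noise)"
proof -
  interpret N: prob_space gauss1 by (rule prob_space_gauss1)
  interpret P: prob_space "noise :: (nat \<times> 'p \<Rightarrow> real) measure" by (rule prob_space_noise)
  interpret NP: pair_sigma_finite gauss1 "noise :: (nat \<times> 'p \<Rightarrow> real) measure" by unfold_locales
  let ?M = "PiM UNIV (\<lambda>_. borel) :: (nat \<times> 'p \<Rightarrow> real) measure"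
  define v where "v = (s j)\<^sup>2 * \<epsilon>\<^sup>2 / ((s j)\<^sup>2 + \<epsilon>\<^sup>2)"
  define f where "f = (\<lambda>z \<xi>. ennreal ((G (\<lambda>j. s j * z j + \<epsilon> * \<xi> j) - s j * z j)\<^sup>2))"
  have comb [measurable]: "(\<lambda>x. (\<lambda>j. s j * A x j + \<epsilon> * B x j)) \<in> N \<rightarrow>\<^sub>M ?M"
    if "A \<in> N \<rightarrow>\<^sub>M ?M" "B \<in> N \<rightarrow>\<^sub>M ?M" for A B and N :: "'x measure"
  proof (rule measurable_PiM_single')
    fix i
    have [measurable]: "(\<lambda>x. A x i) \<in> borel_measurable N" "(\<lambda>x. B x i) \<in> borel_measurable N"
      using measurable_compose[OF that(1), of "\<lambda>z. z i" borel] measurable_compose[OF that(2), of "\<lambda>z. z i" borel] by simp_all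
    show "(\<lambda>x. s i * A x i + \<epsilon> * B x i) \<in> borel_measurable N" by simp
  qed simp
  have upd [measurable]: "(\<lambda>x. (A x)(j := b x)) \<in> N \<rightarrow>\<^sub>M ?M"
    if "A \<in> N \<rightarrow>\<^sub>M ?M" "b \<in> borel_measurable N" for A b and N :: "'x measure"
  proof (rule measurable_PiM_single')
    fix i
    show "(\<lambda>x. ((A x)(j := b x)) i) \<in> borel_measurable N"
      using measurable_compose[OF that(1), of "\<lambda>z. z i" borel] that(2) by (cases "i = j") simp_all
  qed simp
  have f2: "(\<lambda>x. f (A x) (B x)) \<in> borel_measurable N"
    if A: "A \<in> N \<rightarrow>\<^sub>M ?M" and B: "B \<in> N \<rightarrow>\<^sub>M ?M" for A B and N :: "'x measure"
  proof -
    have [measurable]: "(\<lambda>x. G (\<lambda>j. s j * A x j + \<epsilon> * B x j)) \<in> borel_measurable N"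
      by (rule measurable_compose[OF comb[OF A B] G])
    have [measurable]: "(\<lambda>x. A x j) \<in> borel_measurable N"
      using measurable_compose[OF A, of "\<lambda>z. z j" borel] by simp
    show ?thesis unfolding f_def by measurable
  qed
  have fstm: "fst \<in> noise \<Otimes>\<^sub>M noise \<rightarrow>\<^sub>M ?M" "snd \<in> noise \<Otimes>\<^sub>M noise \<rightarrow>\<^sub>M ?M" by measurable
  have m1: "(\<lambda>z. \<integral>\<^sup>+\<xi>. f z \<xi> \<partial>noise) \<in> borel_measurable ?M"
  proof -
    have "(\<lambda>x. f (fst x) (snd x)) \<in> borel_measurable (noise \<Otimes>\<^sub>M noise)" by (rule f2[OF fstm])
    then have "(\<lambda>(z, \<xi>). f z \<xi>) \<in> borel_measurable (noise \<Otimes>\<^sub>M noise)" by (simp add: split_beta')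
    then have "(\<lambda>z. \<integral>\<^sup>+\<xi>. f z \<xi> \<partial>noise) \<in> borel_measurable noise" by (rule P.borel_measurable_nn_integral)
    then show ?thesis by simp
  qed
  have m2: "f z \<in> borel_measurable ?M" for z
  proof -
    have z: "z \<in> space ?M" by (simp add: space_PiM)
    show ?thesis by (rule f2[OF measurable_const[OF z] measurable_ident_sets[OF refl]])
  qed
  have "(\<integral>\<^sup>+z. \<integral>\<^sup>+\<xi>. f z \<xi> \<partial>noise \<partial>noise) = (\<integral>\<^sup>+z. \<integral>\<^sup>+r. \<integral>\<^sup>+\<xi>. f (z(j := r)) \<xi> \<partial>noise \<partial>gauss1 \<partial>noise)"
    by (rule nn_integral_noise_resample[OF m1])
  also have "\<dots> = (\<integral>\<^sup>+z. \<integral>\<^sup>+r. \<integral>\<^sup>+\<xi>. \<integral>\<^sup>+t. f (z(j := r)) (\<xi>(j := t)) \<partial>gauss1 \<partial>noise \<partial>gauss1 \<partial>noise)"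
    by (subst nn_integral_noise_resample[OF m2, where j = j]) (rule refl)
  also have "\<dots> = (\<integral>\<^sup>+z. \<integral>\<^sup>+\<xi>. \<integral>\<^sup>+r. \<integral>\<^sup>+t. f (z(j := r)) (\<xi>(j := t)) \<partial>gauss1 \<partial>gauss1 \<partial>noise \<partial>noise)"
  proof (rule nn_integral_cong)
    fix z :: "nat \<times> 'p \<Rightarrow> real"
    have z: "z \<in> space ?M" by (simp add: space_PiM)
    have "(\<lambda>x. f (z(j := fst (fst x))) ((snd (fst x))(j := snd x))) \<in> borel_measurable ((gauss1 \<Otimes>\<^sub>M noise) \<Otimes>\<^sub>M gauss1)"
      using z by (intro f2 upd) measurable
    then have "(\<lambda>x. \<integral>\<^sup>+t. f (z(j := fst x)) ((snd x)(j := t)) \<partial>gauss1) \<in> borel_measurable (gauss1 \<Otimes>\<^sub>M noise)"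
      by (intro N.borel_measurable_nn_integral) (simp add: split_beta')
    then show "(\<integral>\<^sup>+r. \<integral>\<^sup>+\<xi>. \<integral>\<^sup>+t. f (z(j := r)) (\<xi>(j := t)) \<partial>gauss1 \<partial>noise \<partial>gauss1)
        = (\<integral>\<^sup>+\<xi>. \<integral>\<^sup>+r. \<integral>\<^sup>+t. f (z(j := r)) (\<xi>(j := t)) \<partial>gauss1 \<partial>gauss1 \<partial>noise)"
      by (intro NP.Fubini'[symmetric]) (simp add: split_beta')
  qed
  also have "\<dots> \<ge> (\<integral>\<^sup>+z. \<integral>\<^sup>+\<xi>. ennreal v \<partial>(noise :: (nat \<times> 'p \<Rightarrow> real) measure) \<partial>(noise :: (nat \<times> 'p \<Rightarrow> real) measure))"
  proof (intro nn_integral_mono)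
    fix z \<xi> :: "nat \<times> 'p \<Rightarrow> real"
    define g where "g = (\<lambda>w. G ((\<lambda>j. s j * z j + \<epsilon> * \<xi> j)(j := w)))"
    have "(\<lambda>w::real. (\<lambda>j. s j * z j + \<epsilon> * \<xi> j)(j := w)) \<in> borel \<rightarrow>\<^sub>M ?M"
      by (rule upd[OF measurable_const measurable_ident_sets[OF refl]]) (simp add: space_PiM)
    then have gm: "g \<in> borel_measurable borel" unfolding g_def by (rule measurable_compose[OF _ G])
    have "f (z(j := r)) (\<xi>(j := t)) = ennreal ((g (s j * r + \<epsilon> * t) - s j * r)\<^sup>2)" for r t
    proof -
      have "(\<lambda>i. s i * (z(j := r)) i + \<epsilon> * (\<xi>(j := t)) i) = (\<lambda>j. s j * z j + \<epsilon> * \<xi> j)(j := s j * r + \<epsilon> * t)"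
        by auto
      then show ?thesis unfolding f_def g_def by simp
    qed
    then show "ennreal v \<le> (\<integral>\<^sup>+r. \<integral>\<^sup>+t. f (z(j := r)) (\<xi>(j := t)) \<partial>gauss1 \<partial>gauss1)"
      unfolding v_def using gaussian_bayes_risk[OF gm s \<epsilon>] by simp
  qed
  also have "(\<integral>\<^sup>+z. \<integral>\<^sup>+\<xi>. ennreal v \<partial>(noise :: (nat \<times> 'p \<Rightarrow> real) measure) \<partial>(noise :: (nat \<times> 'p \<Rightarrow> real) measure)) = ennreal v"
    using P.emeasure_space_1 by simp
  finally show ?thesis unfolding v_def f_def .
qed

section \<open>A Bayesian lower bound on the ellipsoid\<close>

definition clip :: "real \<Rightarrow> real \<Rightarrow> real" where
  "clip b x = max (- b) (min b x)"

lemma clip_bound: "b \<ge> 0 \<Longrightarrow> \<bar>clip b x\<bar> \<le> b"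
  by (auto simp: clip_def)

lemma clip_closer: "\<bar>x\<bar> \<le> b \<Longrightarrow> (clip b a - x)\<^sup>2 \<le> (a - x)\<^sup>2"
proof -
  assume "\<bar>x\<bar> \<le> b"
  then have "- b \<le> x" "x \<le> b" by auto
  then have "\<bar>clip b a - x\<bar> \<le> \<bar>a - x\<bar>" unfolding clip_def by linarith
  then show ?thesis by (rule abs_le_square_iff[THEN iffD1])
qed

context eigenframe
begin

definition from_coords :: "(nat \<times> 'p \<Rightarrow> real) \<Rightarrow> nat \<Rightarrow> real^'p" where
  "from_coords W i = (\<Sum>k\<in>UNIV. W (i, k) *\<^sub>R u k)"

lemma inner_from_coords: "u k \<bullet> from_coords W i = W (i, k)"
  by (simp add: from_coords_def inner_sum_frame)

lemma data_from_coords: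
  "data \<epsilon> (from_coords (\<lambda>j. s j * z j)) \<xi> = (\<lambda>i\<in>{1..}. from_coords (\<lambda>j. s j * z j + \<epsilon> * \<xi> j) i)"
  unfolding data_def obs_def from_coords_def
  by (simp add: scaleR_add_left sum.distrib scaleR_sum_right)

lemma sum_coord_risk_le_risk:
  assumes \<delta>: "\<delta> \<in> estimators" and F: "finite F" "F \<subseteq> {1..} \<times> UNIV"
  shows "(\<Sum>j\<in>F. ennreal (d (snd j)) * coord_risk \<epsilon> \<theta> \<delta> (fst j) (snd j)) \<le> risk Q \<epsilon> \<theta> \<delta>"
proof -
  obtain m where m: "fst ` F \<subseteq> {..m}" using F(1) by (meson finite_imageI finite_nat_iff_bounded_le)
  let ?c = "\<lambda>j. ennreal (d (snd j)) * coord_risk \<epsilon> \<theta> \<delta> (fst j) (snd j)"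
  have "(\<Sum>j\<in>F. ?c j) \<le> (\<Sum>j\<in>{1..m} \<times> UNIV. ?c j)"
    using F m by (intro sum_mono2) (auto simp: subset_iff)
  also have "\<dots> = (\<Sum>i=1..m. \<Sum>k\<in>UNIV. ?c (i, k))" by (simp add: sum.cartesian_product split_beta')
  also have "\<dots> = (\<Sum>n<m. \<Sum>k\<in>UNIV. ?c (Suc n, k))" by (simp only: One_nat_def sum.atLeast1_atMost_eq)
  also have "\<dots> \<le> (\<Sum>n. \<Sum>k\<in>UNIV. ?c (Suc n, k))" by (intro sum_le_suminf summableI) auto
  finally show ?thesis by (simp add: risk_eq[OF \<delta>])
qed

text \<open>The prior draws \<open>x\<^sub>j = s j * z j\<close> for \<open>j \<in> F\<close>, and \<open>\<gamma>\<close> is the value of the ellipsoid's form.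
Clip the estimates to \<open>[-b, b]\<close> with \<open>b = sqrt D\<close>, which contains the coordinates on the ellipsoid since
\<open>a\<^sub>i \<ge> 1\<close> for \<open>i \<ge> 2\<close>. If \<open>\<gamma> \<le> 1\<close>, clipping can only help and the risk is bounded by the maximal risk. If
\<open>\<gamma> > 1\<close>, the clipped loss is at most \<open>K \<gamma> \<le> K exp (t (\<gamma> - 1))\<close>, whose expectation is a product of
one-dimensional integrals. The Bayes risk is at most the sum of both contributions.\<close>

lemma max_risk_lower_bound:
  fixes \<epsilon> \<beta> t D :: real and s :: "nat \<times> 'p \<Rightarrow> real" and F :: "(nat \<times> 'p) set"
  assumes \<delta>: "\<delta> \<in> estimators" and \<epsilon>: "\<epsilon> > 0" and \<beta>: "\<beta> > 0"
    and F: "finite F" "F \<subseteq> {2..} \<times> UNIV" and s: "\<And>j. j \<in> F \<Longrightarrow> s j > 0"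
    and D: "\<And>k. d k \<le> D" and t: "t \<ge> 1"
  defines "\<tau> \<equiv> \<lambda>j. (sobolev_weight \<beta> (fst j))\<^sup>2 * (s j)\<^sup>2 / d (snd j)"
  assumes t\<tau>: "\<And>j. j \<in> F \<Longrightarrow> t * \<tau> j \<le> 1 / 4"
  shows "ennreal (\<Sum>j\<in>F. d (snd j) * ((s j)\<^sup>2 * \<epsilon>\<^sup>2 / ((s j)\<^sup>2 + \<epsilon>\<^sup>2)))
    \<le> max_risk \<beta> Q \<epsilon> \<delta> + ennreal (2 * D\<^sup>2 * (card F + 1) * exp (- t + (\<Sum>j\<in>F. t * \<tau> j + 4 * (t * \<tau> j)\<^sup>2)))"
proof -
  interpret P: prob_space "noise :: (nat \<times> 'p \<Rightarrow> real) measure" by (rule prob_space_noise)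
  let ?M = "PiM UNIV (\<lambda>_. borel) :: (nat \<times> 'p \<Rightarrow> real) measure"
  define s' where "s' = (\<lambda>j. if j \<in> F then s j else 0)"
  define \<theta> where "\<theta> = (\<lambda>z. from_coords (\<lambda>j. s' j * z j))"
  define \<gamma> where "\<gamma> = (\<lambda>z. \<Sum>j\<in>F. \<tau> j * (z j)\<^sup>2)"
  define b where "b = sqrt D"
  define K where "K = 2 * D\<^sup>2 * (card F + 1)"
  have d0: "d k \<ge> 0" for k using d_pos[of k] by simp
  have D0: "D \<ge> 0" using d0 D by (meson order_trans)
  have b0: "b \<ge> 0" and b2: "b\<^sup>2 = D" using D0 by (simp_all add: b_def)
  have K0: "K \<ge> 0" by (simp add: K_def)
  have \<tau>0: "\<tau> j \<ge> 0" for j using d0 by (simp add: \<tau>_def)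
  have a1: "sobolev_weight \<beta> (fst j) \<ge> 1" if "j \<in> F" for j
  proof -
    have i: "fst j \<ge> 2" using F(2) that by auto
    then have "1 \<le> (real (fst j) - 1) powr \<beta>" using \<beta> by (intro ge_one_powr_ge_zero) auto
    also have "\<dots> \<le> sobolev_weight \<beta> (fst j)" using i by (intro sobolev_weight_bounds[OF \<beta>]) simp
    finally show ?thesis .
  qed
  have x2: "d (snd j) * (s j * z j)\<^sup>2 \<le> D\<^sup>2 * (\<tau> j * (z j)\<^sup>2)" if "j \<in> F" for j z
  proof -
    have "(d (snd j))\<^sup>2 \<le> D\<^sup>2" by (rule power_mono[OF D d0])
    moreover have "1 \<le> (sobolev_weight \<beta> (fst j))\<^sup>2" using a1[OF that] by simp
    ultimately have "(d (snd j))\<^sup>2 * 1 * ((s j * z j)\<^sup>2 / d (snd j)) \<le> D\<^sup>2 * (sobolev_weight \<beta> (fst j))\<^sup>2 * ((s j * z j)\<^sup>2 / d (snd j))"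
      using d0 by (intro mult_right_mono mult_mono) auto
    then show ?thesis using d_pos[of "snd j"]
      by (simp add: \<tau>_def power2_eq_square mult_ac)
  qed
  have trm: "(\<Sum>k\<in>UNIV. sobolev_term \<beta> (\<theta> z) i k) = (\<Sum>k\<in>UNIV. if (i, k) \<in> F then \<tau> (i, k) * (z (i, k))\<^sup>2 else 0)" for z i
    by (rule sum.cong) (auto simp: sobolev_term_def \<theta>_def inner_from_coords s'_def \<tau>_def power_mult_distrib)
  have mem: "\<theta> z \<in> sobolev_ellipsoid \<beta> Q" if z: "\<gamma> z \<le> 1" for z
  proof -
    obtain m where m: "fst ` F \<subseteq> {..m}" using F(1) by (meson finite_imageI finite_nat_iff_bounded_le)
    have "(\<Sum>n. ennreal (\<Sum>k\<in>UNIV. sobolev_term \<beta> (\<theta> z) (Suc n) k)) = (\<Sum>n<m. ennreal (\<Sum>k\<in>UNIV. sobolev_term \<beta> (\<theta> z) (Suc n) k))"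
    proof (rule suminf_finite)
      fix n assume "n \<notin> {..<m}"
      then have "(Suc n, k) \<notin> F" for k using m by force
      then show "ennreal (\<Sum>k\<in>UNIV. sobolev_term \<beta> (\<theta> z) (Suc n) k) = 0" by (simp add: trm)
    qed simp
    also have "\<dots> = ennreal (\<Sum>n<m. \<Sum>k\<in>UNIV. sobolev_term \<beta> (\<theta> z) (Suc n) k)"
      by (rule sum_ennreal) (simp add: sum_nonneg sobolev_term_nonneg)
    also have "(\<Sum>n<m. \<Sum>k\<in>UNIV. sobolev_term \<beta> (\<theta> z) (Suc n) k) = (\<Sum>i=1..m. \<Sum>k\<in>UNIV. sobolev_term \<beta> (\<theta> z) i k)"
      by (simp only: One_nat_def sum.atLeast1_atMost_eq)
    also have "\<dots> = (\<Sum>j\<in>{1..m} \<times> UNIV. if j \<in> F then \<tau> j * (z j)\<^sup>2 else 0)"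
      unfolding trm sum.cartesian_product by (rule sum.cong) auto
    also have "\<dots> = \<gamma> z"
    proof -
      have "{1..m} \<times> UNIV \<inter> F = F" using F(2) m by force
      then show ?thesis unfolding \<gamma>_def by (subst sum.inter_restrict[symmetric]) auto
    qed
    finally show ?thesis using z by (simp add: sobolev_ellipsoid_iff)
  qed
  define est where "est = (\<lambda>j W. clip b (u (snd j) \<bullet> \<delta> (\<lambda>i\<in>{1..}. from_coords W i) (fst j)))"
  have est_m [measurable]: "est j \<in> borel_measurable ?M" if "j \<in> F" for j
  proof -
    have i: "fst j \<ge> 1" using F(2) that by auto
    have "(\<lambda>W. \<lambda>i\<in>{1..}. from_coords W i) \<in> ?M \<rightarrow>\<^sub>M obs_space"
      by (rule measurable_restrict) (simp add: from_coords_def)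
    from measurable_compose[OF this estimator_measurable[OF \<delta> i]] show ?thesis
      unfolding est_def clip_def by measurable
  qed
  define trunc_loss where "trunc_loss = (\<lambda>z \<xi>. \<Sum>j\<in>F. ennreal (d (snd j)) * ennreal ((est j (\<lambda>j. s' j * z j + \<epsilon> * \<xi> j) - s' j * z j)\<^sup>2))"
  have W_m: "(\<lambda>\<xi>. (\<lambda>j. s' j * z j + \<epsilon> * \<xi> j)) \<in> ?M \<rightarrow>\<^sub>M ?M" for z
    by (rule measurable_PiM_single') simp_all
  have e_m: "(\<lambda>\<xi>. est j (\<lambda>j. s' j * z j + \<epsilon> * \<xi> j)) \<in> borel_measurable ?M" if "j \<in> F" for z j
    by (rule measurable_compose[OF W_m est_m[OF that]])
  have W_m2: "(\<lambda>x. (\<lambda>j. s' j * fst x j + \<epsilon> * snd x j)) \<in> noise \<Otimes>\<^sub>M noise \<rightarrow>\<^sub>M ?M"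
    by (rule measurable_PiM_single') simp_all
  have e_m2 [measurable]: "(\<lambda>x. est j (\<lambda>j. s' j * fst x j + \<epsilon> * snd x j)) \<in> borel_measurable (noise \<Otimes>\<^sub>M noise)" if "j \<in> F" for j
    by (rule measurable_compose[OF W_m2 est_m[OF that]])
  have inner: "(\<integral>\<^sup>+\<xi>. trunc_loss z \<xi> \<partial>noise) \<le> max_risk \<beta> Q \<epsilon> \<delta> + ennreal (K * exp (- t)) * ennreal (exp (t * \<gamma> z))" for z
  proof (cases "\<gamma> z \<le> 1")
    case True
    have le1: "\<tau> j * (z j)\<^sup>2 \<le> 1" if "j \<in> F" for j
    proof -
      have "\<tau> j * (z j)\<^sup>2 \<le> \<gamma> z" unfolding \<gamma>_def using F(1) that \<tau>0 by (intro member_le_sum) auto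
      then show ?thesis using True by simp
    qed
    have xb: "\<bar>s' j * z j\<bar> \<le> b" if j: "j \<in> F" for j
    proof -
      have "(sobolev_weight \<beta> (fst j))\<^sup>2 * (s j * z j)\<^sup>2 / d (snd j) \<le> 1"
        using le1[OF j] by (simp add: \<tau>_def power_mult_distrib mult_ac)
      then have "(sobolev_weight \<beta> (fst j))\<^sup>2 * (s j * z j)\<^sup>2 \<le> d (snd j)"
        using d_pos[of "snd j"] by (simp add: pos_divide_le_eq)
      moreover have "1 * (s j * z j)\<^sup>2 \<le> (sobolev_weight \<beta> (fst j))\<^sup>2 * (s j * z j)\<^sup>2"
        using a1[OF j] by (intro mult_right_mono) auto
      ultimately have "(s j * z j)\<^sup>2 \<le> D" using D[of "snd j"] by linarith
      then show ?thesis unfolding b_def s'_def using j by (simp add: real_le_rsqrt)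
    qed
    have "(\<integral>\<^sup>+\<xi>. trunc_loss z \<xi> \<partial>noise) = (\<Sum>j\<in>F. ennreal (d (snd j)) * (\<integral>\<^sup>+\<xi>. ennreal ((est j (\<lambda>j. s' j * z j + \<epsilon> * \<xi> j) - s' j * z j)\<^sup>2) \<partial>noise))"
      unfolding trunc_loss_def using e_m by (subst nn_integral_sum) (auto simp: nn_integral_cmult)
    also have "\<dots> \<le> (\<Sum>j\<in>F. ennreal (d (snd j)) * coord_risk \<epsilon> (\<theta> z) \<delta> (fst j) (snd j))"
    proof (intro sum_mono mult_left_mono)
      fix j assume j: "j \<in> F"
      show "(\<integral>\<^sup>+\<xi>. ennreal ((est j (\<lambda>j. s' j * z j + \<epsilon> * \<xi> j) - s' j * z j)\<^sup>2) \<partial>noise) \<le> coord_risk \<epsilon> (\<theta> z) \<delta> (fst j) (snd j)"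
        unfolding coord_risk_def
      proof (intro nn_integral_mono ennreal_leI)
        fix \<xi> :: "nat \<times> 'p \<Rightarrow> real"
        show "(est j (\<lambda>j. s' j * z j + \<epsilon> * \<xi> j) - s' j * z j)\<^sup>2 \<le> (u (snd j) \<bullet> (\<delta> (data \<epsilon> (\<theta> z) \<xi>) (fst j) - \<theta> z (fst j)))\<^sup>2"
          unfolding est_def \<theta>_def data_from_coords inner_diff_right inner_from_coords
          using clip_closer[OF xb[OF j]] by simp
      qed
    qed simp
    also have "\<dots> \<le> risk Q \<epsilon> (\<theta> z) \<delta>"
      by (rule sum_coord_risk_le_risk[OF \<delta> F(1)]) (use F(2) in force)
    also have "\<dots> \<le> max_risk \<beta> Q \<epsilon> \<delta>" unfolding max_risk_def by (rule SUP_upper[OF mem[OF True]])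
    also have "\<dots> \<le> max_risk \<beta> Q \<epsilon> \<delta> + ennreal (K * exp (- t)) * ennreal (exp (t * \<gamma> z))" by simp
    finally show ?thesis .
  next
    case False
    have pt: "trunc_loss z \<xi> \<le> ennreal (K * exp (- t)) * ennreal (exp (t * \<gamma> z))" for \<xi>
    proof -
      have "trunc_loss z \<xi> = ennreal (\<Sum>j\<in>F. d (snd j) * (est j (\<lambda>j. s' j * z j + \<epsilon> * \<xi> j) - s' j * z j)\<^sup>2)"
        unfolding trunc_loss_def using d0 by (simp add: sum_ennreal[symmetric] ennreal_mult)
      also have "\<dots> \<le> ennreal (K * exp (- t) * exp (t * \<gamma> z))"
      proof (rule ennreal_leI)
        have sq: "(p - q)\<^sup>2 \<le> 2 * p\<^sup>2 + 2 * q\<^sup>2" for p q :: real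
          using zero_le_power2[of "p + q"] by (simp add: power2_eq_square algebra_simps)
        have "(\<Sum>j\<in>F. d (snd j) * (est j (\<lambda>j. s' j * z j + \<epsilon> * \<xi> j) - s' j * z j)\<^sup>2)
           \<le> (\<Sum>j\<in>F. 2 * D\<^sup>2 + 2 * (D\<^sup>2 * (\<tau> j * (z j)\<^sup>2)))"
        proof (rule sum_mono)
          fix j assume j: "j \<in> F"
          let ?e = "est j (\<lambda>j. s' j * z j + \<epsilon> * \<xi> j)"
          have "\<bar>?e\<bar>\<^sup>2 \<le> b\<^sup>2" unfolding est_def by (rule power_mono[OF clip_bound[OF b0]]) simp
          then have e2: "?e\<^sup>2 \<le> D" by (simp add: b2)
          have "d (snd j) * (?e - s' j * z j)\<^sup>2 \<le> d (snd j) * (2 * ?e\<^sup>2 + 2 * (s' j * z j)\<^sup>2)"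
            by (rule mult_left_mono[OF sq d0])
          also have "\<dots> = 2 * (d (snd j) * ?e\<^sup>2) + 2 * (d (snd j) * (s j * z j)\<^sup>2)"
            using j by (simp add: s'_def algebra_simps)
          also have "\<dots> \<le> 2 * (D * D) + 2 * (D\<^sup>2 * (\<tau> j * (z j)\<^sup>2))"
            using mult_mono[OF D[of "snd j"] e2 D0] x2[OF j, of z] by simp
          finally show "d (snd j) * (?e - s' j * z j)\<^sup>2 \<le> 2 * D\<^sup>2 + 2 * (D\<^sup>2 * (\<tau> j * (z j)\<^sup>2))"
            by (simp add: power2_eq_square)
        qed
        also have "\<dots> = 2 * D\<^sup>2 * card F * 1 + 2 * D\<^sup>2 * \<gamma> z"
          by (simp add: sum.distrib \<gamma>_def sum_distrib_left mult.assoc)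
        also have "\<dots> \<le> 2 * D\<^sup>2 * card F * \<gamma> z + 2 * D\<^sup>2 * \<gamma> z"
          using False by (intro add_right_mono mult_left_mono) auto
        also have "\<dots> = K * \<gamma> z" by (simp add: K_def algebra_simps)
        also have "\<dots> \<le> K * exp (t * (\<gamma> z - 1))"
        proof (rule mult_left_mono[OF _ K0])
          have "\<gamma> z \<le> exp (\<gamma> z - 1)" using exp_ge_add_one_self[of "\<gamma> z - 1"] by simp
          also have "\<dots> \<le> exp (t * (\<gamma> z - 1))" using t False mult_right_mono[of 1 t "\<gamma> z - 1"] by simp
          finally show "\<gamma> z \<le> exp (t * (\<gamma> z - 1))" .
        qed
        also have "\<dots> = K * exp (- t) * exp (t * \<gamma> z)"
          by (simp add: mult.assoc exp_add[symmetric] algebra_simps)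
        finally show "(\<Sum>j\<in>F. d (snd j) * (est j (\<lambda>j. s' j * z j + \<epsilon> * \<xi> j) - s' j * z j)\<^sup>2) \<le> K * exp (- t) * exp (t * \<gamma> z)" .
      qed
      finally show ?thesis using K0 by (simp add: ennreal_mult)
    qed
    have "(\<integral>\<^sup>+\<xi>. trunc_loss z \<xi> \<partial>noise) \<le> (\<integral>\<^sup>+\<xi>. ennreal (K * exp (- t)) * ennreal (exp (t * \<gamma> z)) \<partial>(noise :: (nat \<times> 'p \<Rightarrow> real) measure))"
      by (rule nn_integral_mono) (rule pt)
    also have "\<dots> = ennreal (K * exp (- t)) * ennreal (exp (t * \<gamma> z))" using P.emeasure_space_1 by simp
    finally show ?thesis by (simp add: add_increasing)
  qed
  have mgf: "(\<integral>\<^sup>+z. ennreal (exp (t * \<gamma> z)) \<partial>noise) \<le> ennreal (exp (\<Sum>j\<in>F. t * \<tau> j + 4 * (t * \<tau> j)\<^sup>2))"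
  proof -
    have "(\<integral>\<^sup>+z. ennreal (exp (t * \<gamma> z)) \<partial>noise) = (\<integral>\<^sup>+z. (\<Prod>j\<in>F. ennreal (exp (t * \<tau> j * (z j)\<^sup>2))) \<partial>noise)"
      using F(1) by (simp add: \<gamma>_def sum_distrib_left exp_sum prod_ennreal mult.assoc)
    also have "\<dots> = (\<Prod>j\<in>F. \<integral>\<^sup>+r. ennreal (exp (t * \<tau> j * r\<^sup>2)) \<partial>gauss1)"
      by (rule nn_integral_noise_prod[OF F(1)]) simp
    also have "\<dots> \<le> (\<Prod>j\<in>F. ennreal (exp (t * \<tau> j + 4 * (t * \<tau> j)\<^sup>2)))"
      by (intro prod_mono_ennreal gaussian_square_mgf) (use t \<tau>0 t\<tau> in auto)
    also have "\<dots> = ennreal (exp (\<Sum>j\<in>F. t * \<tau> j + 4 * (t * \<tau> j)\<^sup>2))"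
      using F(1) by (simp add: prod_ennreal exp_sum)
    finally show ?thesis .
  qed
  have \<gamma>_m [measurable]: "\<gamma> \<in> borel_measurable ?M" unfolding \<gamma>_def by measurable
  have "ennreal (\<Sum>j\<in>F. d (snd j) * ((s j)\<^sup>2 * \<epsilon>\<^sup>2 / ((s j)\<^sup>2 + \<epsilon>\<^sup>2)))
      = (\<Sum>j\<in>F. ennreal (d (snd j)) * ennreal ((s' j)\<^sup>2 * \<epsilon>\<^sup>2 / ((s' j)\<^sup>2 + \<epsilon>\<^sup>2)))"
  proof -
    let ?v = "\<lambda>j. (s' j)\<^sup>2 * \<epsilon>\<^sup>2 / ((s' j)\<^sup>2 + \<epsilon>\<^sup>2)"
    have v0: "0 \<le> ?v j" for j by simp
    have "(\<Sum>j\<in>F. d (snd j) * ((s j)\<^sup>2 * \<epsilon>\<^sup>2 / ((s j)\<^sup>2 + \<epsilon>\<^sup>2))) = (\<Sum>j\<in>F. d (snd j) * ?v j)"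
      by (rule sum.cong) (simp_all add: s'_def)
    also have "ennreal \<dots> = (\<Sum>j\<in>F. ennreal (d (snd j) * ?v j))"
      by (rule sum_ennreal[symmetric]) (intro mult_nonneg_nonneg d0 v0)
    also have "\<dots> = (\<Sum>j\<in>F. ennreal (d (snd j)) * ennreal (?v j))"
      by (intro sum.cong refl ennreal_mult d0 v0)
    finally show ?thesis .
  qed
  also have "\<dots> \<le> (\<Sum>j\<in>F. ennreal (d (snd j)) * (\<integral>\<^sup>+z. \<integral>\<^sup>+\<xi>. ennreal ((est j (\<lambda>j. s' j * z j + \<epsilon> * \<xi> j) - s' j * z j)\<^sup>2) \<partial>noise \<partial>noise))"
    using s by (intro sum_mono mult_left_mono noise_bayes_risk est_m \<epsilon>) (auto simp: s'_def)
  also have "\<dots> = (\<integral>\<^sup>+z. \<integral>\<^sup>+\<xi>. trunc_loss z \<xi> \<partial>noise \<partial>noise)"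
  proof -
    have m: "(\<lambda>z. \<integral>\<^sup>+\<xi>. ennreal ((est j (\<lambda>j. s' j * z j + \<epsilon> * \<xi> j) - s' j * z j)\<^sup>2) \<partial>noise) \<in> borel_measurable noise" if "j \<in> F" for j
      using e_m2[OF that] by (intro P.borel_measurable_nn_integral) (simp add: split_beta')
    have "(\<integral>\<^sup>+\<xi>. trunc_loss z \<xi> \<partial>noise) = (\<Sum>j\<in>F. ennreal (d (snd j)) * (\<integral>\<^sup>+\<xi>. ennreal ((est j (\<lambda>j. s' j * z j + \<epsilon> * \<xi> j) - s' j * z j)\<^sup>2) \<partial>noise))" for z
      unfolding trunc_loss_def using e_m by (subst nn_integral_sum) (auto simp: nn_integral_cmult)
    then show ?thesis using m by (simp add: nn_integral_sum nn_integral_cmult)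
  qed
  also have "\<dots> \<le> (\<integral>\<^sup>+z. max_risk \<beta> Q \<epsilon> \<delta> + ennreal (K * exp (- t)) * ennreal (exp (t * \<gamma> z)) \<partial>noise)"
    by (rule nn_integral_mono) (rule inner)
  also have "\<dots> = max_risk \<beta> Q \<epsilon> \<delta> + ennreal (K * exp (- t)) * (\<integral>\<^sup>+z. ennreal (exp (t * \<gamma> z)) \<partial>noise)"
    using P.emeasure_space_1 by (subst nn_integral_add) (auto simp: nn_integral_cmult)
  also have "\<dots> \<le> max_risk \<beta> Q \<epsilon> \<delta> + ennreal (K * exp (- t)) * ennreal (exp (\<Sum>j\<in>F. t * \<tau> j + 4 * (t * \<tau> j)\<^sup>2))"
    by (intro add_left_mono mult_left_mono mgf) simp
  also have "ennreal (K * exp (- t)) * ennreal (exp (\<Sum>j\<in>F. t * \<tau> j + 4 * (t * \<tau> j)\<^sup>2))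
      = ennreal (2 * D\<^sup>2 * (card F + 1) * exp (- t + (\<Sum>j\<in>F. t * \<tau> j + 4 * (t * \<tau> j)\<^sup>2)))"
    using K0 unfolding exp_add by (simp add: K_def ennreal_mult[symmetric] mult.assoc)
  finally show ?thesis .
qed

end

section \<open>Pinsker's level and the asymptotic upper bound\<close>

locale pinsker_problem = eigenframe Q u d for Q :: "real^'p^'p" and u d +
  fixes \<beta> :: real
  assumes \<beta>_pos: "\<beta> > 0"
begin

text \<open>The trace of \<open>Q\<close> to the power \<open>(\<beta> + 1) / \<beta>\<close>.\<close>

definition "tr_pow = (\<Sum>k\<in>UNIV. d k powr ((\<beta> + 1) / \<beta>))"
definition "tr_Q = (\<Sum>k\<in>UNIV. d k)"
text \<open>Pinsker's \<open>\<kappa>\<close>: the minimiser of the sum of the maximal squared bias \<open>\<kappa>\<^sup>2\<close> and the variance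
\<open>\<epsilon>\<^sup>2 \<Sum> d k * (weight)\<^sup>2\<close>, with the sum over times replaced by an integral.\<close>

definition "level \<epsilon> = (tr_pow * \<beta> / ((\<beta> + 1) * (2 * \<beta> + 1)) * \<epsilon>\<^sup>2) powr (\<beta> / (2 * \<beta> + 1))"
text \<open>The real time at which \<open>i powr \<beta>\<close> reaches \<open>d k / \<kappa>\<close>; later coordinates get weight 0.\<close>

definition "cutoff \<epsilon> k = (d k / level \<epsilon>) powr (1 / \<beta>)"

lemma tr_pow_pos: "tr_pow > 0"
  unfolding tr_pow_def using d_pos by (intro sum_pos) (auto simp: powr_gt_zero less_imp_neq[THEN not_sym])

lemma tr_Q_pos: "tr_Q > 0"
  unfolding tr_Q_def using d_pos by (intro sum_pos) auto

lemma amplitude_pos: "tr_pow * \<beta> / ((\<beta> + 1) * (2 * \<beta> + 1)) > 0"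
  using tr_pow_pos \<beta>_pos by simp

lemma level_pos: "\<epsilon> > 0 \<Longrightarrow> level \<epsilon> > 0"
proof -
  assume "\<epsilon> > 0"
  then have "tr_pow * \<beta> / ((\<beta> + 1) * (2 * \<beta> + 1)) * \<epsilon>\<^sup>2 > 0" by (intro mult_pos_pos amplitude_pos) simp
  then show ?thesis unfolding level_def by (metis less_irrefl powr_gt_zero)
qed

lemma cutoff_pos: "\<epsilon> > 0 \<Longrightarrow> cutoff \<epsilon> k > 0"
  unfolding cutoff_def using level_pos d_pos[of k] by (simp add: less_imp_neq[THEN not_sym])

text \<open>Both the variance of Pinsker's estimator and the Bayes risk of Pinsker's prior are multiples of the left
side, up to rounding; this expresses them by \<open>\<kappa>\<^sup>2\<close>.\<close>

lemma level_equation: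
  assumes "\<epsilon> > 0"
  shows "\<epsilon>\<^sup>2 * (\<Sum>k\<in>UNIV. d k * cutoff \<epsilon> k) = (level \<epsilon>)\<^sup>2 * ((\<beta> + 1) * (2 * \<beta> + 1) / \<beta>)"
proof -
  let ?A = "tr_pow * \<beta> / ((\<beta> + 1) * (2 * \<beta> + 1))"
  let ?\<kappa> = "level \<epsilon>"
  have \<kappa>: "?\<kappa> > 0" by (rule level_pos[OF assms])
  have "d k * cutoff \<epsilon> k = d k powr ((\<beta> + 1) / \<beta>) / ?\<kappa> powr (1 / \<beta>)" for k
  proof -
    have "d k powr ((\<beta> + 1) / \<beta>) = d k powr (1 + 1 / \<beta>)" using \<beta>_pos by (simp add: add_divide_distrib)
    also have "\<dots> = d k * d k powr (1 / \<beta>)" using d_pos[of k] by (simp add: powr_add)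
    finally show ?thesis using d_pos[of k] \<kappa> by (simp add: cutoff_def powr_divide)
  qed
  then have 1: "(\<Sum>k\<in>UNIV. d k * cutoff \<epsilon> k) = tr_pow / ?\<kappa> powr (1 / \<beta>)"
    by (simp add: tr_pow_def sum_divide_distrib)
  have 2: "?\<kappa>\<^sup>2 * ?\<kappa> powr (1 / \<beta>) = ?A * \<epsilon>\<^sup>2"
  proof -
    have "?\<kappa>\<^sup>2 = ?\<kappa> powr 2" using \<kappa> by simp
    then have "?\<kappa>\<^sup>2 * ?\<kappa> powr (1 / \<beta>) = ?\<kappa> powr (2 + 1 / \<beta>)" by (simp only: powr_add)
    also have "\<dots> = (?A * \<epsilon>\<^sup>2) powr (\<beta> / (2 * \<beta> + 1) * (2 + 1 / \<beta>))"
      unfolding level_def by (rule powr_powr)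
    also have "\<beta> / (2 * \<beta> + 1) * (2 + 1 / \<beta>) = 1"
    proof -
      have "2 + 1 / \<beta> = (2 * \<beta> + 1) / \<beta>" "2 * \<beta> + 1 \<noteq> 0" using \<beta>_pos by (simp_all add: field_simps)
      then show ?thesis using \<beta>_pos by simp
    qed
    also have "(?A * \<epsilon>\<^sup>2) powr 1 = ?A * \<epsilon>\<^sup>2" by (intro powr_one mult_nonneg_nonneg less_imp_le[OF amplitude_pos]) simp
    finally show ?thesis .
  qed
  have P: "?\<kappa> powr (1 / \<beta>) > 0" using \<kappa> by simp
  have "\<epsilon>\<^sup>2 * (tr_pow / ?\<kappa> powr (1 / \<beta>)) = (?A * \<epsilon>\<^sup>2) * ((\<beta> + 1) * (2 * \<beta> + 1) / \<beta>) / ?\<kappa> powr (1 / \<beta>)"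
    using \<beta>_pos by simp
  also have "\<dots> = ?\<kappa>\<^sup>2 * ((\<beta> + 1) * (2 * \<beta> + 1) / \<beta>)"
    unfolding 2[symmetric] using P by simp
  finally show ?thesis unfolding 1 .
qed

lemma pinsker_const_level:
  assumes "\<epsilon> > 0"
  shows "pinsker_const \<beta> Q * \<epsilon> powr (4 * \<beta> / (2 * \<beta> + 1)) = (2 * \<beta> + 1) * (level \<epsilon>)\<^sup>2"
proof -
  let ?e = "2 * \<beta> / (2 * \<beta> + 1)"
  let ?B = "\<beta> * tr_pow / (\<beta> + 1)"
  have b: "2 * \<beta> + 1 > 0" using \<beta>_pos by simp
  have B: "?B > 0" using \<beta>_pos tr_pow_pos by simp
  have "(level \<epsilon>)\<^sup>2 = level \<epsilon> powr 2" using level_pos[OF assms] by simp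
  also have "\<dots> = (?B * \<epsilon>\<^sup>2 / (2 * \<beta> + 1)) powr (\<beta> / (2 * \<beta> + 1) * 2)"
    unfolding level_def powr_powr by (rule arg_cong2[where f="(powr)"]) (simp_all add: field_simps)
  also have "\<beta> / (2 * \<beta> + 1) * 2 = ?e" by simp
  also have "(?B * \<epsilon>\<^sup>2 / (2 * \<beta> + 1)) powr ?e = ?B powr ?e * (\<epsilon>\<^sup>2) powr ?e / (2 * \<beta> + 1) powr ?e"
    using B b assms by (simp only: powr_divide powr_mult less_imp_le zero_le_power2)
  also have "(\<epsilon>\<^sup>2) powr ?e = \<epsilon> powr (4 * \<beta> / (2 * \<beta> + 1))"
  proof -
    have "\<epsilon>\<^sup>2 = \<epsilon> powr 2" using assms by simp
    then have "(\<epsilon>\<^sup>2) powr ?e = \<epsilon> powr (2 * ?e)" by (simp only: powr_powr)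
    then show ?thesis by simp
  qed
  finally have "(2 * \<beta> + 1) * (level \<epsilon>)\<^sup>2 = (2 * \<beta> + 1) / (2 * \<beta> + 1) powr ?e * (?B powr ?e * \<epsilon> powr (4 * \<beta> / (2 * \<beta> + 1)))"
    by simp
  also have "(2 * \<beta> + 1) / (2 * \<beta> + 1) powr ?e = (2 * \<beta> + 1) powr (1 - ?e)"
    using b by (simp add: powr_diff)
  also have "1 - ?e = 1 / (2 * \<beta> + 1)" using b by (simp add: field_simps)
  finally show ?thesis
    unfolding pinsker_const_def trace_mat_powr tr_pow_def by (simp add: mult.assoc)
qed

text \<open>\<open>\<epsilon>\<^sup>2 / \<kappa>\<^sup>2\<close> is a constant times the power \<open>g = 2 / (2 \<beta> + 1)\<close> of \<open>\<epsilon>\<close>. The limits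
are those of the remainders in the upper bound and, last, of the error in the lower bound.\<close>

lemma level_limits:
  defines "L \<equiv> \<lambda>\<epsilon>. ln (1 / \<epsilon>)"
  shows "((\<lambda>\<epsilon>. \<epsilon>\<^sup>2 / (level \<epsilon>)\<^sup>2) \<longlongrightarrow> 0) (at_right 0)"
    "((\<lambda>\<epsilon>. \<epsilon>\<^sup>2 * (L \<epsilon>)\<^sup>2 / (level \<epsilon>)\<^sup>2) \<longlongrightarrow> 0) (at_right 0)"
    "((\<lambda>\<epsilon>. (2 * \<epsilon>\<^sup>2) powr (2 * \<beta>) / (level \<epsilon>)\<^sup>2) \<longlongrightarrow> 0) (at_right 0)"
    "c > 0 \<Longrightarrow> ((\<lambda>\<epsilon>. (a + b / level \<epsilon> powr (1 / \<beta>)) * exp (- c * ((level \<epsilon>)\<^sup>2 / \<epsilon>\<^sup>2)) / (level \<epsilon>)\<^sup>2) \<longlongrightarrow> 0) (at_right 0)"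
proof -
  define A where "A = tr_pow * \<beta> / ((\<beta> + 1) * (2 * \<beta> + 1))"
  define g where "g = 2 / (2 * \<beta> + 1)"
  have A: "A > 0" unfolding A_def by (rule amplitude_pos)
  have g: "g > 0" unfolding g_def using \<beta>_pos by simp
  have g\<beta>: "2 * (\<beta> * g) = 2 - g" unfolding g_def using \<beta>_pos by (simp add: field_simps)
  define C where "C = A powr (\<beta> / (2 * \<beta> + 1))"
  have C: "C > 0" unfolding C_def using A by simp
  have lev: "level \<epsilon> = C * \<epsilon> powr (\<beta> * g)" if "\<epsilon> > 0" for \<epsilon>
  proof -
    have "level \<epsilon> = A powr (\<beta> / (2 * \<beta> + 1)) * (\<epsilon>\<^sup>2) powr (\<beta> / (2 * \<beta> + 1))"
      unfolding level_def A_def[symmetric] using A by (simp add: powr_mult)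
    also have "(\<epsilon>\<^sup>2) powr (\<beta> / (2 * \<beta> + 1)) = (\<epsilon> powr 2) powr (\<beta> / (2 * \<beta> + 1))" using that by simp
    also have "\<dots> = \<epsilon> powr (\<beta> * g)" unfolding powr_powr g_def by (simp add: mult.commute)
    finally show ?thesis by (simp add: C_def)
  qed
  have lev2: "(level \<epsilon>)\<^sup>2 = C\<^sup>2 * \<epsilon> powr (2 - g)" if "\<epsilon> > 0" for \<epsilon>
  proof -
    have "(\<epsilon> powr (\<beta> * g))\<^sup>2 = \<epsilon> powr (2 * (\<beta> * g))"
      unfolding power2_eq_square powr_add[symmetric] by simp
    then show ?thesis unfolding lev[OF that] g\<beta> power_mult_distrib by simp
  qed
  have ratio: "\<epsilon>\<^sup>2 / (level \<epsilon>)\<^sup>2 = \<epsilon> powr g / C\<^sup>2" if "\<epsilon> > 0" for \<epsilon>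
  proof -
    have "\<epsilon> powr g * \<epsilon> powr (2 - g) = \<epsilon>\<^sup>2" using that by (simp add: powr_add[symmetric])
    then show ?thesis unfolding lev2[OF that] using C that by (simp add: field_simps)
  qed
  have pos: "\<forall>\<^sub>F \<epsilon> in at_right 0. (\<epsilon>::real) > 0" by (simp add: eventually_at_right_less)
  have l1: "((\<lambda>\<epsilon>::real. \<epsilon> powr g / C\<^sup>2) \<longlongrightarrow> 0) (at_right 0)" using g C by real_asymp
  have l2: "((\<lambda>\<epsilon>::real. \<epsilon> powr g / C\<^sup>2 * (ln (1 / \<epsilon>))\<^sup>2) \<longlongrightarrow> 0) (at_right 0)" using g C by real_asymp
  show "((\<lambda>\<epsilon>. \<epsilon>\<^sup>2 / (level \<epsilon>)\<^sup>2) \<longlongrightarrow> 0) (at_right 0)"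
    by (rule Lim_transform_eventually[OF l1]) (use pos in \<open>eventually_elim, simp add: ratio\<close>)
  show "((\<lambda>\<epsilon>. \<epsilon>\<^sup>2 * (L \<epsilon>)\<^sup>2 / (level \<epsilon>)\<^sup>2) \<longlongrightarrow> 0) (at_right 0)"
    by (rule Lim_transform_eventually[OF l2])
      (use pos in \<open>eventually_elim, simp add: ratio[symmetric] L_def\<close>)
  have e: "0 < 4 * \<beta> - 2 + g"
  proof -
    have "4 * \<beta> - 2 + g = 8 * \<beta>\<^sup>2 / (2 * \<beta> + 1)"
      unfolding g_def using \<beta>_pos by (simp add: field_simps power2_eq_square)
    then show ?thesis using \<beta>_pos by simp
  qed
  have l3: "((\<lambda>\<epsilon>::real. 2 powr (2 * \<beta>) / C\<^sup>2 * \<epsilon> powr (4 * \<beta> - 2 + g)) \<longlongrightarrow> 0) (at_right 0)"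
    using e C by real_asymp
  show "((\<lambda>\<epsilon>. (2 * \<epsilon>\<^sup>2) powr (2 * \<beta>) / (level \<epsilon>)\<^sup>2) \<longlongrightarrow> 0) (at_right 0)"
  proof (rule Lim_transform_eventually[OF l3], use pos in eventually_elim)
    fix \<epsilon> :: real assume \<epsilon>: "\<epsilon> > 0"
    have "(2 * \<epsilon>\<^sup>2) powr (2 * \<beta>) = 2 powr (2 * \<beta>) * (\<epsilon> powr 2) powr (2 * \<beta>)" using \<epsilon> by (simp add: powr_mult)
    also have "(\<epsilon> powr 2) powr (2 * \<beta>) = \<epsilon> powr (4 * \<beta> - 2 + g) * \<epsilon> powr (2 - g)"
      unfolding powr_powr powr_add[symmetric] by simp
    finally show "2 powr (2 * \<beta>) / C\<^sup>2 * \<epsilon> powr (4 * \<beta> - 2 + g) = (2 * \<epsilon>\<^sup>2) powr (2 * \<beta>) / (level \<epsilon>)\<^sup>2"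
      unfolding lev2[OF \<epsilon>] using C \<epsilon> by (simp add: field_simps)
  qed
  assume c: "c > 0"
  define c' where "c' = c * C\<^sup>2"
  have c': "c' > 0" unfolding c'_def using c C by simp
  define b' where "b' = b / C powr (1 / \<beta>)"
  have E: "((\<lambda>\<epsilon>::real. \<epsilon> powr (- r) * exp (- c' * \<epsilon> powr (- g))) \<longlongrightarrow> 0) (at_right 0)" for r
    using c' g by real_asymp
  have l4: "((\<lambda>\<epsilon>::real. a / C\<^sup>2 * (\<epsilon> powr (- (2 - g)) * exp (- c' * \<epsilon> powr (- g)))
      + b' / C\<^sup>2 * (\<epsilon> powr (- (2 - g + g)) * exp (- c' * \<epsilon> powr (- g)))) \<longlongrightarrow> a / C\<^sup>2 * 0 + b' / C\<^sup>2 * 0) (at_right 0)"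
    by (intro tendsto_add tendsto_mult tendsto_const E)
  then have l4: "((\<lambda>\<epsilon>::real. a / C\<^sup>2 * (\<epsilon> powr (- (2 - g)) * exp (- c' * \<epsilon> powr (- g)))
      + b' / C\<^sup>2 * (\<epsilon> powr (- (2 - g + g)) * exp (- c' * \<epsilon> powr (- g)))) \<longlongrightarrow> 0) (at_right 0)" by simp
  show "((\<lambda>\<epsilon>. (a + b / level \<epsilon> powr (1 / \<beta>)) * exp (- c * ((level \<epsilon>)\<^sup>2 / \<epsilon>\<^sup>2)) / (level \<epsilon>)\<^sup>2) \<longlongrightarrow> 0) (at_right 0)"
  proof (rule Lim_transform_eventually[OF l4], use pos in eventually_elim)
    fix \<epsilon> :: real assume \<epsilon>: "\<epsilon> > 0"
    have "level \<epsilon> powr (1 / \<beta>) = C powr (1 / \<beta>) * (\<epsilon> powr (\<beta> * g)) powr (1 / \<beta>)"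
      unfolding lev[OF \<epsilon>] using C by (simp add: powr_mult)
    also have "(\<epsilon> powr (\<beta> * g)) powr (1 / \<beta>) = \<epsilon> powr g" unfolding powr_powr using \<beta>_pos by simp
    finally have 1: "b / level \<epsilon> powr (1 / \<beta>) = b' * \<epsilon> powr (- g)" by (simp add: b'_def powr_minus divide_inverse)
    have "(level \<epsilon>)\<^sup>2 / \<epsilon>\<^sup>2 = C\<^sup>2 * \<epsilon> powr (- g)"
    proof -
      have "(level \<epsilon>)\<^sup>2 / \<epsilon>\<^sup>2 = 1 / (\<epsilon>\<^sup>2 / (level \<epsilon>)\<^sup>2)" by simp
      also have "\<dots> = C\<^sup>2 * \<epsilon> powr (- g)" unfolding ratio[OF \<epsilon>] by (simp add: powr_minus divide_inverse)
      finally show ?thesis .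
    qed
    then have 2: "exp (- c * ((level \<epsilon>)\<^sup>2 / \<epsilon>\<^sup>2)) = exp (- c' * \<epsilon> powr (- g))" by (simp add: c'_def)
    have 3: "x / (level \<epsilon>)\<^sup>2 = x / C\<^sup>2 * \<epsilon> powr (- (2 - g))" for x
      unfolding lev2[OF \<epsilon>] powr_minus[of \<epsilon> "2 - g"] by (simp add: divide_inverse)
    show "a / C\<^sup>2 * (\<epsilon> powr (- (2 - g)) * exp (- c' * \<epsilon> powr (- g)))
      + b' / C\<^sup>2 * (\<epsilon> powr (- (2 - g + g)) * exp (- c' * \<epsilon> powr (- g)))
      = (a + b / level \<epsilon> powr (1 / \<beta>)) * exp (- c * ((level \<epsilon>)\<^sup>2 / \<epsilon>\<^sup>2)) / (level \<epsilon>)\<^sup>2"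
    proof -
      have "\<epsilon> powr (- (2 - g + g)) = \<epsilon> powr (- g) * \<epsilon> powr (- (2 - g))" by (simp add: powr_add[symmetric])
      then show ?thesis unfolding 1 2 3 by (simp add: algebra_simps add_divide_distrib)
    qed
  qed
qed

lemma max_risk_bem_upper:
  assumes \<eta>: "\<eta> > 0"
  shows "\<forall>\<^sub>F \<epsilon> in at_right 0. max_risk \<beta> Q \<epsilon> (bem \<epsilon>) \<le> ennreal ((1 + \<eta>) * ((2 * \<beta> + 1) * (level \<epsilon>)\<^sup>2))"
proof -
  define D where "D = Max (range d)"
  have D: "d k \<le> D" for k unfolding D_def by simp
  define L where "L = (\<lambda>\<epsilon>::real. ln (1 / \<epsilon>))"
  let ?P = "real CARD('p) + 1"
  define R where "R = (\<lambda>\<epsilon>. 1 + 2 * \<beta> * ((L \<epsilon> + 1) / (L \<epsilon> - 1)) + D\<^sup>2 * ((2 * \<epsilon>\<^sup>2) powr (2 * \<beta>) / (level \<epsilon>)\<^sup>2)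
     + tr_Q * (\<epsilon>\<^sup>2 * (L \<epsilon>)\<^sup>2 / (level \<epsilon>)\<^sup>2 + \<epsilon>\<^sup>2 / (level \<epsilon>)\<^sup>2)
     + 2 * ?P * tr_Q * (\<epsilon>\<^sup>2 / (level \<epsilon>)\<^sup>2 + 4 * (\<epsilon>\<^sup>2 * (L \<epsilon>)\<^sup>2 / (level \<epsilon>)\<^sup>2)))"
  have l: "((\<lambda>\<epsilon>. (L \<epsilon> + 1) / (L \<epsilon> - 1)) \<longlongrightarrow> 1) (at_right 0)" unfolding L_def by real_asymp
  have "(R \<longlongrightarrow> 1 + 2 * \<beta> * 1 + D\<^sup>2 * 0 + tr_Q * (0 + 0) + 2 * ?P * tr_Q * (0 + 4 * 0)) (at_right 0)"
    unfolding R_def using level_limits(1-3) l by (intro tendsto_intros) (simp_all add: L_def)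
  then have "(R \<longlongrightarrow> 2 * \<beta> + 1) (at_right 0)" by (simp add: add.commute)
  moreover have "2 * \<beta> + 1 < (1 + \<eta>) * (2 * \<beta> + 1)" using \<eta> \<beta>_pos by simp
  ultimately have "\<forall>\<^sub>F \<epsilon> in at_right 0. R \<epsilon> < (1 + \<eta>) * (2 * \<beta> + 1)" by (rule order_tendstoD(2))
  moreover have "\<forall>\<^sub>F \<epsilon> in at_right 0. 2 < L \<epsilon>" unfolding L_def by real_asymp
  moreover have "\<forall>\<^sub>F \<epsilon> in at_right 0. (\<epsilon>::real) > 0" by (simp add: eventually_at_right_less)
  ultimately show ?thesis
  proof eventually_elim
    case (elim \<epsilon>)
    let ?\<kappa> = "level \<epsilon>" and ?L = "L \<epsilon>"
    have \<kappa>: "?\<kappa> > 0" by (rule level_pos[OF elim(3)])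
    have "max_risk \<beta> Q \<epsilon> (bem \<epsilon>) \<le> ennreal (?\<kappa>\<^sup>2 * R \<epsilon>)"
      unfolding max_risk_def
    proof (rule SUP_least)
      fix \<theta> assume "\<theta> \<in> sobolev_ellipsoid \<beta> Q"
      from bem_risk_le[OF this elim(3) L_def[THEN fun_cong] elim(2) \<kappa> \<beta>_pos D]
      have "risk Q \<epsilon> \<theta> (bem \<epsilon>) \<le> ennreal (?\<kappa>\<^sup>2 + D\<^sup>2 * (2 * \<epsilon>\<^sup>2) powr (2 * \<beta>)
         + \<epsilon>\<^sup>2 * (\<Sum>k\<in>UNIV. d k * (?L + 1 + cutoff \<epsilon> k * ((?L + 1) / (?L - 1)) * (2 * \<beta>\<^sup>2 / ((\<beta> + 1) * (2 * \<beta> + 1)))))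
         + 2 * ?P * \<epsilon>\<^sup>2 * (1 + 4 * ?L\<^sup>2) * tr_Q)"
        by (simp add: cutoff_def tr_Q_def)
      also have "\<dots> \<le> ennreal (?\<kappa>\<^sup>2 * R \<epsilon>)"
      proof (rule ennreal_leI)
        let ?I2 = "2 * \<beta>\<^sup>2 / ((\<beta> + 1) * (2 * \<beta> + 1))" and ?r = "(?L + 1) / (?L - 1)"
        have "\<epsilon>\<^sup>2 * (\<Sum>k\<in>UNIV. d k * (?L + 1 + cutoff \<epsilon> k * ?r * ?I2))
           = \<epsilon>\<^sup>2 * (tr_Q * (?L + 1)) + (\<epsilon>\<^sup>2 * (\<Sum>k\<in>UNIV. d k * cutoff \<epsilon> k)) * (?r * ?I2)"
        proof -
          have *: "(\<Sum>k\<in>UNIV. d k * (X + cutoff \<epsilon> k * r * I)) = tr_Q * X + (\<Sum>k\<in>UNIV. d k * cutoff \<epsilon> k) * (r * I)" for X r I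
            by (simp add: tr_Q_def distrib_left sum.distrib sum_distrib_right mult.assoc)
          show ?thesis unfolding * by (simp only: distrib_left[of "\<epsilon>\<^sup>2"] mult.assoc)
        qed
        also have "(\<epsilon>\<^sup>2 * (\<Sum>k\<in>UNIV. d k * cutoff \<epsilon> k)) * (?r * ?I2) = ?\<kappa>\<^sup>2 * (2 * \<beta> * ?r)"
        proof -
          have "(\<beta> + 1) * (2 * \<beta> + 1) / \<beta> * ?I2 = 2 * \<beta>"
          proof -
            have *: "P / \<beta> * (2 * \<beta>\<^sup>2 / P) = 2 * \<beta>" if "P \<noteq> 0" for P using that \<beta>_pos by (simp add: power2_eq_square)
            show ?thesis by (rule *) (use \<beta>_pos in simp)
          qed
          moreover have "K * M * (r * I) = K * (M * I * r)" for K M r I :: real by (simp only: mult_ac)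
          ultimately show ?thesis unfolding level_equation[OF elim(3)] by (simp only:)
        qed
        also have "\<epsilon>\<^sup>2 * (tr_Q * (?L + 1)) \<le> \<epsilon>\<^sup>2 * (tr_Q * (?L\<^sup>2 + 1))"
          using tr_Q_pos elim(2) by (intro mult_left_mono add_right_mono) (auto simp: power2_eq_square)
        finally have 1: "\<epsilon>\<^sup>2 * (\<Sum>k\<in>UNIV. d k * (?L + 1 + cutoff \<epsilon> k * ?r * ?I2))
           \<le> \<epsilon>\<^sup>2 * (tr_Q * (?L\<^sup>2 + 1)) + ?\<kappa>\<^sup>2 * (2 * \<beta> * ?r)" by simp
        have 2: "?\<kappa>\<^sup>2 * R \<epsilon> = ?\<kappa>\<^sup>2 + ?\<kappa>\<^sup>2 * (2 * \<beta> * ?r) + D\<^sup>2 * (2 * \<epsilon>\<^sup>2) powr (2 * \<beta>) + \<epsilon>\<^sup>2 * (tr_Q * (?L\<^sup>2 + 1))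
           + 2 * ?P * \<epsilon>\<^sup>2 * (1 + 4 * ?L\<^sup>2) * tr_Q"
        proof -
          define K where "K = ?\<kappa>\<^sup>2"
          have "K \<noteq> 0" using \<kappa> by (simp add: K_def)
          then show ?thesis unfolding R_def K_def[symmetric] by (simp add: field_simps)
        qed
        show "?\<kappa>\<^sup>2 + D\<^sup>2 * (2 * \<epsilon>\<^sup>2) powr (2 * \<beta>)
         + \<epsilon>\<^sup>2 * (\<Sum>k\<in>UNIV. d k * (?L + 1 + cutoff \<epsilon> k * ?r * ?I2))
         + 2 * ?P * \<epsilon>\<^sup>2 * (1 + 4 * ?L\<^sup>2) * tr_Q \<le> ?\<kappa>\<^sup>2 * R \<epsilon>"
          unfolding 2 using 1 by linarith
      qed
      finally show "risk Q \<epsilon> \<theta> (bem \<epsilon>) \<le> ennreal (?\<kappa>\<^sup>2 * R \<epsilon>)" .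
    qed
    also have "\<dots> \<le> ennreal ((1 + \<eta>) * ((2 * \<beta> + 1) * ?\<kappa>\<^sup>2))"
    proof (rule ennreal_leI)
      have "?\<kappa>\<^sup>2 * R \<epsilon> \<le> ?\<kappa>\<^sup>2 * ((1 + \<eta>) * (2 * \<beta> + 1))" using elim(1) by (intro mult_left_mono) auto
      then show "?\<kappa>\<^sup>2 * R \<epsilon> \<le> (1 + \<eta>) * ((2 * \<beta> + 1) * ?\<kappa>\<^sup>2)" by (simp add: mult_ac)
    qed
    finally show ?case .
  qed
qed

end

section \<open>Pinsker's prior and the asymptotic lower bound\<close>

context pinsker_problem
begin

text \<open>The least favourable variances are \<open>\<epsilon>\<^sup>2 (1 / y - 1)\<close> with \<open>y = \<kappa> a / d\<close>, on the coordinates with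
\<open>y < 1\<close>. For them the Bayes risks are \<open>\<epsilon>\<^sup>2 W\<close> with the Pinsker weights \<open>W = 1 - y\<close>, and the expectation of the
ellipsoid's form is \<open>(\<epsilon>\<^sup>2 / \<kappa>\<^sup>2) \<Sum> d (W - W\<^sup>2)\<close>, which is 1 up to rounding. The factor \<open>1 - h\<close> makes room for
fluctuations. Time 1 carries no constraint and is left out of the prior.\<close>

lemma pinsker_prior_bound:
  fixes \<epsilon> h D :: real
  assumes \<epsilon>: "\<epsilon> > 0" and h: "0 < h" "h < 1" and D: "\<And>k. d k \<le> D"
    and small1: "8 * D * (\<epsilon>\<^sup>2 / (level \<epsilon>)\<^sup>2) \<le> h" and small2: "8 * tr_Q * (\<epsilon>\<^sup>2 / (level \<epsilon>)\<^sup>2) \<le> h"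
    and \<delta>: "\<delta> \<in> estimators"
  shows "ennreal ((1 - h) * ((2 * \<beta> + 1) * (level \<epsilon>)\<^sup>2 - 2 * tr_Q * \<epsilon>\<^sup>2)) \<le> max_risk \<beta> Q \<epsilon> \<delta>
    + ennreal ((2 * D\<^sup>2 * (real CARD('p) + 1) + 2 * D\<^sup>2 * real CARD('p) * D powr (1 / \<beta>) / level \<epsilon> powr (1 / \<beta>))
        * exp (- (h\<^sup>2 / (32 * D)) * ((level \<epsilon>)\<^sup>2 / \<epsilon>\<^sup>2)))"
proof -
  define \<kappa> where "\<kappa> = level \<epsilon>"
  define q where "q = \<epsilon>\<^sup>2 / \<kappa>\<^sup>2"
  define a where "a = (\<lambda>j::nat \<times> 'p. sobolev_weight \<beta> (fst j))"
  define y where "y = (\<lambda>j. \<kappa> * a j / d (snd j))"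
  define W where "W = (\<lambda>j. max 0 (1 - y j))"
  define F where "F = {j. 2 \<le> fst j \<and> \<kappa> * a j < d (snd j)}"
  define s where "s = (\<lambda>j. sqrt ((1 - h) * \<epsilon>\<^sup>2 * (1 / y j - 1)))"
  define H where "H = (D / \<kappa>) powr (1 / \<beta>)"
  define m where "m = nat \<lceil>H\<rceil>"
  define \<tau> where "\<tau> = (\<lambda>j. (sobolev_weight \<beta> (fst j))\<^sup>2 * (s j)\<^sup>2 / d (snd j))"
  (* D q bounds the weights \<tau>; with this t the quadratic terms of the Chernoff exponent cost at most
     the factor 1 + h / 2, which the factor 1 - h in the prior variances outweighs. *)
  define t where "t = h / (8 * (D * q))"
  let ?I1 = "\<beta> / (\<beta> + 1)" and ?I2 = "2 * \<beta>\<^sup>2 / ((\<beta> + 1) * (2 * \<beta> + 1))" and ?M = "(\<beta> + 1) * (2 * \<beta> + 1) / \<beta>"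
  have \<kappa>: "\<kappa> > 0" unfolding \<kappa>_def by (rule level_pos[OF \<epsilon>])
  have D0: "D > 0" using d_pos D by (meson less_le_trans)
  have q: "q > 0" unfolding q_def using \<epsilon> \<kappa> by simp
  have Dq: "D * q > 0" using D0 q by simp
  have d0: "d k \<ge> 0" for k using d_pos[of k] by simp
  have cut: "cutoff \<epsilon> k > 0" for k by (rule cutoff_pos[OF \<epsilon>])
  have cut_pow: "(x / cutoff \<epsilon> k) powr \<beta> = \<kappa> * x powr \<beta> / d k" if "x \<ge> 0" for x k
  proof -
    have "cutoff \<epsilon> k powr \<beta> = d k / \<kappa>"
      unfolding cutoff_def \<kappa>_def[symmetric] powr_powr using \<beta>_pos d_pos[of k] \<kappa> by simp
    then show ?thesis using that cut[of k] by (simp add: powr_divide mult.commute)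
  qed
  have ym: "(real (fst j) - 1) powr \<beta> * \<kappa> / d (snd j) \<le> y j" "y j \<le> real (fst j) powr \<beta> * \<kappa> / d (snd j)"
    if "2 \<le> fst j" for j
    unfolding y_def a_def mult.commute[of \<kappa>] using sobolev_weight_bounds[OF \<beta>_pos, of "fst j"] that \<kappa> d0
    by (auto intro!: divide_right_mono mult_right_mono)
  have W_up: "W j \<le> pinsker_weight \<beta> ((real (fst j) - 1) / cutoff \<epsilon> (snd j))" if "2 \<le> fst j" for j
    using ym(1)[OF that] that cut_pow[of "real (fst j) - 1" "snd j"] by (simp add: W_def pinsker_weight_def mult.commute)
  have W_lo: "pinsker_weight \<beta> (real (fst j) / cutoff \<epsilon> (snd j)) \<le> W j" if "2 \<le> fst j" for j
    using ym(2)[OF that] that cut_pow[of "real (fst j)" "snd j"] by (simp add: W_def pinsker_weight_def mult.commute)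
  have a1: "a j > 0" if "2 \<le> fst j" for j
  proof -
    have "0 < (real (fst j) - 1) powr \<beta>" using that by simp
    also have "\<dots> \<le> a j" unfolding a_def using that by (intro sobolev_weight_bounds[OF \<beta>_pos]) simp
    finally show ?thesis .
  qed
  have y01: "0 < y j" "y j < 1" "W j = 1 - y j" if "j \<in> F" for j
  proof -
    have "2 \<le> fst j" "\<kappa> * a j < d (snd j)" using that by (auto simp: F_def)
    then show "0 < y j" "y j < 1" using a1 \<kappa> d_pos[of "snd j"] by (simp_all add: y_def)
    then show "W j = 1 - y j" by (simp add: W_def)
  qed
  have W0: "W j = 0" if "2 \<le> fst j" "j \<notin> F" for j
  proof -
    have "d (snd j) \<le> \<kappa> * a j" using that by (auto simp: F_def)
    then have "1 \<le> y j" using d_pos[of "snd j"] by (simp add: y_def pos_le_divide_eq)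
    then show ?thesis by (simp add: W_def)
  qed
  have Hm: "H \<le> real m" "real m \<le> H + 1"
  proof -
    have "0 \<le> H" by (simp add: H_def)
    then show "H \<le> real m" "real m \<le> H + 1" unfolding m_def by linarith+
  qed
  have cutH: "cutoff \<epsilon> k \<le> H" for k
    unfolding cutoff_def H_def \<kappa>_def[symmetric] using \<beta>_pos D \<kappa> d0
    by (intro powr_mono2 divide_right_mono) auto
  have F_sub: "F \<subseteq> {2..Suc m} \<times> UNIV"
  proof
    fix j assume j: "j \<in> F"
    have j2: "2 \<le> fst j" and lt: "\<kappa> * a j < d (snd j)" using j by (auto simp: F_def)
    have "\<kappa> * (real (fst j) - 1) powr \<beta> \<le> \<kappa> * a j"
      unfolding a_def using \<kappa> j2 by (intro mult_left_mono sobolev_weight_bounds[OF \<beta>_pos]) auto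
    then have "\<kappa> * (real (fst j) - 1) powr \<beta> < D" using lt D[of "snd j"] by linarith
    then have "(real (fst j) - 1) powr \<beta> < D / \<kappa>" using \<kappa> by (simp add: pos_less_divide_eq mult.commute)
    then have "((real (fst j) - 1) powr \<beta>) powr (1 / \<beta>) < H"
      unfolding H_def using \<beta>_pos by (intro powr_less_mono2) auto
    then have "real (fst j) - 1 < H" using \<beta>_pos j2 by (simp add: powr_powr)
    then have "real (fst j) - 1 < real m" using Hm by linarith
    then have "fst j \<le> Suc m" by linarith
    then show "j \<in> {2..Suc m} \<times> UNIV" using j2 by (cases j) auto
  qed
  have finF: "finite F" by (rule finite_subset[OF F_sub]) simp
  have cardF: "real (card F) \<le> real CARD('p) * (H + 1)"
  proof -
    have "card F \<le> card ({2..Suc m} \<times> (UNIV :: 'p set))" by (rule card_mono[OF _ F_sub]) simp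
    also have "\<dots> = m * CARD('p)" by (simp add: card_cartesian_product)
    finally have "real (card F) \<le> real m * real CARD('p)" by (simp flip: of_nat_mult)
    also have "\<dots> \<le> (H + 1) * real CARD('p)" using Hm by (intro mult_right_mono) auto
    finally show ?thesis by (simp add: mult.commute)
  qed
  have sumF: "(\<Sum>j\<in>F. d (snd j) * g (W j)) = (\<Sum>k\<in>UNIV. d k * (\<Sum>i=2..Suc m. g (W (i, k))))" if g0: "g 0 = 0" for g :: "real \<Rightarrow> real"
  proof -
    have "(\<Sum>j\<in>F. d (snd j) * g (W j)) = (\<Sum>j\<in>{2..Suc m} \<times> UNIV. d (snd j) * g (W j))"
      by (rule sum.mono_neutral_left[OF _ F_sub]) (auto simp: W0 g0)
    also have "\<dots> = (\<Sum>i=2..Suc m. \<Sum>k\<in>UNIV. d k * g (W (i, k)))"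
      unfolding sum.cartesian_product by (rule sum.cong) auto
    finally show ?thesis by (subst (asm) sum.swap) (simp only: sum_distrib_left)
  qed
  (* Dropping time 1 and the rounding in the sums cost at most 1 each, whence the constants 2 below. *)
  have split2: "(\<Sum>i=2..Suc m. f i) = (\<Sum>i=1..Suc m. f i) - f 1" for f :: "nat \<Rightarrow> real"
    using sum.atLeast_Suc_atMost[of 1 "Suc m" f] by (simp add: numeral_2_eq_2 del: sum.cl_ivl_Suc)
  have lo1: "cutoff \<epsilon> k * ?I1 - 2 \<le> (\<Sum>i=2..Suc m. W (i, k))" for k
  proof -
    have "cutoff \<epsilon> k * ?I1 - 1 \<le> (\<Sum>i=1..Suc m. pinsker_weight \<beta> (real i / cutoff \<epsilon> k))"
      using cutH[of k] Hm by (intro pinsker_weight_sum1(2)[OF \<beta>_pos cut]) simp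
    moreover have "pinsker_weight \<beta> (real 1 / cutoff \<epsilon> k) \<le> 1" by (rule pinsker_weight_bounds)
    moreover have "(\<Sum>i=2..Suc m. pinsker_weight \<beta> (real i / cutoff \<epsilon> k)) \<le> (\<Sum>i=2..Suc m. W (i, k))"
      using W_lo[of "(_, k)"] by (intro sum_mono) simp
    ultimately show ?thesis using split2[of "\<lambda>i. pinsker_weight \<beta> (real i / cutoff \<epsilon> k)"] by linarith
  qed
  have up: "(\<Sum>i=2..Suc m. W (i, k) - (W (i, k))\<^sup>2) \<le> cutoff \<epsilon> k * (?I1 - ?I2) + 2" for k
  proof -
    have "(\<Sum>i=2..Suc m. W (i, k)) \<le> (\<Sum>i=2..Suc m. pinsker_weight \<beta> ((real i - 1) / cutoff \<epsilon> k))"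
      using W_up[of "(_, k)"] by (intro sum_mono) simp
    also have "\<dots> = (\<Sum>i=1..m. pinsker_weight \<beta> (real i / cutoff \<epsilon> k))"
      using sum.shift_bounds_cl_Suc_ivl[of "\<lambda>i. pinsker_weight \<beta> ((real i - 1) / cutoff \<epsilon> k)" 1 m]
      by (simp add: numeral_2_eq_2)
    also have "\<dots> \<le> cutoff \<epsilon> k * ?I1" by (rule pinsker_weight_sum1(1)[OF \<beta>_pos cut])
    finally have 1: "(\<Sum>i=2..Suc m. W (i, k)) \<le> cutoff \<epsilon> k * ?I1" .
    have "cutoff \<epsilon> k * ?I2 - 1 \<le> (\<Sum>i=1..Suc m. (pinsker_weight \<beta> (real i / cutoff \<epsilon> k))\<^sup>2)"
      using cutH[of k] Hm by (intro pinsker_weight_sum2(2)[OF \<beta>_pos cut]) simp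
    moreover have "(pinsker_weight \<beta> (real 1 / cutoff \<epsilon> k))\<^sup>2 \<le> 1"
      by (intro power_le_one pinsker_weight_bounds)
    moreover have "(\<Sum>i=2..Suc m. (pinsker_weight \<beta> (real i / cutoff \<epsilon> k))\<^sup>2) \<le> (\<Sum>i=2..Suc m. (W (i, k))\<^sup>2)"
      using W_lo[of "(_, k)"] by (intro sum_mono power_mono pinsker_weight_bounds) simp
    ultimately have 2: "cutoff \<epsilon> k * ?I2 - 2 \<le> (\<Sum>i=2..Suc m. (W (i, k))\<^sup>2)"
      using split2[of "\<lambda>i. (pinsker_weight \<beta> (real i / cutoff \<epsilon> k))\<^sup>2"] by linarith
    show ?thesis using 1 2 by (simp add: sum_subtractf right_diff_distrib)
  qed
  have b1: "?M * ?I1 = 2 * \<beta> + 1" and b2: "?M * (?I1 - ?I2) = 1"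
  proof -
    have M1: "?M * ?I1 = 2 * \<beta> + 1" using \<beta>_pos by simp
    have *: "P / \<beta> * (2 * \<beta>\<^sup>2 / P) = 2 * \<beta>" if "P \<noteq> 0" for P using that \<beta>_pos by (simp add: power2_eq_square)
    have "?M * ?I2 = 2 * \<beta>" by (rule *) (use \<beta>_pos in simp)
    then show "?M * ?I1 = 2 * \<beta> + 1" "?M * (?I1 - ?I2) = 1" unfolding right_diff_distrib M1 by simp_all
  qed
  have lev: "\<epsilon>\<^sup>2 * (\<Sum>k\<in>UNIV. d k * cutoff \<epsilon> k) = \<kappa>\<^sup>2 * ?M" unfolding \<kappa>_def by (rule level_equation[OF \<epsilon>])
  have s2: "(s j)\<^sup>2 = (1 - h) * \<epsilon>\<^sup>2 * (1 / y j - 1)" if "j \<in> F" for j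
    unfolding s_def using y01[OF that] h by simp
  have s_pos: "s j > 0" if "j \<in> F" for j
    unfolding s_def using y01[OF that] h \<epsilon> by simp
  have \<tau>_eq: "\<tau> j = (1 - h) * q * (d (snd j) * (W j - (W j)\<^sup>2))" if j: "j \<in> F" for j
  proof -
    have aj: "a j = y j * d (snd j) / \<kappa>" using \<kappa> d_pos[of "snd j"] by (simp add: y_def)
    have "\<tau> j = (y j * d (snd j) / \<kappa>)\<^sup>2 * ((1 - h) * \<epsilon>\<^sup>2 * (1 / y j - 1)) / d (snd j)"
      unfolding \<tau>_def s2[OF j] aj[symmetric] by (simp add: a_def)
    also have "\<dots> = (1 - h) * q * (d (snd j) * (y j * y j * (1 / y j - 1)))"
      using d_pos[of "snd j"] by (simp add: q_def power2_eq_square)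
    also have "y j * y j * (1 / y j - 1) = W j - (W j)\<^sup>2"
      unfolding y01(3)[OF j] using y01(1)[OF j] by (simp add: power2_eq_square algebra_simps)
    finally show ?thesis .
  qed
  have \<tau>_le: "0 \<le> \<tau> j" "\<tau> j \<le> D * q" if j: "j \<in> F" for j
  proof -
    show "0 \<le> \<tau> j" using d0 by (simp add: \<tau>_def)
    have "W j - (W j)\<^sup>2 \<le> 1" "0 \<le> W j - (W j)\<^sup>2"
    proof -
      have "0 \<le> W j" "W j \<le> 1" using y01[OF j] by auto
      then show "0 \<le> W j - (W j)\<^sup>2" using mult_left_mono[of "W j" 1 "W j"] by (simp add: power2_eq_square)
      show "W j - (W j)\<^sup>2 \<le> 1" using \<open>W j \<le> 1\<close> zero_le_power2[of "W j"] by linarith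
    qed
    then have "(1 - h) * q * (d (snd j) * (W j - (W j)\<^sup>2)) \<le> 1 * q * (D * 1)"
      using h q D D0 d0 by (intro mult_mono) auto
    then show "\<tau> j \<le> D * q" unfolding \<tau>_eq[OF j] by (simp add: mult.commute)
  qed
  have tDq: "t * (D * q) = h / 8" unfolding t_def using D0 q by simp
  have t1: "t \<ge> 1"
  proof -
    have "8 * (D * q) \<le> h" using small1 by (simp add: q_def \<kappa>_def)
    then show ?thesis unfolding t_def using Dq by (simp add: pos_le_divide_eq)
  qed
  have t\<tau>: "t * \<tau> j \<le> h / 8" if "j \<in> F" for j
    unfolding tDq[symmetric] using \<tau>_le(2)[OF that] t1 by (intro mult_left_mono) auto
  have sum\<tau>: "(\<Sum>j\<in>F. \<tau> j) \<le> (1 - h) * (1 + 2 * tr_Q * q)"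
  proof -
    have "(\<Sum>j\<in>F. \<tau> j) = (1 - h) * q * (\<Sum>j\<in>F. d (snd j) * (W j - (W j)\<^sup>2))"
      by (simp add: \<tau>_eq sum_distrib_left)
    also have "\<dots> = (1 - h) * q * (\<Sum>k\<in>UNIV. d k * (\<Sum>i=2..Suc m. W (i, k) - (W (i, k))\<^sup>2))"
      by (subst sumF[of "\<lambda>w. w - w\<^sup>2"]) simp_all
    also have "\<dots> \<le> (1 - h) * q * (\<Sum>k\<in>UNIV. d k * (cutoff \<epsilon> k * (?I1 - ?I2) + 2))"
      using h q by (intro mult_left_mono sum_mono up d0) auto
    also have "\<dots> = (1 - h) * (1 + 2 * tr_Q * q)"
    proof -
      have "(\<Sum>k\<in>UNIV. d k * (cutoff \<epsilon> k * x + 2)) = (\<Sum>k\<in>UNIV. d k * cutoff \<epsilon> k) * x + 2 * tr_Q" for x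
        by (simp add: tr_Q_def distrib_left sum.distrib sum_distrib_right sum_distrib_left mult.assoc mult.commute[of 2])
      then have "q * (\<Sum>k\<in>UNIV. d k * (cutoff \<epsilon> k * (?I1 - ?I2) + 2))
          = q * ((\<Sum>k\<in>UNIV. d k * cutoff \<epsilon> k) * (?I1 - ?I2)) + 2 * tr_Q * q"
        by (simp only: distrib_left[of q] mult.commute[of q "2 * tr_Q"])
      also have "q * ((\<Sum>k\<in>UNIV. d k * cutoff \<epsilon> k) * (?I1 - ?I2)) = (\<epsilon>\<^sup>2 * (\<Sum>k\<in>UNIV. d k * cutoff \<epsilon> k)) / \<kappa>\<^sup>2 * (?I1 - ?I2)"
        by (simp add: q_def)
      also have "\<dots> = 1" unfolding lev using \<kappa> b2 by simp
      finally show ?thesis by (simp only: mult.assoc[of "1 - h" q])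
    qed
    finally show ?thesis .
  qed
  have expo: "- t + (\<Sum>j\<in>F. t * \<tau> j + 4 * (t * \<tau> j)\<^sup>2) \<le> - (h\<^sup>2 / (32 * D)) * (\<kappa>\<^sup>2 / \<epsilon>\<^sup>2)"
  proof -
    have "(\<Sum>j\<in>F. t * \<tau> j + 4 * (t * \<tau> j)\<^sup>2) \<le> (\<Sum>j\<in>F. t * ((1 + h / 2) * \<tau> j))"
    proof (rule sum_mono)
      fix j assume j: "j \<in> F"
      have "(t * \<tau> j)\<^sup>2 \<le> h / 8 * (t * \<tau> j)"
        unfolding power2_eq_square using t\<tau>[OF j] \<tau>_le(1)[OF j] t1 by (intro mult_right_mono) auto
      then show "t * \<tau> j + 4 * (t * \<tau> j)\<^sup>2 \<le> t * ((1 + h / 2) * \<tau> j)" by (simp add: algebra_simps)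
    qed
    also have "\<dots> = t * ((1 + h / 2) * (\<Sum>j\<in>F. \<tau> j))" by (simp add: sum_distrib_left)
    also have "\<dots> \<le> t * ((1 + h / 2) * ((1 - h) * (1 + 2 * tr_Q * q)))"
      using t1 h sum\<tau> by (intro mult_left_mono) auto
    also have "\<dots> \<le> t * (1 - h / 4)"
    proof (rule mult_left_mono)
      have "2 * tr_Q * q \<le> h / 4" using small2 by (simp add: q_def \<kappa>_def)
      then have "(1 + h / 2) * ((1 - h) * (1 + 2 * tr_Q * q)) \<le> (1 + h / 2) * ((1 - h) * (1 + h / 4))"
        using h by (intro mult_left_mono) auto
      also have "\<dots> \<le> 1 - h / 4"
      proof -
        have "(1 + h / 2) * ((1 - h) * (1 + h / 4)) = 1 - h / 4 - h * h * (5 / 8) - h * h * h / 8"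
          by (simp add: field_simps)
        moreover have "0 \<le> h * h" "0 \<le> h * h * h" using h by auto
        ultimately show ?thesis by linarith
      qed
      finally show "(1 + h / 2) * ((1 - h) * (1 + 2 * tr_Q * q)) \<le> 1 - h / 4" .
    qed (use t1 in simp)
    finally have "- t + (\<Sum>j\<in>F. t * \<tau> j + 4 * (t * \<tau> j)\<^sup>2) \<le> - (t * h / 4)" by (simp add: algebra_simps)
    also have "t * h / 4 = (h\<^sup>2 / (32 * D)) * (\<kappa>\<^sup>2 / \<epsilon>\<^sup>2)"
      unfolding t_def q_def by (simp add: power2_eq_square mult_ac)
    finally show ?thesis by simp
  qed
  have bayes: "(1 - h) * ((2 * \<beta> + 1) * \<kappa>\<^sup>2 - 2 * tr_Q * \<epsilon>\<^sup>2) \<le> (\<Sum>j\<in>F. d (snd j) * ((s j)\<^sup>2 * \<epsilon>\<^sup>2 / ((s j)\<^sup>2 + \<epsilon>\<^sup>2)))"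
  proof -
    have "(1 - h) * ((2 * \<beta> + 1) * \<kappa>\<^sup>2 - 2 * tr_Q * \<epsilon>\<^sup>2) = (1 - h) * (\<epsilon>\<^sup>2 * (\<Sum>k\<in>UNIV. d k * (cutoff \<epsilon> k * ?I1 - 2)))"
    proof -
      have "(\<Sum>k\<in>UNIV. d k * (cutoff \<epsilon> k * x - 2)) = (\<Sum>k\<in>UNIV. d k * cutoff \<epsilon> k) * x - 2 * tr_Q" for x
        by (simp add: tr_Q_def right_diff_distrib sum_subtractf sum_distrib_right sum_distrib_left mult.assoc mult.commute[of 2])
      then have "\<epsilon>\<^sup>2 * (\<Sum>k\<in>UNIV. d k * (cutoff \<epsilon> k * ?I1 - 2)) = \<epsilon>\<^sup>2 * (\<Sum>k\<in>UNIV. d k * cutoff \<epsilon> k) * ?I1 - \<epsilon>\<^sup>2 * (2 * tr_Q)"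
        by (simp only: right_diff_distrib[of "\<epsilon>\<^sup>2"] mult.assoc)
      also have "\<dots> = \<kappa>\<^sup>2 * (?M * ?I1) - \<epsilon>\<^sup>2 * (2 * tr_Q)" unfolding lev by (simp only: mult.assoc)
      finally show ?thesis unfolding b1 by (simp add: mult_ac)
    qed
    also have "\<dots> \<le> (1 - h) * (\<epsilon>\<^sup>2 * (\<Sum>k\<in>UNIV. d k * (\<Sum>i=2..Suc m. W (i, k))))"
      using h by (intro mult_left_mono sum_mono lo1 d0) auto
    also have "\<dots> = (1 - h) * (\<epsilon>\<^sup>2 * (\<Sum>j\<in>F. d (snd j) * W j))" by (subst sumF[of "\<lambda>w. w"]) simp_all
    also have "\<dots> = (\<Sum>j\<in>F. d (snd j) * ((1 - h) * \<epsilon>\<^sup>2 * W j))" by (simp add: sum_distrib_left mult_ac)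
    also have "\<dots> \<le> (\<Sum>j\<in>F. d (snd j) * ((s j)\<^sup>2 * \<epsilon>\<^sup>2 / ((s j)\<^sup>2 + \<epsilon>\<^sup>2)))"
    proof (intro sum_mono mult_left_mono d0)
      fix j assume j: "j \<in> F"
      define v where "v = 1 / y j - 1"
      have v: "v > 0" unfolding v_def using y01[OF j] by simp
      have Wv: "W j = v / (v + 1)" unfolding v_def y01(3)[OF j] using y01[OF j] by (simp add: field_simps)
      have pos: "(1 - h) * v + 1 > 0" using h v by (intro add_nonneg_pos) auto
      have "v / (v + 1) \<le> v / ((1 - h) * v + 1)"
        using v h pos by (intro divide_left_mono) auto
      then have "(1 - h) * \<epsilon>\<^sup>2 * W j \<le> (1 - h) * \<epsilon>\<^sup>2 * (v / ((1 - h) * v + 1))"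
        unfolding Wv using h by (intro mult_left_mono) auto
      also have "\<dots> = (s j)\<^sup>2 * \<epsilon>\<^sup>2 / ((s j)\<^sup>2 + \<epsilon>\<^sup>2)"
      proof -
        have "(s j)\<^sup>2 + \<epsilon>\<^sup>2 = \<epsilon>\<^sup>2 * ((1 - h) * v + 1)" unfolding s2[OF j] v_def[symmetric] by (simp add: algebra_simps)
        then show ?thesis unfolding s2[OF j] v_def[symmetric] using \<epsilon> by simp
      qed
      finally show "(1 - h) * \<epsilon>\<^sup>2 * W j \<le> (s j)\<^sup>2 * \<epsilon>\<^sup>2 / ((s j)\<^sup>2 + \<epsilon>\<^sup>2)" .
    qed
    finally show ?thesis .
  qed
  have "ennreal ((1 - h) * ((2 * \<beta> + 1) * \<kappa>\<^sup>2 - 2 * tr_Q * \<epsilon>\<^sup>2)) \<le> ennreal (\<Sum>j\<in>F. d (snd j) * ((s j)\<^sup>2 * \<epsilon>\<^sup>2 / ((s j)\<^sup>2 + \<epsilon>\<^sup>2)))"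
    by (rule ennreal_leI[OF bayes])
  also have "\<dots> \<le> max_risk \<beta> Q \<epsilon> \<delta> + ennreal (2 * D\<^sup>2 * (card F + 1) * exp (- t + (\<Sum>j\<in>F. t * \<tau> j + 4 * (t * \<tau> j)\<^sup>2)))"
    unfolding \<tau>_def
  proof (rule max_risk_lower_bound[OF \<delta> \<epsilon> \<beta>_pos finF _ s_pos D t1])
    show "F \<subseteq> {2..} \<times> UNIV" using F_sub by auto
    fix j assume "j \<in> F"
    from t\<tau>[OF this] h have "t * \<tau> j \<le> 1 / 4" by linarith
    then show "t * ((sobolev_weight \<beta> (fst j))\<^sup>2 * (s j)\<^sup>2 / d (snd j)) \<le> 1 / 4"
      unfolding \<tau>_def by simp
  qed
  also have "\<dots> \<le> max_risk \<beta> Q \<epsilon> \<delta> + ennreal ((2 * D\<^sup>2 * (real CARD('p) + 1) + 2 * D\<^sup>2 * real CARD('p) * D powr (1 / \<beta>) / \<kappa> powr (1 / \<beta>))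
        * exp (- (h\<^sup>2 / (32 * D)) * (\<kappa>\<^sup>2 / \<epsilon>\<^sup>2)))"
  proof (intro add_left_mono ennreal_leI mult_mono)
    have "2 * D\<^sup>2 * (card F + 1) \<le> 2 * D\<^sup>2 * (real CARD('p) * (H + 1) + 1)"
      using cardF by (intro mult_left_mono) auto
    also have "\<dots> = 2 * D\<^sup>2 * (real CARD('p) + 1) + 2 * D\<^sup>2 * real CARD('p) * H" by (simp add: algebra_simps)
    also have "H = D powr (1 / \<beta>) / \<kappa> powr (1 / \<beta>)" unfolding H_def using D0 \<kappa> by (simp add: powr_divide)
    finally show "2 * D\<^sup>2 * (card F + 1) \<le> 2 * D\<^sup>2 * (real CARD('p) + 1) + 2 * D\<^sup>2 * real CARD('p) * D powr (1 / \<beta>) / \<kappa> powr (1 / \<beta>)"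
      by simp
    show "exp (- t + (\<Sum>j\<in>F. t * \<tau> j + 4 * (t * \<tau> j)\<^sup>2)) \<le> exp (- (h\<^sup>2 / (32 * D)) * (\<kappa>\<^sup>2 / \<epsilon>\<^sup>2))"
      using expo by simp
  qed (auto intro!: add_nonneg_nonneg)
  finally show ?thesis unfolding \<kappa>_def .
qed

text \<open>In \<open>pinsker_prior_bound\<close> with \<open>h = \<eta> / 2\<close>, all corrections are negligible against \<open>\<kappa>\<^sup>2\<close>.\<close>

lemma minimax_risk_lower:
  assumes \<eta>: "0 < \<eta>" "\<eta> < 1"
  shows "\<forall>\<^sub>F \<epsilon> in at_right 0. ennreal ((1 - \<eta>) * ((2 * \<beta> + 1) * (level \<epsilon>)\<^sup>2)) \<le> minimax_risk \<beta> Q \<epsilon>"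
proof -
  define h where "h = \<eta> / 2"
  have h: "0 < h" "h < 1" using \<eta> by (auto simp: h_def)
  define D where "D = Max (range d)"
  have D: "d k \<le> D" for k unfolding D_def by simp
  have D0: "D > 0" using d_pos D by (meson less_le_trans)
  define err where "err = (\<lambda>\<epsilon>. (2 * D\<^sup>2 * (real CARD('p) + 1) + 2 * D\<^sup>2 * real CARD('p) * D powr (1 / \<beta>) / level \<epsilon> powr (1 / \<beta>))
        * exp (- (h\<^sup>2 / (32 * D)) * ((level \<epsilon>)\<^sup>2 / \<epsilon>\<^sup>2)))"
  have err0: "err \<epsilon> \<ge> 0" for \<epsilon> unfolding err_def by simp
  have l1: "((\<lambda>\<epsilon>. \<epsilon>\<^sup>2 / (level \<epsilon>)\<^sup>2) \<longlongrightarrow> 0) (at_right 0)" by (rule level_limits(1))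
  have l2: "((\<lambda>\<epsilon>. err \<epsilon> / (level \<epsilon>)\<^sup>2) \<longlongrightarrow> 0) (at_right 0)"
    unfolding err_def by (rule level_limits(4)) (use h D0 in simp)
  have "((\<lambda>\<epsilon>. (1 - h) * (2 * \<beta> + 1 - 2 * tr_Q * (\<epsilon>\<^sup>2 / (level \<epsilon>)\<^sup>2)) - err \<epsilon> / (level \<epsilon>)\<^sup>2)
      \<longlongrightarrow> (1 - h) * (2 * \<beta> + 1 - 2 * tr_Q * 0) - 0) (at_right 0)"
    by (intro tendsto_intros l1 l2)
  moreover have "(1 - \<eta>) * (2 * \<beta> + 1) < (1 - h) * (2 * \<beta> + 1 - 2 * tr_Q * 0) - 0"
    using \<eta> \<beta>_pos by (simp add: h_def)
  ultimately have e1: "\<forall>\<^sub>F \<epsilon> in at_right 0. (1 - \<eta>) * (2 * \<beta> + 1) < (1 - h) * (2 * \<beta> + 1 - 2 * tr_Q * (\<epsilon>\<^sup>2 / (level \<epsilon>)\<^sup>2)) - err \<epsilon> / (level \<epsilon>)\<^sup>2"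
    by (rule order_tendstoD(1))
  have e2: "\<forall>\<^sub>F \<epsilon> in at_right 0. c * (\<epsilon>\<^sup>2 / (level \<epsilon>)\<^sup>2) < h" for c
  proof -
    have "((\<lambda>\<epsilon>. c * (\<epsilon>\<^sup>2 / (level \<epsilon>)\<^sup>2)) \<longlongrightarrow> c * 0) (at_right 0)" by (intro tendsto_intros l1)
    then show ?thesis using h by (intro order_tendstoD(2)) auto
  qed
  have "\<forall>\<^sub>F \<epsilon> in at_right 0. (\<epsilon>::real) > 0" by (simp add: eventually_at_right_less)
  with e1 e2[of "8 * D"] e2[of "8 * tr_Q"] show ?thesis
  proof eventually_elim
    case (elim \<epsilon>)
    let ?\<kappa> = "level \<epsilon>"
    have \<kappa>: "?\<kappa> > 0" by (rule level_pos[OF elim(4)])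
    have le: "(1 - \<eta>) * ((2 * \<beta> + 1) * ?\<kappa>\<^sup>2) + err \<epsilon> \<le> (1 - h) * ((2 * \<beta> + 1) * ?\<kappa>\<^sup>2 - 2 * tr_Q * \<epsilon>\<^sup>2)"
    proof -
      have "?\<kappa>\<^sup>2 * ((1 - \<eta>) * (2 * \<beta> + 1)) \<le> ?\<kappa>\<^sup>2 * ((1 - h) * (2 * \<beta> + 1 - 2 * tr_Q * (\<epsilon>\<^sup>2 / ?\<kappa>\<^sup>2)) - err \<epsilon> / ?\<kappa>\<^sup>2)"
        using elim(1) by (intro mult_left_mono) auto
      also have "\<dots> = (1 - h) * ((2 * \<beta> + 1) * ?\<kappa>\<^sup>2 - 2 * tr_Q * \<epsilon>\<^sup>2) - err \<epsilon>"
      proof -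
        have "K * ((1 - h) * (b - 2 * tr_Q * (e / K)) - x / K) = (1 - h) * (b * K - 2 * tr_Q * e) - x" if "K \<noteq> 0" for K b e x
          using that by (simp add: field_simps)
        then show ?thesis using \<kappa> by simp
      qed
      finally show ?thesis by (simp add: mult_ac)
    qed
    have nn: "0 \<le> (1 - \<eta>) * ((2 * \<beta> + 1) * ?\<kappa>\<^sup>2)" using \<eta> \<beta>_pos by simp
    show ?case
      unfolding minimax_risk_def
    proof (rule INF_greatest)
      fix \<delta> :: "(nat \<Rightarrow> real^'p) \<Rightarrow> nat \<Rightarrow> real^'p" assume \<delta>: "\<delta> \<in> estimators"
      have "ennreal (err \<epsilon>) + ennreal ((1 - \<eta>) * ((2 * \<beta> + 1) * ?\<kappa>\<^sup>2)) = ennreal ((1 - \<eta>) * ((2 * \<beta> + 1) * ?\<kappa>\<^sup>2) + err \<epsilon>)"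
        using nn err0 by (simp add: add.commute)
      also have "\<dots> \<le> ennreal ((1 - h) * ((2 * \<beta> + 1) * ?\<kappa>\<^sup>2 - 2 * tr_Q * \<epsilon>\<^sup>2))" by (rule ennreal_leI[OF le])
      also have "\<dots> \<le> max_risk \<beta> Q \<epsilon> \<delta> + ennreal (err \<epsilon>)"
        unfolding err_def by (rule pinsker_prior_bound[OF elim(4) h D _ _ \<delta>]) (use elim in auto)
      finally have "ennreal (err \<epsilon>) + ennreal ((1 - \<eta>) * ((2 * \<beta> + 1) * ?\<kappa>\<^sup>2)) \<le> ennreal (err \<epsilon>) + max_risk \<beta> Q \<epsilon> \<delta>"
        by (simp add: add.commute)
      then show "ennreal ((1 - \<eta>) * ((2 * \<beta> + 1) * ?\<kappa>\<^sup>2)) \<le> max_risk \<beta> Q \<epsilon> \<delta>"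
        by (simp add: ennreal_add_left_cancel_le)
    qed
  qed
qed

end

lemma tendsto_1_ennrealI:
  fixes f :: "real \<Rightarrow> ennreal"
  assumes lo: "\<And>\<eta>. 0 < \<eta> \<Longrightarrow> \<eta> < 1 \<Longrightarrow> \<forall>\<^sub>F x in F. ennreal (1 - \<eta>) \<le> f x"
    and up: "\<And>\<eta>. 0 < \<eta> \<Longrightarrow> \<eta> < 1 \<Longrightarrow> \<forall>\<^sub>F x in F. f x \<le> ennreal (1 + \<eta>)"
  shows "(f \<longlongrightarrow> 1) F"
proof (rule order_tendstoI)
  fix a :: ennreal assume a: "a < 1"
  then obtain r where r: "a = ennreal r" "0 \<le> r" by (cases a) auto
  then have "r < 1" using a by (simp add: ennreal_less_iff flip: ennreal_1)
  define \<eta> where "\<eta> = (1 - r) / 2"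
  have \<eta>: "0 < \<eta>" "\<eta> < 1" "r < 1 - \<eta>" using r \<open>r < 1\<close> by (auto simp: \<eta>_def field_simps)
  have "a < ennreal (1 - \<eta>)" using r \<eta> by (simp add: ennreal_less_iff)
  with lo[OF \<eta>(1,2)] show "\<forall>\<^sub>F x in F. a < f x" by (auto elim!: eventually_mono intro: less_le_trans)
next
  fix a :: ennreal assume a: "1 < a"
  obtain \<eta> where \<eta>: "0 < \<eta>" "\<eta> < 1" "ennreal (1 + \<eta>) < a"
  proof (cases a)
    case (real r)
    then have "1 < r" using a by (simp add: ennreal_less_iff flip: ennreal_1)
    define \<eta> where "\<eta> = min (1 / 2) ((r - 1) / 2)"
    have "0 < \<eta>" "\<eta> < 1" "1 + \<eta> < r" using \<open>1 < r\<close> unfolding \<eta>_def by (auto simp: min_def field_simps)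
    then show ?thesis using real by (intro that[of \<eta>]) (simp_all add: ennreal_less_iff del: ennreal_plus)
  next
    case top
    then show ?thesis by (intro that[of "1 / 2"]) (simp_all add: ennreal_less_top)
  qed
  from up[OF \<eta>(1,2)] show "\<forall>\<^sub>F x in F. f x < a" using \<eta>(3) by (auto elim!: eventually_mono intro: le_less_trans)
qed

theorem theorem6p1:
  fixes Q :: "real^'p^'p" and \<beta> :: real
  assumes "CARD('p) > 1" and "\<beta> > 0" and "sym_pos_def Q"
  shows "((\<lambda>\<epsilon>. max_risk \<beta> Q \<epsilon> (bem \<epsilon>) / minimax_risk \<beta> Q \<epsilon>) \<longlongrightarrow> 1) (at_right 0) \<and>
    ((\<lambda>\<epsilon>. minimax_risk \<beta> Q \<epsilon> /
        ennreal (pinsker_const \<beta> Q * \<epsilon> powr (4 * \<beta> / (2 * \<beta> + 1)))) \<longlongrightarrow> 1) (at_right 0)"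
proof -
  obtain u d where "eigenframe Q u d" using sym_pos_def_eigenframe[OF assms(3)] .
  then interpret pinsker_problem Q u d \<beta>
    unfolding pinsker_problem_def pinsker_problem_axioms_def using assms(2) by blast
  define rt where "rt = (\<lambda>\<epsilon>. (2 * \<beta> + 1) * (level \<epsilon>)\<^sup>2)"
  have pos: "\<forall>\<^sub>F \<epsilon> in at_right 0. (\<epsilon>::real) > 0" by (simp add: eventually_at_right_less)
  have rt: "rt \<epsilon> > 0" if "\<epsilon> > 0" for \<epsilon> unfolding rt_def using level_pos[OF that] \<beta>_pos by simp
  have le: "minimax_risk \<beta> Q \<epsilon> \<le> max_risk \<beta> Q \<epsilon> (bem \<epsilon>)" for \<epsilon>
    unfolding minimax_risk_def by (rule INF_lower[OF bem_estimator])
  have low: "\<forall>\<^sub>F \<epsilon> in at_right 0. ennreal ((1 - \<eta>) * rt \<epsilon>) \<le> minimax_risk \<beta> Q \<epsilon>" if "0 < \<eta>" "\<eta> < 1" for \<eta>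
    unfolding rt_def by (rule minimax_risk_lower[OF that])
  have upp: "\<forall>\<^sub>F \<epsilon> in at_right 0. max_risk \<beta> Q \<epsilon> (bem \<epsilon>) \<le> ennreal ((1 + \<eta>) * rt \<epsilon>)" if "0 < \<eta>" for \<eta>
    unfolding rt_def by (rule max_risk_bem_upper[OF that])
  have div: "ennreal (c * rt \<epsilon>) / ennreal (rt \<epsilon>) = ennreal c" if "\<epsilon> > 0" "c \<ge> 0" for c \<epsilon>
    using rt[OF that(1)] that(2) by (simp add: divide_ennreal)
  have A: "((\<lambda>\<epsilon>. max_risk \<beta> Q \<epsilon> (bem \<epsilon>) / minimax_risk \<beta> Q \<epsilon>) \<longlongrightarrow> 1) (at_right 0)"
  proof (rule tendsto_1_ennrealI)
    fix \<eta> :: real assume \<eta>: "0 < \<eta>" "\<eta> < 1"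
    have fin: "\<forall>\<^sub>F \<epsilon> in at_right 0. 0 < minimax_risk \<beta> Q \<epsilon> \<and> minimax_risk \<beta> Q \<epsilon> < \<top>"
      using low[of "1 / 2", simplified] upp[of 1, simplified] pos
    proof eventually_elim
      case (elim \<epsilon>)
      have "0 < ennreal (rt \<epsilon> / 2)" using rt[OF elim(3)] by simp
      then show ?case using elim le[of \<epsilon>] by (meson ennreal_less_top le_less_trans less_le_trans)
    qed
    show "\<forall>\<^sub>F \<epsilon> in at_right 0. ennreal (1 - \<eta>) \<le> max_risk \<beta> Q \<epsilon> (bem \<epsilon>) / minimax_risk \<beta> Q \<epsilon>"
      using fin
    proof eventually_elim
      case (elim \<epsilon>)
      have "ennreal (1 - \<eta>) \<le> 1" using \<eta> by (simp flip: ennreal_1)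
      also have "1 = minimax_risk \<beta> Q \<epsilon> / minimax_risk \<beta> Q \<epsilon>"
        using elim by (intro ennreal_divide_self[symmetric]) auto
      also have "\<dots> \<le> max_risk \<beta> Q \<epsilon> (bem \<epsilon>) / minimax_risk \<beta> Q \<epsilon>" by (rule divide_right_mono_ennreal[OF le])
      finally show ?case .
    qed
    (* Small enough for (1 + \<eta>') / (1 - \<eta>') to stay below 1 + \<eta>. *)
    define \<eta>' where "\<eta>' = \<eta> / 4"
    have \<eta>': "0 < \<eta>'" "\<eta>' < 1" "1 + \<eta>' \<le> (1 + \<eta>) * (1 - \<eta>')"
    proof -
      show "0 < \<eta>'" "\<eta>' < 1" using \<eta> by (auto simp: \<eta>'_def)
      show "1 + \<eta>' \<le> (1 + \<eta>) * (1 - \<eta>')"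
      proof -
        have "\<eta> * \<eta> \<le> \<eta> * 1" using \<eta> by (intro mult_left_mono) auto
        then show ?thesis unfolding \<eta>'_def using \<eta> by (simp add: algebra_simps add_divide_distrib)
      qed
    qed
    show "\<forall>\<^sub>F \<epsilon> in at_right 0. max_risk \<beta> Q \<epsilon> (bem \<epsilon>) / minimax_risk \<beta> Q \<epsilon> \<le> ennreal (1 + \<eta>)"
      using low[OF \<eta>'(1,2)] upp[OF \<eta>'(1)] pos fin
    proof eventually_elim
      case (elim \<epsilon>)
      have "max_risk \<beta> Q \<epsilon> (bem \<epsilon>) \<le> ennreal ((1 + \<eta>') * rt \<epsilon>)" by (rule elim(2))
      also have "\<dots> \<le> ennreal ((1 + \<eta>) * (1 - \<eta>') * rt \<epsilon>)"
        using \<eta>'(3) rt[OF elim(3)] by (intro ennreal_leI mult_right_mono) auto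
      also have "\<dots> = ennreal (1 + \<eta>) * ennreal ((1 - \<eta>') * rt \<epsilon>)"
        using \<eta> \<eta>' rt[OF elim(3)] by (subst ennreal_mult[symmetric]) (auto simp: mult.assoc)
      also have "\<dots> \<le> ennreal (1 + \<eta>) * minimax_risk \<beta> Q \<epsilon>" by (intro mult_left_mono elim(1)) simp
      finally have "max_risk \<beta> Q \<epsilon> (bem \<epsilon>) / minimax_risk \<beta> Q \<epsilon>
          \<le> ennreal (1 + \<eta>) * minimax_risk \<beta> Q \<epsilon> / minimax_risk \<beta> Q \<epsilon>"
        by (rule divide_right_mono_ennreal)
      also have "\<dots> = ennreal (1 + \<eta>)"
        using elim(4) by (intro ennreal_mult_divide_eq) auto
      finally show ?case .
    qed
  qed
  have B: "((\<lambda>\<epsilon>. minimax_risk \<beta> Q \<epsilon> / ennreal (rt \<epsilon>)) \<longlongrightarrow> 1) (at_right 0)"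
  proof (rule tendsto_1_ennrealI)
    fix \<eta> :: real assume \<eta>: "0 < \<eta>" "\<eta> < 1"
    show "\<forall>\<^sub>F \<epsilon> in at_right 0. ennreal (1 - \<eta>) \<le> minimax_risk \<beta> Q \<epsilon> / ennreal (rt \<epsilon>)"
      using low[OF \<eta>] pos
    proof eventually_elim
      case (elim \<epsilon>)
      have "ennreal (1 - \<eta>) = ennreal ((1 - \<eta>) * rt \<epsilon>) / ennreal (rt \<epsilon>)" using div[OF elim(2)] \<eta> by simp
      also have "\<dots> \<le> minimax_risk \<beta> Q \<epsilon> / ennreal (rt \<epsilon>)" by (rule divide_right_mono_ennreal[OF elim(1)])
      finally show ?case .
    qed
    show "\<forall>\<^sub>F \<epsilon> in at_right 0. minimax_risk \<beta> Q \<epsilon> / ennreal (rt \<epsilon>) \<le> ennreal (1 + \<eta>)"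
      using upp[OF \<eta>(1)] pos
    proof eventually_elim
      case (elim \<epsilon>)
      have "minimax_risk \<beta> Q \<epsilon> / ennreal (rt \<epsilon>) \<le> ennreal ((1 + \<eta>) * rt \<epsilon>) / ennreal (rt \<epsilon>)"
        by (rule divide_right_mono_ennreal) (use le elim in \<open>blast intro: order_trans\<close>)
      also have "\<dots> = ennreal (1 + \<eta>)" using div[OF elim(2)] \<eta> by simp
      finally show ?case .
    qed
  qed
  have "((\<lambda>\<epsilon>. minimax_risk \<beta> Q \<epsilon> / ennreal (pinsker_const \<beta> Q * \<epsilon> powr (4 * \<beta> / (2 * \<beta> + 1)))) \<longlongrightarrow> 1) (at_right 0)"
    by (rule Lim_transform_eventually[OF B])
      (use pos in \<open>eventually_elim, simp only: pinsker_const_level rt_def\<close>)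
  with A show ?thesis by blast
qed

end
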